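(* Let $\{p_d\}_{d=1}^\infty$ be a sequence of monic polynomials, $\deg p_d=d$, with only non-negative roots, such that $\mu_{p_d}$ converges weakly as $d\to\infty$ to a compactly supported probability measure $\mu_p$ and such that all roots of all the $p_d$ are bounded in absolute value by a single constant $C>0$. Let $n=n_d>-1$ be real (possibly depending on $d$), let $M_n=xD^2+(n+1)D$ with $D=\frac{d}{dx}$, and for $j\in\{1,\dots,d\}$ let $$p_{j,d}(x)=\frac{1}{(d)_j(n+d)_j}M_n^jp_d(x).$$ (A) Assume $\ell=d-j$ is fixed. (A1) If $n>-1$ is fixed and the first moment of $\mu_p$ is $1$, then $\lim_{d\to\infty}\mathcal{D}_{d+n}\,p_{j,d}(x)\approx L^{(n)}_\ell(x)$, uniformly on compact subsets. (A2) If $n\to\infty$ as $d\to\infty$ and the first moment of $\mu_p$ is $1$, then $\lim_{d\to\infty}\mathcal{D}_{\frac{d+n}{n}}\,p_{j,d}(x)=(x-1)^\ell$, uniformly on compact subsets. (B) Assume $\ell=d-j\to\infty$ and $\ell=o(d)$. (B1) If $-1<n=o(\ell)$ and the first moment of $\mu_p$ is $1$, then the empirical root measures of $\mathcal{D}_{\frac{d+n}{n+\ell}}\,p_{j,d}$ converge weakly as $d\to\infty$ to $\nu_1$, the Marchenko--Pastur distribution with rate $1$ and mean $1$. (B2) If $n\sim\alpha\ell$ for some $\alpha\in(0,\infty)$ and the first moment of $\mu_p$ is $1$, then the empirical root measures of $\mathcal{D}_{\frac{d+n}{n+\ell}}\,p_{j,d}$ converge weakly as $d\to\infty$ to $\nu_\alpha$,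 the push-forward of the Marchenko--Pastur distribution with rate $1+\alpha$ by $t\mapsto\frac{1}{1+\alpha}t$. (C) Assume $d-j\sim td$ for some $t\in(0,1)$. (C1) If $-1<n=o(d)$, then weakly $\lim_{d\to\infty}\sqrt{\mu_{p_{j,d}}}=\mathcal{D}_t\sqrt{\mu_p}^{\,\boxplus_1\frac1t}$. (C2) If $n\sim\alpha d$ for some $\alpha\in(0,\infty)$, then $\sqrt{\mu_{p_{j,d}}}$ converges weakly to a probability measure $\mu_{\alpha,t}$ whose rectangular $R$-transform $C_{t,\alpha}$ with ratio $\frac{t}{t+\alpha}$ satisfies $$C_{t,\alpha}(z)=\frac1t\,C_\alpha\Big(t\,\frac{\alpha+t}{\alpha+1}\,z\Big),$$ where $C_\alpha$ is the rectangular $R$-transform with ratio $\frac{1}{1+\alpha}$ of $\sqrt{\mu_p}$.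
   Context: $(a)_k=a(a-1)\cdots(a-k+1)$ is the falling factorial. For a degree $d$ polynomial $p$ with real roots $y_1,\dots,y_d$, $\mu_p=\frac1d\sum_j\delta_{y_j}$ is its empirical root measure. For $a>0$, $\mathcal{D}_ap(x)=a^dp(x/a)$ for a degree $d$ polynomial $p$ (roots multiplied by $a$), and $\mathcal{D}_a\mu$ is the push-forward of the measure $\mu$ by $t\mapsto at$. For polynomials, $p\approx q$ means $p=cq$ for a constant $c\ne0$. $a_d\sim b_d$ means $a_d/b_d\to1$. Laguerre polynomials: $L^{(n)}_\ell(x)=\sum_{k=0}^\ell\frac{(-1)^k(\ell+n)_{\ell-k}}{k!(\ell-k)!}x^k$. The Marchenko--Pastur distribution with rate $c\ge1$ has density $\frac{\sqrt{4c-(x-1-c)^2}}{2\pi x}$ on $[(1-\sqrt c)^2,(1+\sqrt c)^2]$. For a measure $\mu$ on $[0,\infty)$, $\sqrt\mu$ is the symmetrization of the push-forward of $\mu$ by $t\mapsto\sqrt t$ (so for $p$ with roots $\alpha_1^2,\dots,\alpha_d^2$, $\sqrt{\mu_p}=\frac1{2d}\sum_j(\delta_{\alpha_j}+\delta_{-\alpha_j})$). Rectangular $R$-transform with ratio $\lambda\in(0,1]$ of a symmetric probability measure $\mu$ on $\mathbb{R}$: let $M_{\mu^2}(z)=\int\frac{zt^2}{1-t^2z}d\mu(t)$, $H_\mu(z)=z(\lambda M_{\mu^2}(z)+1)(M_{\mu^2}(z)+1)$, which is invertible on $(-\beta,0)$ for some small $\beta>0$, and $U(z)=\frac{-\lambda-1+\sqrt{(\lambda+1)^2+4\lambda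 z}}{2\lambda}$ near $0$; then $C^\lambda_\mu(z)=U\big(\frac{z}{H_\mu^{-1}(z)}-1\big)$. For compactly supported $\mu$ it extends analytically to a neighborhood of $0$, with $C_\mu^\lambda(0)=0$. The rectangular free convolution $\mu\boxplus_\lambda\nu$ is the unique symmetric probability measure with $C^\lambda_{\mu\boxplus_\lambda\nu}=C^\lambda_\mu+C^\lambda_\nu$, and $\mu^{\boxplus_\lambda k}$ (real $k\ge1$) denotes the symmetric probability measure with $C^\lambda=k\,C^\lambda_\mu$. *)

theory Defs
  imports
    "HOL-Probability.Probability"
    "HOL-Computational_Algebra.Computational_Algebra"
    "HOL-Library.Landau_Symbols"
begin

section \<open>Polynomials\<close>

definition falling :: "real \<Rightarrow> nat \<Rightarrow> real" where
  "falling a k = (\<Prod>i<k. a - real i)"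

definition laguerre :: "real \<Rightarrow> nat \<Rightarrow> real poly" where
  "laguerre n l =
     (\<Sum>k\<le>l. monom ((-1) ^ k * falling (real l + n) (l - k) / (fact k * fact (l - k))) k)"

definition dilate_poly :: "real \<Rightarrow> real poly \<Rightarrow> real poly" where
  "dilate_poly a p = smult (a ^ degree p) (pcompose p [:0, 1 / a:])"

definition proportional :: "real poly \<Rightarrow> real poly \<Rightarrow> bool" (infix \<open>\<approx>\<close> 50) where
  "p \<approx> q \<longleftrightarrow> (\<exists>c. c \<noteq> 0 \<and> p = smult c q)"

definition M_op :: "real \<Rightarrow> real poly \<Rightarrow> real poly" where
  "M_op n p = [:0, 1:] * pderiv (pderiv p) + smult (n + 1) (pderiv p)"

definition p_jd :: "real \<Rightarrow> nat \<Rightarrow> nat \<Rightarrow> real poly \<Rightarrow> real poly" where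
  "p_jd n j d p = smult (1 / (falling (real d) j * falling (n + real d) j)) ((M_op n ^^ j) p)"

abbreviation cpoly :: "real poly \<Rightarrow> complex \<Rightarrow> complex" where
  "cpoly p \<equiv> poly (map_poly of_real p)"

definition unif_compact_limit :: "(nat \<Rightarrow> real poly) \<Rightarrow> real poly \<Rightarrow> bool" where
  "unif_compact_limit q r \<longleftrightarrow>
     (\<forall>K. compact K \<longrightarrow> uniform_limit K (\<lambda>d. cpoly (q d)) (cpoly r) sequentially)"


section \<open>Measures\<close>

text \<open>The roots counted by \<^const>\<open>proots\<close> are the real ones (with multiplicity), whereas the
  normalisation is by the degree; so the total mass is 1 exactly when the (nonconstant) polynomial
  has only real roots.\<close>

definition root_measure :: "real poly \<Rightarrow> real measure" where
  "root_measure p = measure_of UNIV (sets borel)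
     (\<lambda>A. (\<Sum>y\<in>#proots p. indicator A y) / of_nat (degree p))"

definition dilate_measure :: "real \<Rightarrow> real measure \<Rightarrow> real measure" where
  "dilate_measure a \<mu> = distr \<mu> borel (\<lambda>x. a * x)"

definition symmetrization :: "real measure \<Rightarrow> real measure" where
  "symmetrization \<sigma> = measure_of UNIV (sets borel)
     (\<lambda>A. (emeasure \<sigma> A + emeasure (distr \<sigma> borel uminus) A) / 2)"

text \<open>Meaningful for measures concentrated on \<open>[0, \<infinity>)\<close> (\<^const>\<open>sqrt\<close> is an odd function).\<close>

definition sqrt_measure :: "real measure \<Rightarrow> real measure" where
  "sqrt_measure \<mu> = symmetrization (distr \<mu> borel sqrt)"

definition symmetric_distribution :: "real measure \<Rightarrow> bool" where
  "symmetric_distribution \<mu> \<longleftrightarrow> real_distribution \<mu> \<and> distr \<mu> borel uminus = \<mu>"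

definition compactly_supported :: "real measure \<Rightarrow> bool" where
  "compactly_supported \<mu> \<longleftrightarrow> (\<exists>K. compact K \<and> emeasure \<mu> (- K) = 0)"

definition marchenko_pastur :: "real \<Rightarrow> real measure" where
  "marchenko_pastur c = density lborel
     (\<lambda>x. ennreal (sqrt (4 * c - (x - 1 - c)\<^sup>2) / (2 * pi * x) *
             indicator {(1 - sqrt c)\<^sup>2..(1 + sqrt c)\<^sup>2} x))"

lemma sets_root_measure [simp, measurable_cong]: "sets (root_measure p) = sets borel"
  unfolding root_measure_def using sets.sigma_sets_eq[of "borel :: real measure"]
  by (simp add: space_borel)

lemma space_root_measure [simp]: "space (root_measure p) = UNIV"
  unfolding root_measure_def by (simp add: space_measure_of_conv)

lemma emeasure_root_measure:
  assumes "A \<in> sets borel"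
  shows "emeasure (root_measure p) A = (\<Sum>y\<in>#proots p. indicator A y) / of_nat (degree p)"
  unfolding root_measure_def
proof (rule emeasure_measure_of_sigma)
  show "sigma_algebra UNIV (sets (borel :: real measure))"
    using sets.sigma_algebra_axioms[of "borel :: real measure"] by simp
  show "positive (sets borel) (\<lambda>A. (\<Sum>y\<in>#proots p. indicator A y) / of_nat (degree p))"
    by (simp add: positive_def)
  show "countably_additive (sets borel)
          (\<lambda>A. (\<Sum>y\<in>#proots p. indicator A y) / of_nat (degree p) :: ennreal)"
  proof (rule countably_additiveI)
    fix A :: "nat \<Rightarrow> real set"
    assume A: "disjoint_family A"
    have "(\<Sum>i. \<Sum>y\<in>#N. indicator (A i) y) = (\<Sum>y\<in>#N. indicator (\<Union>i. A i) y :: ennreal)" for N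
      by (induction N) (simp_all add: suminf_add[symmetric] suminf_indicator[OF A])
    then show "(\<Sum>i. (\<Sum>y\<in>#proots p. indicator (A i) y) / of_nat (degree p)) =
        (\<Sum>y\<in>#proots p. indicator (\<Union>i. A i) y) / (of_nat (degree p) :: ennreal)"
      by (simp add: ennreal_suminf_divide)
  qed
qed (use assms in auto)

lemma sets_symmetrization [simp, measurable_cong]: "sets (symmetrization \<sigma>) = sets borel"
  unfolding symmetrization_def using sets.sigma_sets_eq[of "borel :: real measure"]
  by (simp add: space_borel)

lemma space_symmetrization [simp]: "space (symmetrization \<sigma>) = UNIV"
  unfolding symmetrization_def by (simp add: space_measure_of_conv)

lemma emeasure_symmetrization:
  assumes "sets \<sigma> = sets borel" "A \<in> sets borel"
  shows "emeasure (symmetrization \<sigma>) A =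
           (emeasure \<sigma> A + emeasure (distr \<sigma> borel uminus) A) / 2"
  unfolding symmetrization_def
proof (rule emeasure_measure_of_sigma)
  show "sigma_algebra UNIV (sets (borel :: real measure))"
    using sets.sigma_algebra_axioms[of "borel :: real measure"] by simp
  show "positive (sets borel) (\<lambda>A. (emeasure \<sigma> A + emeasure (distr \<sigma> borel uminus) A) / 2)"
    by (simp add: positive_def)
  show "countably_additive (sets borel)
          (\<lambda>A. (emeasure \<sigma> A + emeasure (distr \<sigma> borel uminus) A) / 2)"
  proof (rule countably_additiveI)
    fix A :: "nat \<Rightarrow> real set"
    assume A: "range A \<subseteq> sets borel" "disjoint_family A"
    show "(\<Sum>i. (emeasure \<sigma> (A i) + emeasure (distr \<sigma> borel uminus) (A i)) / 2) =
        (emeasure \<sigma> (\<Union>i. A i) + emeasure (distr \<sigma> borel uminus) (\<Union>i. A i)) / 2"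
      using suminf_emeasure[of A \<sigma>] suminf_emeasure[of A "distr \<sigma> borel uminus"] A assms(1)
      by (simp add: ennreal_suminf_divide suminf_add[symmetric])
  qed
qed (use assms in auto)


section \<open>The rectangular R-transform\<close>

definition rect_M :: "real measure \<Rightarrow> real \<Rightarrow> real" where
  "rect_M \<mu> z = (\<integral>t. z * t\<^sup>2 / (1 - t\<^sup>2 * z) \<partial>\<mu>)"

definition rect_H :: "real \<Rightarrow> real measure \<Rightarrow> real \<Rightarrow> real" where
  "rect_H r \<mu> z = z * (r * rect_M \<mu> z + 1) * (rect_M \<mu> z + 1)"

definition rect_U :: "real \<Rightarrow> real \<Rightarrow> real" where
  "rect_U r z = (- r - 1 + sqrt ((r + 1)\<^sup>2 + 4 * r * z)) / (2 * r)"

text \<open>The transform with ratio \<open>r\<close>. Only the germ of this function at \<open>0\<close> from the left is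
  meaningful. It does not depend on the choice of \<open>\<beta>\<close>, because \<open>rect_H r \<mu> z / z\<close>
  tends to \<open>1\<close> as \<open>z\<close> tends to \<open>0\<close> from the left.\<close>

definition rect_R :: "real \<Rightarrow> real measure \<Rightarrow> real \<Rightarrow> real" where
  "rect_R r \<mu> z =
     (let \<beta> = SOME \<beta>. \<beta> > 0 \<and> inj_on (rect_H r \<mu>) {-\<beta><..<0}
      in rect_U r (z / inv_into {-\<beta><..<0} (rect_H r \<mu>) z - 1))"

text \<open>\<open>C\<close> is the analytic extension of the transform to a neighbourhood of \<open>0\<close>; its germ at
  \<open>0\<close> is unique by the identity theorem.\<close>

definition is_rect_R :: "real \<Rightarrow> real measure \<Rightarrow> (complex \<Rightarrow> complex) \<Rightarrow> bool" where
  "is_rect_R r \<mu> C \<longleftrightarrow> C analytic_on {0} \<and> C 0 = 0 \<and>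
     (\<forall>\<^sub>F z in at_left 0. C (of_real z) = of_real (rect_R r \<mu> z))"

definition rect_power :: "real \<Rightarrow> real measure \<Rightarrow> real \<Rightarrow> real measure" where
  "rect_power r \<mu> k = (THE \<nu>. symmetric_distribution \<nu> \<and>
     (\<forall>\<^sub>F z in at_left 0. rect_R r \<nu> z = k * rect_R r \<mu> z))"

end

theory Submission
  imports Defs "HOL-Complex_Analysis.Complex_Analysis" "HOL-Real_Asymp.Real_Asymp"
begin

text \<open>
  Let \<open>M = x D\<^sup>2 + (n + 1) D\<close> and write \<open>p = P(M) x\<^sup>d\<close>. Then \<open>M\<^sup>j p\<close> is a multiple of
  \<open>P(M) x\<^bsup>d-j\<^esup>\<close>: passing from \<open>p\<close> to \<open>M\<^sup>j p\<close> only changes the degree and keeps the coefficients of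
  \<open>\<theta>P / P\<close>, the cumulants. The commutator relation \<open>[x D, M] = - M\<close> gives the exact identity
  \<open>x p' / p - d = - \<Sum>\<^sub>r r \<kappa>\<^sub>r M\<^sup>r p / p\<close>. As the degree tends to infinity, \<open>M\<^sup>r p / p\<close> in the variable
  \<open>w = 1 / x\<close> becomes, after normalisation, the \<open>r\<close>-th power of \<open>H(w) = w (\<rho> m(w) + 1) (m(w) + 1)\<close>,
  where \<open>m\<close> is the moment series of the roots. So in the limit \<open>m = C o H\<close> with \<open>C\<close> the normalised
  cumulant series, which is therefore the rectangular R-transform. Convergence of moments and of
  cumulants are equivalent, and changing \<open>d\<close> to \<open>d - j\<close> rescales \<open>C\<close>; if \<open>d - j = o(d)\<close> only the
  first cumulant survives, which is the Marchenko--Pastur case \<open>m = H\<close>. For \<open>d - j\<close> fixed, Newton's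
  identities give the limits of the coefficients directly. Weak convergence follows from the
  convergence of moments. Since \<open>rect_power\<close> quantifies over all symmetric distributions, the
  R-transform is shown to determine the measure without assuming any moments.
\<close>

unbundle no vec_syntax

section \<open>The operator on power series\<close>

text \<open>The powers of H come from conjugation by p. Dividing by p turns x D into d times g
  \<mapsto> (1 + m) g - \<theta>g / d, so the normalised M becomes multiplication by a finite-degree
  version of H plus derivative terms with weights 1 / d and 1 / (n + d). At a fixed index these
  terms vanish in the limit, and the r-fold iterate tends to H^r. The algebra is done
  coefficientwise on formal power series. The symbol of p is meaningful only up to index d, so the
  identities at finite degree are truncated; every fixed index is covered eventually. The analytic
  input is a Gauss--Lucas argument: M keeps all roots in [0, C]. When l is proportional to d this
  gives tightness and hence a limit law. When l = o(d) with l tending to infinity, the dilation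
  factor is unbounded. There the limit law is given explicitly, and the method of moments is set up
  so that only the limit law has to have bounded support.\<close>

definition fps_theta :: "'a::comm_semiring_1 fps \<Rightarrow> 'a fps" where
  "fps_theta f = fps_X * fps_deriv f"

lemma fps_theta_nth [simp]: "fps_theta f $ k = of_nat k * f $ k"
  by (cases k) (simp_all add: fps_theta_def)

lemma fps_theta_mult: "fps_theta (f * g) = fps_theta f * g + f * fps_theta g"
  by (simp add: fps_theta_def algebra_simps)

lemma fps_theta_1 [simp]: "fps_theta 1 = 0"
  by (simp add: fps_theta_def)

text \<open>A polynomial \<open>p\<close> of degree \<open>d\<close> is encoded by the series of \<open>w\<^sup>d p(1/w)\<close>. In this
  encoding \<open>x D\<close> becomes \<open>d - \<theta>\<close> and \<^const>\<open>M_op\<close> becomes \<open>w (d - \<theta>) (n + d - \<theta>)\<close>; both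
  make sense for all real \<open>d\<close>.\<close>

definition fps_M :: "real \<Rightarrow> real \<Rightarrow> real fps \<Rightarrow> real fps" where
  "fps_M d n f = Abs_fps (\<lambda>k. if k = 0 then 0 else (d - real (k - 1)) * (n + d - real (k - 1)) * f $ (k - 1))"

text \<open>Each application shifts the index by one, and the factors met on the way from index k -
  r to k are consecutive, so they collect into two falling factorials.\<close>

lemma fps_M_funpow_nth:
  "(fps_M d n ^^ r) f $ k =
     (if k < r then 0 else falling (d - real (k - r)) r * falling (n + d - real (k - r)) r * f $ (k - r))"
proof (induction r arbitrary: k)
  case 0
  then show ?case by (simp add: falling_def)
next
  case (Suc r)
  show ?case
  proof (cases k)
    case 0
    then show ?thesis by (simp add: fps_M_def)
  next
    case [simp]: (Suc k')
    show ?thesis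
    proof (cases "k' < r")
      case False
      then have "real (k' - r) = real k' - real r" by (simp add: of_nat_diff)
      then show ?thesis using False Suc.IH[of k']
        by (simp add: fps_M_def falling_def algebra_simps)
    next
      case True
      then show ?thesis using Suc.IH[of k'] by (simp add: fps_M_def)
    qed
  qed
qed

text \<open>The conjugate of \<open>M / (d (n + d))\<close> by multiplication with \<open>f\<close>, where \<open>\<rho> = d / (n + d)\<close>,
  \<open>a = 1 / d\<close>, \<open>b = 1 / (n + d)\<close> and \<open>m = - \<theta>f / (d f)\<close> generates the moments of the roots.\<close>

definition M_step :: "real \<Rightarrow> real \<Rightarrow> real \<Rightarrow> real fps \<Rightarrow> real fps \<Rightarrow> real fps" where
  "M_step \<rho> a b m g = fps_X *
     (let h = (1 + m) * g - fps_const a * fps_theta g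
      in (1 + fps_const \<rho> * m) * h - fps_const b * fps_theta h)"

lemma fps_M_eq:
  fixes d n :: real and F :: "real fps"
  defines "h \<equiv> fps_const d * F - fps_theta F"
  shows "fps_M d n F = fps_X * (fps_const (n + d) * h - fps_theta h)"
  unfolding h_def by (rule fps_ext) (auto simp: fps_M_def right_diff_distrib, simp add: algebra_simps)

text \<open>By the product rule, d - \<theta> sends f g to d f ((1 + m) g - \<theta>g / d). The
  factor n + d - \<theta> acts in the same way with n + d in front; since \<theta>f is still
  measured in units of d, the series m then appears with the factor d / (n + d).\<close>

lemma fps_M_mult:
  assumes "d \<noteq> 0" "n + d \<noteq> 0" and m: "fps_theta f = - (fps_const d * (m * f))"
  shows "fps_M d n (f * g) = fps_const (d * (n + d)) * (f * M_step (d / (n + d)) (1 / d) (1 / (n + d)) m g)"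
proof -
  define e where "e = n + d"
  define c c' where "c = fps_const d" and "c' = fps_const e"
  have inv: "c * fps_const (1 / d) = 1" "c' * fps_const (1 / e) = 1"
    "c' * fps_const (d / e) = c"
    using assms by (auto simp: c_def c'_def e_def)
  have theta_const: "fps_theta (fps_const a * F) = fps_const a * fps_theta F" for a and F :: "real fps"
    by (simp add: fps_eq_iff)
  define h where "h = (1 + m) * g - fps_const (1 / d) * fps_theta g"
  have h: "c * h = c * (g + m * g) - fps_theta g"
    unfolding h_def using inv(1) by algebra
  have 1: "c * (f * h) = c * (f * g) - fps_theta (f * g)"
    using h m unfolding fps_theta_mult by (simp add: c_def[symmetric]) algebra
  have 2: "c' * (f * ((1 + fps_const (d / e) * m) * h - fps_const (1 / e) * fps_theta h)) =
      c' * (f * h) - fps_theta (f * h)"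
    using m inv(2,3) unfolding fps_theta_mult by (simp add: c_def[symmetric]) algebra
  have 3: "fps_theta (c * F) = c * fps_theta F" for F
    unfolding c_def by (rule theta_const)
  have "fps_M d n (f * g) = fps_X * (c' * (c * (f * g) - fps_theta (f * g)) - fps_theta (c * (f * g) - fps_theta (f * g)))"
    by (simp add: fps_M_eq c_def c'_def e_def)
  also have "\<dots> = fps_X * (c' * (c * (f * h)) - c * fps_theta (f * h))"
    by (simp flip: 1 add: 3)
  also have "\<dots> = c * c' * (f * (fps_X * ((1 + fps_const (d / e) * m) * h - fps_const (1 / e) * fps_theta h)))"
    using 2 by algebra
  also have "c * c' = fps_const (d * (n + d))"
    by (simp add: c_def c'_def e_def)
  finally show ?thesis
    by (simp add: M_step_def h_def e_def Let_def)
qed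

lemma fps_M_const: "fps_M d n (fps_const c * f) = fps_const c * fps_M d n f"
  by (rule fps_ext) (simp add: fps_M_def)

lemma fps_M_funpow_eq:
  assumes "d \<noteq> 0" "n + d \<noteq> 0" and m: "fps_theta f = - (fps_const d * (m * f))"
  shows "(fps_M d n ^^ r) f =
    fps_const ((d * (n + d)) ^ r) * (f * (M_step (d / (n + d)) (1 / d) (1 / (n + d)) m ^^ r) 1)"
proof (induction r)
  case (Suc r)
  have "(fps_M d n ^^ Suc r) f = fps_const ((d * (n + d)) ^ r) *
      fps_M d n (f * (M_step (d / (n + d)) (1 / d) (1 / (n + d)) m ^^ r) 1)"
    using Suc by (simp add: fps_M_const)
  also have "\<dots> = fps_const ((d * (n + d)) ^ Suc r) *
      (f * (M_step (d / (n + d)) (1 / d) (1 / (n + d)) m ^^ Suc r) 1)"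
    unfolding fps_M_mult[OF assms] by (simp add: mult_ac)
  finally show ?case .
qed auto

lemma M_step_0: "M_step \<rho> a b m g $ 0 = 0"
  by (simp add: M_step_def)

text \<open>Every step multiplies by \<open>fps_X\<close>, and its other operations do not lower the
  order. This is what ends the sum in \<open>moment_cumulant_exact\<close> at r = k.\<close>

lemma M_step_funpow_nth_eq_0:
  "k < r \<Longrightarrow> (M_step \<rho> a b m ^^ r) g $ k = 0"
proof (induction r arbitrary: k)
  case (Suc r)
  show ?case
  proof (cases k)
    case (Suc k')
    define g' where "g' = (M_step \<rho> a b m ^^ r) g"
    define h where "h = (1 + m) * g' - fps_const a * fps_theta g'"
    have g': "g' $ i = 0" if "i \<le> k'" for i
      using Suc.IH[of i] Suc Suc.prems that by (simp add: g'_def)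
    then have h: "h $ i = 0" if "i \<le> k'" for i
      using that by (simp add: h_def fps_mult_nth)
    have "(M_step \<rho> a b m ^^ Suc r) g $ k = ((1 + fps_const \<rho> * m) * h - fps_const b * fps_theta h) $ k'"
      by (simp add: M_step_def Suc flip: g'_def h_def)
    also have "\<dots> = 0"
      unfolding fps_sub_nth fps_mult_nth using h by simp
    finally show ?thesis .
  qed (simp add: M_step_0)
qed simp

text \<open>Multiplication by the inverse of f is triangular in the coefficients, so cancellation is
  compatible with identities that hold only up to some index.\<close>

lemma fps_mult_left_cancel_upto:
  fixes f :: "'a::field fps"
  assumes "f $ 0 \<noteq> 0" and eq: "\<And>k. k \<le> N \<Longrightarrow> (f * g) $ k = (f * h) $ k" and "k \<le> N"
  shows "g $ k = h $ k"
proof -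
  have "inverse f * (f * g) = g" "inverse f * (f * h) = h"
    using inverse_mult_eq_1[OF assms(1)] by (simp_all flip: mult.assoc)
  moreover have "(inverse f * (f * g)) $ k = (inverse f * (f * h)) $ k"
    unfolding fps_mult_nth[of "inverse f"] using eq \<open>k \<le> N\<close> by (intro sum.cong) auto
  ultimately show ?thesis by metis
qed

text \<open>The symbol is the series \<open>P\<close> with \<open>p = P(M) x\<^sup>d\<close>. Its coefficients beyond index \<open>d\<close> are
  junk (division by zero), so all identities are stated for indices up to \<open>d\<close>.\<close>

definition symbol :: "real \<Rightarrow> real \<Rightarrow> real fps \<Rightarrow> real fps" where
  "symbol d n f = Abs_fps (\<lambda>k. f $ k / (falling d k * falling (n + d) k))"

definition log_symbol :: "real \<Rightarrow> real \<Rightarrow> real fps \<Rightarrow> real fps" where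
  "log_symbol d n f = fps_theta (symbol d n f) * inverse (symbol d n f)"

text \<open>The factor (d (n + d))^r is the one that \<open>fps_M_funpow_eq\<close> extracts from
  the r-th iterate; the sign and the division by d match \<theta>f = - d m f.\<close>

definition cumulant :: "real \<Rightarrow> real \<Rightarrow> real fps \<Rightarrow> nat \<Rightarrow> real" where
  "cumulant d n f r = - (log_symbol d n f $ r * (d * (n + d)) ^ r / d)"

lemma falling_add: "falling a (i + j) = falling a i * falling (a - real i) j"
  by (induction j) (simp_all add: falling_def algebra_simps)

lemma falling_pos:
  assumes "a > real k - 1"
  shows "falling a k > 0"
  unfolding falling_def using assms by (intro prod_pos) auto

lemma log_symbol_mult:
  assumes "f $ 0 = 1"
  shows "log_symbol d n f * symbol d n f = fps_theta (symbol d n f)"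
proof -
  have "symbol d n f $ 0 \<noteq> 0" using assms by (simp add: symbol_def falling_def)
  from inverse_mult_eq_1[OF this] show ?thesis by (simp add: log_symbol_def mult.assoc)
qed

lemma log_symbol_0: "log_symbol d n f $ 0 = 0"
  by (simp add: log_symbol_def)

text \<open>Since \<open>[x D, M] = - M\<close>, applying \<open>x D\<close> to \<open>P(M) x\<^sup>d\<close> gives
  \<open>(x D - d) p = - (\<theta>P / P)(M) p\<close>; dividing by \<open>p\<close> expresses the moments by the cumulants.\<close>

lemma moment_cumulant_exact:
  fixes d :: nat and n :: real
  assumes d: "d \<ge> 1" and n: "n > -1" and f0: "f $ 0 = 1"
    and m: "fps_theta f = - (fps_const (real d) * (m * f))" and "k \<le> d"
  shows "m $ k = (\<Sum>r\<le>k. cumulant d n f r *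
           (M_step (d / (n + d)) (1 / d) (1 / (n + d)) m ^^ r) 1 $ k)"
proof -
  define K where "K = log_symbol d n f"
  define P where "P = symbol d n f"
  define A where "A = (\<lambda>r. (M_step (d / (n + d)) (1 / d) (1 / (n + d)) m ^^ r) 1)"
  define S where "S = (\<Sum>r\<le>d. fps_const (K $ r * (d * (n + d)) ^ r) * A r)"
  have nz: "real d \<noteq> 0" "n + d \<noteq> 0" using d n by auto
  have pos: "falling d i > 0" "falling (n + d) i > 0" if "i \<le> d" for i
    using that n by (auto intro!: falling_pos)
  have "fps_theta f $ i = (f * S) $ i" if "i \<le> d" for i
  proof -
    have "of_nat i * P $ i = (K * P) $ i"
      using log_symbol_mult[OF f0, of d n] by (simp add: K_def P_def)
    also have "\<dots> = (\<Sum>r\<le>i. K $ r * P $ (i - r))"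
      by (simp add: fps_mult_nth atLeast0AtMost)
    finally have "of_nat i * f $ i = (\<Sum>r\<le>i. K $ r * P $ (i - r)) * (falling d i * falling (n + d) i)"
      using pos[OF that] by (simp add: P_def symbol_def field_simps)
    also have "\<dots> = (\<Sum>r\<le>i. K $ r * (fps_M d n ^^ r) f $ i)"
      unfolding sum_distrib_right
    proof (intro sum.cong refl)
      fix r assume r: "r \<in> {..i}"
      then have "falling a i = falling a (i - r) * falling (a - real (i - r)) r" for a
        using falling_add[of a "i - r" r] by simp
      then show "K $ r * P $ (i - r) * (falling d i * falling (n + d) i) = K $ r * (fps_M d n ^^ r) f $ i"
        using less_imp_neq[OF pos(1)[of "i - r"]] less_imp_neq[OF pos(2)[of "i - r"]] that r
        by (simp add: fps_M_funpow_nth P_def symbol_def)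
    qed
    \<comment> \<open>With the range extended to d, the right-hand side is a coefficient of one
      series f S that is the same for all i, so that f can be cancelled. The added terms vanish
      because the r-th iterate has no coefficients below index r.\<close>
    also have "\<dots> = (\<Sum>r\<le>d. K $ r * (fps_M d n ^^ r) f $ i)"
      using that by (intro sum.mono_neutral_left) (auto simp: fps_M_funpow_nth)
    also have "\<dots> = (\<Sum>r\<le>d. fps_const (K $ r) * (fps_M d n ^^ r) f) $ i"
      by (simp add: fps_sum_nth)
    also have "(\<Sum>r\<le>d. fps_const (K $ r) * (fps_M d n ^^ r) f) = f * S"
      unfolding S_def sum_distrib_left fps_M_funpow_eq[OF nz m] A_def
      by (intro sum.cong refl) (simp add: algebra_simps flip: fps_const_mult)
    finally show ?thesis by simp
  qed
  then have "(f * (- (fps_const (real d) * m))) $ i = (f * S) $ i" if "i \<le> d" for i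
    using that unfolding m by (simp add: algebra_simps)
  then have "(- (fps_const (real d) * m)) $ k = S $ k"
    by (rule fps_mult_left_cancel_upto[OF _ _ \<open>k \<le> d\<close>, of f, rotated]) (simp_all add: f0)
  then have "m $ k = - S $ k / d"
    using d by (simp add: field_simps)
  also have "\<dots> = (\<Sum>r\<le>d. cumulant d n f r * A r $ k)"
    by (simp add: S_def cumulant_def fps_sum_nth sum_divide_distrib K_def flip: sum_negf)
  also have "\<dots> = (\<Sum>r\<le>k. cumulant d n f r * A r $ k)"
    unfolding A_def using \<open>k \<le> d\<close> by (intro sum.mono_neutral_right) (auto intro!: M_step_funpow_nth_eq_0)
  finally show ?thesis by (simp add: A_def)
qed

text \<open>The substitution w \<mapsto> a w commutes with \<theta> and with products, hence with P
  \<mapsto> \<theta>P / P. The bound N is there because a polynomial and its derivative share their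
  symbol only up to the smaller degree.\<close>

lemma log_symbol_scale_upto:
  assumes "f $ 0 = 1" "g $ 0 = 1"
    and eq: "\<And>k. k \<le> N \<Longrightarrow> symbol d' n' g $ k = a ^ k * symbol d n f $ k" and "k \<le> N"
  shows "log_symbol d' n' g $ k = a ^ k * log_symbol d n f $ k"
proof -
  define P where "P = symbol d n f"
  define K where "K = log_symbol d n f"
  define Q where "Q = symbol d' n' g"
  define L where "L = log_symbol d' n' g"
  define K' where "K' = Abs_fps (\<lambda>k. a ^ k * K $ k)"
  have PQ: "Q $ i = a ^ i * P $ i" if "i \<le> N" for i using eq that by (simp add: P_def Q_def)
  have "(Q * L) $ i = (Q * K') $ i" if "i \<le> N" for i
  proof -
    have "(Q * L) $ i = fps_theta Q $ i"
      using log_symbol_mult[OF assms(2), of d' n'] by (simp add: Q_def L_def mult.commute)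
    also have "\<dots> = a ^ i * fps_theta P $ i" using PQ[OF that] by (simp only: fps_theta_nth mult_ac)
    also have "\<dots> = a ^ i * (P * K) $ i"
      using log_symbol_mult[OF assms(1), of d n] by (simp add: P_def K_def mult.commute)
    also have "\<dots> = (\<Sum>s=0..i. a ^ s * P $ s * (a ^ (i - s) * K $ (i - s)))"
      unfolding fps_mult_nth sum_distrib_left
      by (intro sum.cong) (simp_all add: mult_ac flip: power_add)
    also have "\<dots> = (Q * K') $ i"
      unfolding fps_mult_nth using PQ that by (intro sum.cong) (auto simp: K'_def)
    finally show ?thesis .
  qed
  moreover have "Q $ 0 \<noteq> 0"
    using assms(2) by (simp add: Q_def symbol_def falling_def)
  ultimately have "L $ k = K' $ k"
    using \<open>k \<le> N\<close> fps_mult_left_cancel_upto by blast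
  then show ?thesis by (simp add: K_def L_def K'_def)
qed

section \<open>Coefficientwise limit of the conjugated operator\<close>

lemma tendsto_fps_mult_nth:
  fixes F G :: "'b \<Rightarrow> 'a::real_normed_field fps"
  assumes "\<And>i. i \<le> k \<Longrightarrow> ((\<lambda>d. F d $ i) \<longlongrightarrow> F' $ i) net" "\<And>i. i \<le> k \<Longrightarrow> ((\<lambda>d. G d $ i) \<longlongrightarrow> G' $ i) net"
  shows "((\<lambda>d. (F d * G d) $ k) \<longlongrightarrow> (F' * G') $ k) net"
  unfolding fps_mult_nth using assms by (intro tendsto_intros) auto

lemma M_step_zero: "M_step \<rho> 0 0 m g = fps_X * (1 + fps_const \<rho> * m) * (1 + m) * g"
  by (simp add: M_step_def mult.assoc)

lemma M_step_zero_funpow: "(M_step \<rho> 0 0 m ^^ r) 1 = (fps_X * (1 + fps_const \<rho> * m) * (1 + m)) ^ r"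
  by (induction r) (simp_all add: M_step_zero)

text \<open>The shift from i < k to i \<le> k is the point: because of the factor
  \<open>fps_X\<close>, coefficient k of the result depends only on coefficients below k of m and g.
  This makes the induction in \<open>moments_convergent\<close> possible.\<close>

lemma tendsto_M_step_nth:
  assumes "a \<longlonglongrightarrow> 0" "b \<longlonglongrightarrow> 0" "\<rho> \<longlonglongrightarrow> \<rho>'"
    and m: "\<And>i. i < k \<Longrightarrow> (\<lambda>d. m d $ i) \<longlonglongrightarrow> m' $ i"
    and g: "\<And>i. i < k \<Longrightarrow> (\<lambda>d. g d $ i) \<longlonglongrightarrow> g' $ i" and "i \<le> k"
  shows "(\<lambda>d. M_step (\<rho> d) (a d) (b d) (m d) (g d) $ i) \<longlonglongrightarrow> M_step \<rho>' 0 0 m' g' $ i"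
proof (cases i)
  case (Suc j)
  define h where "h d = (1 + m d) * g d - fps_const (a d) * fps_theta (g d)" for d
  define h' where "h' = (1 + m') * g' - fps_const 0 * fps_theta g'"
  have one: "(\<lambda>d. (1 + m d) $ i) \<longlonglongrightarrow> (1 + m') $ i" if "i < k" for i
    unfolding fps_add_nth by (intro tendsto_intros m that)
  have h: "(\<lambda>d. h d $ i) \<longlonglongrightarrow> h' $ i" if "i < k" for i
    unfolding h_def h'_def fps_sub_nth fps_mult_left_const_nth fps_theta_nth
    using that by (intro tendsto_intros tendsto_fps_mult_nth g one assms) auto
  have two: "(\<lambda>d. (1 + fps_const (\<rho> d) * m d) $ i) \<longlonglongrightarrow> (1 + fps_const \<rho>' * m') $ i" if "i < k" for i
    unfolding fps_add_nth fps_mult_left_const_nth by (intro tendsto_intros m assms that)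
  have "(\<lambda>d. ((1 + fps_const (\<rho> d) * m d) * h d - fps_const (b d) * fps_theta (h d)) $ j)
      \<longlonglongrightarrow> ((1 + fps_const \<rho>' * m') * h' - fps_const 0 * fps_theta h') $ j"
    unfolding fps_sub_nth[of "_ * _"] fps_mult_left_const_nth[of "b _"] fps_mult_left_const_nth[of "0::real"] fps_theta_nth
    using \<open>i \<le> k\<close> Suc by (intro tendsto_intros tendsto_fps_mult_nth h two assms) auto
  moreover have "M_step (\<rho> d) (a d) (b d) (m d) (g d) $ i =
      ((1 + fps_const (\<rho> d) * m d) * h d - fps_const (b d) * fps_theta (h d)) $ j" for d
    by (simp add: M_step_def Suc Let_def h_def)
  moreover have "M_step \<rho>' 0 0 m' g' $ i =
      ((1 + fps_const \<rho>' * m') * h' - fps_const 0 * fps_theta h') $ j"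
    by (simp add: M_step_def Suc Let_def h'_def)
  ultimately show ?thesis by simp
qed (simp add: M_step_0)

lemma tendsto_M_step_funpow_nth:
  assumes "a \<longlonglongrightarrow> 0" "b \<longlonglongrightarrow> 0" "\<rho> \<longlonglongrightarrow> \<rho>'"
    and m: "\<And>i. i < k \<Longrightarrow> (\<lambda>d. m d $ i) \<longlonglongrightarrow> m' $ i" and "i \<le> k"
  shows "(\<lambda>d. (M_step (\<rho> d) (a d) (b d) (m d) ^^ r) 1 $ i)
    \<longlonglongrightarrow> (fps_X * (1 + fps_const \<rho>' * m') * (1 + m')) ^ r $ i"
  using \<open>i \<le> k\<close>
proof (induction r arbitrary: i)
  case (Suc r)
  show ?case
    unfolding M_step_zero_funpow[symmetric] funpow.simps comp_def
    by (rule tendsto_M_step_nth[OF assms(1-4)]) (use Suc in \<open>auto simp: M_step_zero_funpow\<close>)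
qed auto

text \<open>In the limit \<open>A\<^sub>r = M_step\<^sup>r 1\<close> becomes \<open>H\<^sup>r\<close>, so the moment series is the composition of the
  cumulant series with \<open>H\<close>. Coefficient \<open>k\<close> of \<open>A\<^sub>r\<close> involves only the moments below \<open>k\<close> when
  \<open>r \<ge> 1\<close>, hence convergence passes in both directions.\<close>

locale moment_cumulant_limit =
  fixes m :: "nat \<Rightarrow> real fps" and c :: "nat \<Rightarrow> nat \<Rightarrow> real" and \<rho> a b :: "nat \<Rightarrow> real" and \<rho>' :: real
  assumes a: "a \<longlonglongrightarrow> 0" and b: "b \<longlonglongrightarrow> 0" and \<rho>: "\<rho> \<longlonglongrightarrow> \<rho>'"
    and exact: "\<And>k. \<forall>\<^sub>F d in sequentially.
      m d $ k = (\<Sum>r\<le>k. c d r * (M_step (\<rho> d) (a d) (b d) (m d) ^^ r) 1 $ k)"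
begin

abbreviation H where "H m' \<equiv> fps_X * (1 + fps_const \<rho>' * m') * (1 + m')"

lemma H_power_nth_same:
  assumes "m' $ 0 = 0"
  shows "H m' ^ k $ k = 1"
proof -
  have eq: "H m' ^ k = fps_X ^ k * ((1 + fps_const \<rho>' * m') * (1 + m')) ^ k"
    by (simp only: power_mult_distrib mult.assoc)
  show ?thesis
    unfolding eq fps_X_power_mult_nth using assms by (simp add: fps_power_zeroth)
qed

text \<open>The relation is triangular: coefficient k contains the cumulant of index k with a factor
  that tends to 1 by \<open>H_power_nth_same\<close>, and otherwise only smaller cumulants.
  Eventually one can divide by this factor and solve.\<close>

lemma cumulants_convergent:
  assumes c0: "\<And>d. c d 0 = 0" and m: "\<And>k. (\<lambda>d. m d $ k) \<longlonglongrightarrow> m' $ k"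
  shows "convergent (\<lambda>d. c d k)"
proof (induction k rule: less_induct)
  case (less k)
  have m'0: "m' $ 0 = 0"
  proof -
    have "\<forall>\<^sub>F d in sequentially. m d $ 0 = 0" using exact[of 0] by (simp add: c0)
    then have "(\<lambda>d. m d $ 0) \<longlonglongrightarrow> 0" by (rule tendsto_eventually)
    then show ?thesis using LIMSEQ_unique[OF m] by blast
  qed
  let ?A = "\<lambda>d r. (M_step (\<rho> d) (a d) (b d) (m d) ^^ r) 1 $ k"
  have A: "(\<lambda>d. ?A d r) \<longlonglongrightarrow> H m' ^ r $ k" for r
    by (rule tendsto_M_step_funpow_nth[OF a b \<rho> m order_refl])
  then have Ak: "(\<lambda>d. ?A d k) \<longlonglongrightarrow> 1"
    using A[of k] unfolding H_power_nth_same[OF m'0] by blast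
  define L where "L r = lim (\<lambda>d. c d r)" for r
  have L: "(\<lambda>d. c d r) \<longlonglongrightarrow> L r" if "r < k" for r
    using less[OF that] by (simp only: L_def convergent_LIMSEQ_iff)
  have "(\<lambda>d. (m d $ k - (\<Sum>r<k. c d r * ?A d r)) / ?A d k) \<longlonglongrightarrow> (m' $ k - (\<Sum>r<k. L r * H m' ^ r $ k)) / 1"
    by (intro tendsto_divide tendsto_diff tendsto_sum tendsto_mult m L A Ak) simp_all
  moreover have "\<forall>\<^sub>F d in sequentially. (m d $ k - (\<Sum>r<k. c d r * ?A d r)) / ?A d k = c d k"
    using exact[of k] tendsto_imp_eventually_ne[OF Ak zero_neq_one[symmetric]]
  proof eventually_elim
    case (elim d)
    have eq: "m d $ k = (\<Sum>r<k. c d r * ?A d r) + c d k * ?A d k"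
      using elim(1) unfolding lessThan_Suc_atMost[symmetric] sum.lessThan_Suc .
    have diff: "m d $ k - (\<Sum>r<k. c d r * ?A d r) = c d k * ?A d k"
      unfolding eq by (rule add_diff_cancel_left')
    show ?case
      unfolding diff by (rule nonzero_mult_div_cancel_right[OF elim(2)])
  qed
  ultimately show ?case
    by (intro convergentI) (rule Lim_transform_eventually)
qed

lemma moments_convergent:
  assumes "\<And>k. (\<lambda>d. c d k) \<longlonglongrightarrow> C $ k"
  shows "convergent (\<lambda>d. m d $ k)"
proof (induction k rule: less_induct)
  case (less k)
  \<comment> \<open>Only the coefficients of m' below k are known to be limits at this point;
    \<open>tendsto_M_step_funpow_nth\<close> asks for no more.\<close>
  define m' where "m' = Abs_fps (\<lambda>i. lim (\<lambda>d. m d $ i))"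
  have m: "(\<lambda>d. m d $ i) \<longlonglongrightarrow> m' $ i" if "i < k" for i
    using less[OF that] by (simp add: m'_def convergent_LIMSEQ_iff)
  have "(\<lambda>d. \<Sum>r\<le>k. c d r * (M_step (\<rho> d) (a d) (b d) (m d) ^^ r) 1 $ k) \<longlonglongrightarrow> (\<Sum>r\<le>k. C $ r * H m' ^ r $ k)"
    by (intro tendsto_intros assms tendsto_M_step_funpow_nth[OF a b \<rho> m order_refl])
  then have "(\<lambda>d. m d $ k) \<longlonglongrightarrow> (\<Sum>r\<le>k. C $ r * H m' ^ r $ k)"
    unfolding tendsto_cong[OF exact[of k]] .
  then show ?case by (rule convergentI)
qed

lemma limit_identity:
  assumes C: "\<And>k. (\<lambda>d. c d k) \<longlonglongrightarrow> C $ k" and m: "\<And>k. (\<lambda>d. m d $ k) \<longlonglongrightarrow> m' $ k"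
  shows "m' = fps_compose C (H m')"
proof (rule fps_ext)
  fix k
  have "(\<lambda>d. \<Sum>r\<le>k. c d r * (M_step (\<rho> d) (a d) (b d) (m d) ^^ r) 1 $ k) \<longlonglongrightarrow> (\<Sum>r\<le>k. C $ r * H m' ^ r $ k)"
    by (intro tendsto_intros C tendsto_M_step_funpow_nth[OF a b \<rho> m order_refl])
  then have "(\<lambda>d. m d $ k) \<longlonglongrightarrow> (\<Sum>r\<le>k. C $ r * H m' ^ r $ k)"
    unfolding tendsto_cong[OF exact[of k]] .
  then show "m' $ k = fps_compose C (H m') $ k"
    using LIMSEQ_unique[OF m] by (simp add: fps_compose_nth atLeast0AtMost)
qed

end

section \<open>Location of the roots\<close>

lemma map_poly_of_real_add: "map_poly of_real (p + q) = (map_poly of_real p + map_poly of_real q :: 'a::real_field poly)"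
  by (simp add: poly_eq_iff coeff_map_poly)

lemma map_poly_of_real_mult: "map_poly of_real (p * q) = (map_poly of_real p * map_poly of_real q :: 'a::real_field poly)"
  by (simp add: poly_eq_iff coeff_map_poly coeff_mult)

lemma poly_map_poly_of_real: "poly (map_poly of_real p) (of_real x) = (of_real (poly p x) :: 'a::real_field)"
  by (simp add: poly_altdef degree_map_poly coeff_map_poly)

lemma cpoly_prod_mset_linear: "cpoly (\<Prod>y\<in>#Y. [:-y, 1:]) z = (\<Prod>y\<in>#Y. z - of_real y)"
  by (induction Y) (simp_all add: map_poly_of_real_mult map_poly_pCons del: mult_pCons_left)

lemma prod_mset_linear_neq_0: "(\<Prod>y\<in>#Y. [:-y, 1:]) \<noteq> (0 :: 'a::idom poly)"
  by (induction Y) (auto simp del: mult_pCons_left)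

lemma proots_prod_mset_linear: "proots (\<Prod>y\<in>#Y. [:-y, 1:]) = (Y :: 'a::idom multiset)"
  proof (induction Y)
  case (add x Y)
  have "[:-x, 1:] \<noteq> 0" by simp
  with add show ?case
    unfolding image_mset_add_mset prod_mset.add_mset
    by (subst proots_mult) (use prod_mset_linear_neq_0[of Y] in \<open>simp_all only: proots_linear_factor minus_minus mult_eq_0_iff add_mset_add_single[of x Y] add.commute simp_thms\<close>)
qed simp

lemma degree_prod_mset_linear: "degree (\<Prod>y\<in>#Y. [:-y, 1 :: 'a::idom:]) = size Y"
  proof (induction Y)
  case (add x Y)
  have "[:-x, 1:] \<noteq> 0" by simp
  from degree_mult_eq[OF this prod_mset_linear_neq_0[of Y]] add show ?case
    unfolding image_mset_add_mset prod_mset.add_mset by (simp del: mult_pCons_left)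
qed simp

text \<open>The hypothesis speaks of complex roots, so algebraic closedness provides a root and the
  hypothesis makes it real. Splitting off the linear factor leaves a quotient whose roots are again
  roots of p.\<close>

lemma real_rooted_factorization:
  assumes "p \<noteq> 0" and "\<And>z. cpoly p z = 0 \<Longrightarrow> z \<in> of_real ` S"
  shows "p = smult (lead_coeff p) (\<Prod>y\<in>#proots p. [:-y, 1:]) \<and> set_mset (proots p) \<subseteq> S"
proof -
  have "\<exists>Y c. p = smult c (\<Prod>y\<in>#Y. [:-y, 1:]) \<and> set_mset Y \<subseteq> S"
    using assms
  proof (induction "degree p" arbitrary: p)
    case 0
    then obtain c where "p = [:c:]" using degree_eq_zeroE by metis
    then have "p = smult c (\<Prod>y\<in>#{#}. [:-y, 1:]) \<and> set_mset {#} \<subseteq> S" by simp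
    then show ?case by blast
  next
    case (Suc d)
    have "degree (map_poly of_real p :: complex poly) = Suc d"
      using Suc by (simp add: degree_map_poly)
    then obtain z where z: "cpoly p z = 0"
      using alg_closed_imp_poly_has_root[of "map_poly of_real p :: complex poly"] by auto
    then obtain y where y: "y \<in> S" "z = of_real y" using Suc.prems by blast
    then have "poly p y = 0" using z by (simp add: poly_map_poly_of_real)
    then obtain q where q: "p = [:-y, 1:] * q" by (auto simp: poly_eq_0_iff_dvd)
    then have "q \<noteq> 0" using Suc.prems by auto
    have "degree p = Suc (degree q)"
      using q \<open>q \<noteq> 0\<close> by (subst q, subst degree_mult_eq) auto
    then have "d = degree q" using Suc.hyps(2) by simp
    moreover have "w \<in> of_real ` S" if "cpoly q w = 0" for w
      using that by (intro Suc.prems) (simp add: q map_poly_of_real_mult del: mult_pCons_left)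
    ultimately obtain Y c where "q = smult c (\<Prod>y\<in>#Y. [:-y, 1:])" "set_mset Y \<subseteq> S"
      using Suc.hyps(1)[of q] \<open>q \<noteq> 0\<close> by blast
    then have "p = smult c (\<Prod>y\<in>#add_mset y Y. [:-y, 1:]) \<and> set_mset (add_mset y Y) \<subseteq> S"
      using q y by (simp del: mult_pCons_left)
    then show ?case by blast
  qed
  then obtain Y c where Y: "p = smult c (\<Prod>y\<in>#Y. [:-y, 1:])" "set_mset Y \<subseteq> S" by blast
  then have "c \<noteq> 0" using assms by auto
  then have "proots p = Y" using Y by (simp add: proots_prod_mset_linear)
  moreover have "lead_coeff (\<Prod>y\<in>#Y. [:-y, 1:]) = 1"
    by (induction Y) (auto simp: lead_coeff_mult simp del: mult_pCons_left)
  then have "lead_coeff p = c" using Y(1) lead_coeff_smult[of c] by (metis mult.right_neutral)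
  ultimately show ?thesis using Y by metis
qed

lemma cpoly_pderiv_prod_mset:
  assumes "\<And>y. y \<in># Y \<Longrightarrow> z \<noteq> of_real y"
  shows "cpoly (pderiv (\<Prod>y\<in>#Y. [:-y, 1:])) z =
    (\<Prod>y\<in>#Y. z - of_real y) * (\<Sum>y\<in>#Y. 1 / (z - of_real y))"
  using assms
proof (induction Y)
  case (add x Y)
  have "z - of_real x \<noteq> 0" using add.prems by auto
  with add show ?case
    by (simp add: pderiv_mult map_poly_of_real_mult map_poly_of_real_add cpoly_prod_mset_linear
          map_poly_pCons pderiv_pCons del: mult_pCons_left) (simp add: field_simps)
qed simp

text \<open>All the vectors \<open>1 / (z - y)\<close> with \<open>y\<close> in an interval avoiding \<open>z\<close> lie in one open
  half-plane, as in the Gauss--Lucas theorem.\<close>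

lemma half_plane_interval:
  fixes z :: complex
  assumes "z \<notin> of_real ` {0..C}"
  obtains u where "\<And>y. y \<in> {0..C} \<Longrightarrow> Re (u / (z - of_real y)) > 0"
proof -
  have nz: "(Re z - y)\<^sup>2 + (Im z)\<^sup>2 > 0" if "y \<in> {0..C}" for y
  proof -
    have "z \<noteq> of_real y" using assms that by blast
    then show ?thesis by (auto simp: complex_eq_iff sum_power2_gt_zero_iff)
  qed
  consider "Im z > 0" | "Im z < 0" | "Im z = 0" "Re z < 0" | "Im z = 0" "Re z > C"
    using assms complex_eq_iff[of z] by (force simp: image_iff)
  then show ?thesis
  proof cases
    case 1
    show ?thesis by (rule that[of \<i>]) (use 1 nz in \<open>simp add: Re_divide\<close>)
  next
    case 2
    show ?thesis by (rule that[of "-\<i>"]) (use 2 nz in \<open>simp add: Re_divide divide_neg_pos\<close>)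
  next
    case 3
    show ?thesis by (rule that[of "-1"]) (use 3 in \<open>auto simp: Re_divide intro!: divide_neg_pos\<close>)
  next
    case 4
    show ?thesis by (rule that[of 1]) (use 4 nz in \<open>simp add: Re_divide\<close>)
  qed
qed

lemma complex_Re_of_real_mult: "Re (of_real w * v) = w * Re v"
  by simp

lemma sum_mset_nonneg:
  fixes f :: "'a \<Rightarrow> real"
  assumes "\<And>x. x \<in># Y \<Longrightarrow> f x \<ge> 0"
  shows "(\<Sum>x\<in>#Y. f x) \<ge> 0"
  using assms by (induction Y) auto

text \<open>After multiplication by the u of \<open>half_plane_interval\<close> every summand has
  positive real part. The term w / z acts as an additional root 0 of weight w, which belongs to the
  interval as C \<ge> 0.\<close>

lemma sum_mset_inverse_nonzero:
  fixes z :: complex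
  assumes "z \<notin> of_real ` {0..C}" "set_mset Y \<subseteq> {0..C}" "w \<ge> 0" "C \<ge> 0" "Y \<noteq> {#} \<or> w > 0"
  shows "(\<Sum>y\<in>#Y. 1 / (z - of_real y)) + of_real w / z \<noteq> 0"
proof -
  obtain u where u: "\<And>y. y \<in> {0..C} \<Longrightarrow> Re (u / (z - of_real y)) > 0"
    using half_plane_interval[OF assms(1)] by blast
  have eq: "Re (u * (\<Sum>y\<in>#Y. 1 / (z - of_real y))) = (\<Sum>y\<in>#Y. Re (u / (z - of_real y)))"
    by (induction Y) (simp_all add: distrib_left)
  have nonneg: "(\<Sum>y\<in>#Y. Re (u / (z - of_real y))) \<ge> 0"
    using assms(2) u by (intro sum_mset_nonneg) (force intro: less_imp_le)
  have pos: "(\<Sum>y\<in>#Y. Re (u / (z - of_real y))) > 0" if nonempty: "Y \<noteq> {#}"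
  proof -
    obtain x X where Y: "Y = add_mset x X" using multi_nonempty_split[OF nonempty] by blast
    have "(\<Sum>y\<in>#X. Re (u / (z - of_real y))) \<ge> 0"
      using assms(2) u Y by (intro sum_mset_nonneg) (force intro: less_imp_le)
    moreover have "Re (u / (z - of_real x)) > 0" using assms(2) Y by (intro u) auto
    ultimately show ?thesis using Y by simp
  qed
  have "Re (u / z) > 0" using u[of 0] assms by simp
  moreover have "Re (u * (of_real w / z)) = w * Re (u / z)"
  proof -
    have "u * (of_real w / z) = of_real w * (u / z)" by simp
    then show ?thesis by (simp only: complex_Re_of_real_mult)
  qed
  moreover have "(\<Sum>y\<in>#Y. Re (u / (z - of_real y))) + w * Re (u / z) > 0"
    using assms(5)
  proof
    assume "Y \<noteq> {#}"
    then show ?thesis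
      using pos \<open>Re (u / z) > 0\<close> assms(3) by (intro add_pos_nonneg mult_nonneg_nonneg) auto
  next
    assume "w > 0"
    then show ?thesis
      using nonneg \<open>Re (u / z) > 0\<close> by (intro add_nonneg_pos mult_pos_pos) auto
  qed
  ultimately have "Re (u * ((\<Sum>y\<in>#Y. 1 / (z - of_real y)) + of_real w / z)) > 0"
    by (simp only: distrib_left plus_complex.sel eq)
  then show ?thesis by force
qed

text \<open>This is Gauss--Lucas for the convex set [0, C]. The formula for the logarithmic
  derivative is part of the conclusion because the next lemma applies it to p' and p''.\<close>

lemma pderiv_roots_interval:
  assumes "degree p \<ge> 1" "C \<ge> 0" and S: "\<And>z. cpoly p z = 0 \<Longrightarrow> z \<in> of_real ` {0..C}"
    and z: "z \<notin> of_real ` {0..C}"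
  shows "cpoly (pderiv p) z = cpoly p z * (\<Sum>y\<in>#proots p. 1 / (z - of_real y)) \<and>
    cpoly (pderiv p) z \<noteq> 0 \<and> set_mset (proots p) \<subseteq> {0..C}"
proof -
  define Y where "Y = proots p"
  have "p \<noteq> 0" using assms(1) by auto
  then have p: "p = smult (lead_coeff p) (\<Prod>y\<in>#Y. [:-y, 1:])" "set_mset Y \<subseteq> {0..C}"
    using real_rooted_factorization[OF _ S] by (simp_all add: Y_def)
  have "size Y = degree p"
    using \<open>p \<noteq> 0\<close> by (subst p) (simp add: degree_prod_mset_linear)
  then have "Y \<noteq> {#}" using assms(1) by auto
  have cp: "cpoly p z = of_real (lead_coeff p) * (\<Prod>y\<in>#Y. z - of_real y)"
    by (subst p(1)) (simp add: map_poly_smult cpoly_prod_mset_linear)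
  have "cpoly (pderiv p) z = of_real (lead_coeff p) * cpoly (pderiv (\<Prod>y\<in>#Y. [:-y, 1:])) z"
    by (subst p(1)) (simp add: map_poly_smult pderiv_smult)
  also have "\<dots> = cpoly p z * (\<Sum>y\<in>#Y. 1 / (z - of_real y))"
    using p(2) z by (subst cpoly_pderiv_prod_mset) (auto simp: cp)
  finally have eq: "cpoly (pderiv p) z = cpoly p z * (\<Sum>y\<in>#Y. 1 / (z - of_real y))" .
  moreover have "(\<Sum>y\<in>#Y. 1 / (z - of_real y)) + of_real 0 / z \<noteq> 0"
    using p(2) z assms(2) \<open>Y \<noteq> {#}\<close> by (intro sum_mset_inverse_nonzero) auto
  moreover have "cpoly p z \<noteq> 0" using S z by blast
  ultimately show ?thesis using p(2) by (simp add: Y_def)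
qed

text \<open>Away from the interval, M p = x p' (p'' / p' + (n + 1) / x). The bracket is the sum of 1
  / (x - y) over the roots y of p', plus a charge n + 1 at the origin, which is positive because n >
  -1.\<close>

lemma M_op_roots_interval:
  assumes "degree p \<ge> 1" "n > -1" "C \<ge> 0" and S: "\<And>z. cpoly p z = 0 \<Longrightarrow> z \<in> of_real ` {0..C}"
    and "cpoly (M_op n p) z = 0"
  shows "z \<in> of_real ` {0..C}"
proof (rule ccontr)
  assume z: "z \<notin> of_real ` {0..C}"
  have z0: "z \<noteq> 0" using z \<open>C \<ge> 0\<close> by force
  have S': "w \<in> of_real ` {0..C}" if "cpoly (pderiv p) w = 0" for w
    using pderiv_roots_interval[OF assms(1,3) S] that by metis
  define p' where "p' = pderiv p"
  have nz: "cpoly p' z \<noteq> 0" using S' z by (auto simp: p'_def)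
  have M: "cpoly (M_op n p) z = z * cpoly (pderiv p') z + of_real (n + 1) * cpoly p' z"
    by (simp add: M_op_def map_poly_of_real_add map_poly_of_real_mult map_poly_smult map_poly_pCons p'_def)
  have "\<exists>Y. cpoly (pderiv p') z = cpoly p' z * (\<Sum>y\<in>#Y. 1 / (z - of_real y)) \<and> set_mset Y \<subseteq> {0..C}"
  proof (cases "degree p' = 0")
    case True
    then have "pderiv p' = 0" by (simp add: pderiv_eq_0_iff)
    \<comment> \<open>A constant p' has no roots; in this case the charge at the origin alone keeps
      the bracket away from 0.\<close>
    then show ?thesis by (intro exI[of _ "{#}"]) simp
  next
    case False
    then show ?thesis
      using pderiv_roots_interval[of p' C z] S' z assms(3) by (auto simp: p'_def)
  qed
  then obtain Y where Y: "cpoly (pderiv p') z = cpoly p' z * (\<Sum>y\<in>#Y. 1 / (z - of_real y))"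
    "set_mset Y \<subseteq> {0..C}" by blast
  have "cpoly (M_op n p) z = cpoly p' z * z * ((\<Sum>y\<in>#Y. 1 / (z - of_real y)) + of_real (n + 1) / z)"
    using z0 by (simp add: M Y(1) field_simps)
  moreover have "(\<Sum>y\<in>#Y. 1 / (z - of_real y)) + of_real (n + 1) / z \<noteq> 0"
    using Y z assms by (intro sum_mset_inverse_nonzero) auto
  ultimately show False using assms(5) nz z0 by simp
qed

section \<open>Coefficients and symbols of the iterates of M\<close>

lemma coeff_M_op: "coeff (M_op n p) i = (real i + 1) * (real i + 1 + n) * coeff p (Suc i)"
  by (cases i) (simp_all add: M_op_def coeff_pderiv algebra_simps)

lemma coeff_M_op_funpow:
  "coeff ((M_op n ^^ j) p) i = falling (real (i + j)) j * falling (n + real (i + j)) j * coeff p (i + j)"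
  by (induction j arbitrary: i) (simp_all add: coeff_M_op falling_def algebra_simps)

definition rev_fps :: "real poly \<Rightarrow> real fps" where
  "rev_fps p = fps_of_poly (reflect_poly p)"

lemma rev_fps_nth: "rev_fps p $ k = (if k \<le> degree p then coeff p (degree p - k) else 0)"
  by (simp add: rev_fps_def coeff_reflect_poly)

lemma rev_fps_0: "rev_fps p $ 0 = lead_coeff p"
  by (simp add: rev_fps_nth)

context
  fixes n :: real and p :: "real poly" and d j :: nat
  assumes n: "n > -1" and deg: "degree p = d" and monic: "lead_coeff p = 1" and j: "j \<le> d"
begin

lemma p_jd_denominator_pos: "falling (real d) j > 0" "falling (n + real d) j > 0"
  using n j by (auto intro!: falling_pos)

lemma coeff_p_jd:
  "coeff (p_jd n j d p) i = falling (real (i + j)) j * falling (n + real (i + j)) j /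
     (falling (real d) j * falling (n + real d) j) * coeff p (i + j)"
  by (simp add: p_jd_def coeff_M_op_funpow)

lemma lead_coeff_p_jd: "coeff (p_jd n j d p) (d - j) = 1"
  using j p_jd_denominator_pos[THEN less_imp_neq] monic deg by (simp add: coeff_p_jd)

lemma degree_p_jd: "degree (p_jd n j d p) = d - j"
proof (rule antisym)
  show "degree (p_jd n j d p) \<le> d - j"
    using deg by (intro degree_le) (auto simp: coeff_p_jd coeff_eq_0)
  show "d - j \<le> degree (p_jd n j d p)"
    using lead_coeff_p_jd by (intro le_degree) simp
qed

lemma symbol_p_jd:
  assumes k: "k \<le> d - j"
  shows "symbol (real (d - j)) n (rev_fps (p_jd n j d p)) $ k = symbol (real d) n (rev_fps p) $ k"
proof -
  define i where "i = d - j - k"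
  have d: "d = i + j + k" and dj: "d - j = i + k" using k j by (auto simp: i_def)
  \<comment> \<open>Both sides equal \<open>falling a (k + j)\<close>, split in two orders. This
    exchanges the factors produced by the j-th iterate for the denominators in the two
    symbols.\<close>
  have split: "falling a k * falling (a - real k) j = falling a j * falling (a - real j) k" for a
    using falling_add[of a k j] falling_add[of a j k] by (simp add: add.commute)
  have 1: "falling (real d) k * falling (real (i + j)) j = falling (real d) j * falling (real (d - j)) k"
    using split[of "real d"] by (simp add: d algebra_simps)
  have 2: "falling (n + real d) k * falling (n + real (i + j)) j = falling (n + real d) j * falling (n + real (d - j)) k"
    using split[of "n + real d"] by (simp add: d algebra_simps)
  have pos: "falling (real d) k > 0" "falling (n + real d) k > 0" "falling (real d) j > 0" "falling (n + real d) j > 0"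
    "falling (real (d - j)) k > 0" "falling (n + real (d - j)) k > 0"
    using n j k by (auto intro!: falling_pos)
  have "rev_fps (p_jd n j d p) $ k = coeff (p_jd n j d p) i"
    using k by (simp add: rev_fps_nth degree_p_jd i_def)
  also have "\<dots> = (falling (real (i + j)) j / falling (real d) j) * (falling (n + real (i + j)) j / falling (n + real d) j) * coeff p (i + j)"
    by (simp only: coeff_p_jd) simp
  also have "falling (real (i + j)) j / falling (real d) j = falling (real (d - j)) k / falling (real d) k"
    using 1 pos by (simp add: field_simps)
  also have "falling (n + real (i + j)) j / falling (n + real d) j = falling (n + real (d - j)) k / falling (n + real d) k"
    using 2 pos by (simp add: field_simps)
  finally have eq: "rev_fps (p_jd n j d p) $ k = falling (real (d - j)) k / falling (real d) k *
      (falling (n + real (d - j)) k / falling (n + real d) k) * coeff p (i + j)" .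
  have "rev_fps p $ k = coeff p (i + j)"
    using k deg by (simp add: rev_fps_nth d)
  with eq show ?thesis
    using pos by (simp add: symbol_def field_simps)
qed

end

lemma M_op_funpow_roots_interval:
  assumes "n > -1" "C \<ge> 0" and S: "\<And>z. cpoly p z = 0 \<Longrightarrow> z \<in> of_real ` {0..C}"
    and "j \<le> degree p" "p \<noteq> 0"
  shows "cpoly ((M_op n ^^ j) p) z = 0 \<Longrightarrow> z \<in> of_real ` {0..C}"
  using \<open>j \<le> degree p\<close>
proof (induction j arbitrary: z)
  case 0
  then show ?case using S by simp
next
  case (Suc j)
  \<comment> \<open>A step of the induction needs an iterate that is not constant; here j < degree
    p, so its leading index is at least 1.\<close>
  have "coeff ((M_op n ^^ j) p) (degree p - j) \<noteq> 0"
    using Suc.prems(2) \<open>p \<noteq> 0\<close> \<open>n > -1\<close>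
    by (simp add: coeff_M_op_funpow less_imp_neq[OF falling_pos, symmetric])
  then have "degree ((M_op n ^^ j) p) \<ge> 1"
    using le_degree Suc.prems(2) by fastforce
  then show ?case
  proof (rule M_op_roots_interval[OF _ assms(1,2)])
    show "w \<in> of_real ` {0..C}" if "cpoly ((M_op n ^^ j) p) w = 0" for w
      using Suc.IH[OF that] Suc.prems(2) by simp
    show "cpoly (M_op n ((M_op n ^^ j) p)) z = 0"
      using Suc.prems(1) by simp
  qed
qed

lemma p_jd_roots_interval:
  assumes "n > -1" "C \<ge> 0" and S: "\<And>z. cpoly p z = 0 \<Longrightarrow> z \<in> of_real ` {0..C}"
    and "degree p = d" "lead_coeff p = 1" "j \<le> d" and z: "cpoly (p_jd n j d p) z = 0"
  shows "z \<in> of_real ` {0..C}"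
proof -
  have "cpoly ((M_op n ^^ j) p) z = 0"
    using z p_jd_denominator_pos[OF assms(1,4,5,6), THEN less_imp_neq] by (simp add: p_jd_def map_poly_smult)
  moreover have "p \<noteq> 0" using assms(5) by auto
  ultimately show ?thesis
    using M_op_funpow_roots_interval[OF assms(1,2) S] assms(4,6) by simp
qed

section \<open>Newton's identities as an identity of power series\<close>

definition moment_fps :: "real multiset \<Rightarrow> real fps" where
  "moment_fps Y = Abs_fps (\<lambda>k. if k = 0 then 0 else (\<Sum>y\<in>#Y. y ^ k) / size Y)"

lemma rev_fps_prod_mset: "rev_fps (\<Prod>y\<in>#Y. [:-y, 1:]) = (\<Prod>y\<in>#Y. 1 - fps_const y * fps_X)"
proof (induction Y)
  case (add y Y)
  have "reflect_poly [:-y, 1:] = [:1, -y:]"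
    by (simp add: reflect_poly_def)
  moreover have "fps_of_poly [:1, -y:] = 1 - fps_const y * fps_X"
    by (auto simp: fps_eq_iff coeff_pCons split: nat.split)
  ultimately have "rev_fps ([:-y, 1:] * q) = (1 - fps_const y * fps_X) * rev_fps q" for q
    by (simp only: rev_fps_def reflect_poly_mult fps_of_poly_mult)
  with add show ?case by (simp del: mult_pCons_left)
qed (simp add: rev_fps_def)

text \<open>The operation \<theta> on a product is additive after division by the product, and the
  factor 1 - y w contributes - y w / (1 - y w), whose geometric series without sign is
  \<open>G y\<close>. Summing over the roots gives the power sums.\<close>

lemma fps_theta_rev_fps:
  assumes "p = (\<Prod>y\<in>#Y. [:-y, 1:])" "Y \<noteq> {#}"
  shows "fps_theta (rev_fps p) = - (fps_const (real (size Y)) * (moment_fps Y * rev_fps p))"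
proof -
  define S where "S Y = Abs_fps (\<lambda>k. if k = 0 then 0 else (\<Sum>y\<in>#Y. y ^ k) :: real)" for Y
  define G :: "real \<Rightarrow> real fps" where "G y = Abs_fps (\<lambda>k. if k = 0 then 0 else y ^ k)" for y
  have G: "G y * (1 - fps_const y * fps_X) = fps_const y * fps_X" for y
  proof (rule fps_ext)
    fix k
    have "(G y * (1 - fps_const y * fps_X)) $ k = G y $ k - y * (if k = 0 then 0 else G y $ (k - 1))"
      by (simp add: right_diff_distrib mult.left_commute)
    also have "\<dots> = (fps_const y * fps_X) $ k"
      by (cases k; cases "k - 1") (auto simp: G_def)
    finally show "(G y * (1 - fps_const y * fps_X)) $ k = (fps_const y * fps_X) $ k" .
  qed
  have "fps_theta (\<Prod>y\<in>#Y. 1 - fps_const y * fps_X) = - (S Y * (\<Prod>y\<in>#Y. 1 - fps_const y * fps_X))" for Y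
  proof (induction Y)
    case empty
    have "S {#} = 0" by (simp add: S_def fps_eq_iff)
    then show ?case by simp
  next
    case (add y Y)
    define F where "F = (\<Prod>y\<in>#Y. 1 - fps_const y * fps_X :: real fps)"
    have S: "S (add_mset y Y) = G y + S Y"
      by (simp add: S_def G_def fps_eq_iff)
    have th: "fps_theta (1 - fps_const y * fps_X) = - (fps_const y * fps_X)"
      by (simp add: fps_eq_iff)
    have "fps_theta ((1 - fps_const y * fps_X) * F) = - (fps_const y * fps_X) * F + (1 - fps_const y * fps_X) * - (S Y * F)"
      using add by (simp only: fps_theta_mult th F_def)
    also have "\<dots> = - ((G y + S Y) * ((1 - fps_const y * fps_X) * F))"
      using G[of y] by algebra
    finally show ?case by (simp add: S F_def)
  qed
  moreover have "S Y = fps_const (real (size Y)) * moment_fps Y"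
    using assms(2) by (simp add: S_def moment_fps_def fps_eq_iff)
  ultimately show ?thesis
    by (simp add: assms(1) rev_fps_prod_mset mult.assoc)
qed

section \<open>Root measures and convergence of moments\<close>

lemma sum_mset_count:
  fixes f :: "'a \<Rightarrow> 'b::comm_semiring_1"
  shows "(\<Sum>y\<in>#Y. f y) = (\<Sum>y\<in>set_mset Y. of_nat (count Y y) * f y)"
proof (induction Y)
  case (add x Y)
  have "(\<Sum>y\<in>set_mset (add_mset x Y). of_nat (count (add_mset x Y) y) * f y) =
      (\<Sum>y\<in>insert x (set_mset Y). of_nat (count Y y) * f y + (if y = x then f y else 0))"
    by (intro sum.cong) (auto simp: algebra_simps)
  also have "\<dots> = (\<Sum>y\<in>insert x (set_mset Y). of_nat (count Y y) * f y) + f x"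
    by (simp add: sum.distrib)
  also have "(\<Sum>y\<in>insert x (set_mset Y). of_nat (count Y y) * f y) = (\<Sum>y\<in>set_mset Y. of_nat (count Y y) * f y)"
    by (rule sum.mono_neutral_right) (auto simp: not_in_iff)
  finally show ?case using add by (simp add: add.commute)
qed simp

context
  fixes p :: "real poly" and Y :: "real multiset"
  assumes Y: "proots p = Y" and size: "size Y = degree p" and nonempty: "Y \<noteq> {#}"
begin

text \<open>Integrals against the uniform distribution on a multiset are finite sums. Taking
  \<open>distr\<close> along the identity only exchanges the discrete sigma-algebra for the Borel
  one.\<close>

lemma root_measure_eq_distr: "root_measure p = distr (measure_pmf (pmf_of_multiset Y)) borel (\<lambda>x. x)"
proof (rule measure_eqI)
  fix A assume "A \<in> sets (root_measure p)"
  then have A: "A \<in> sets borel" by simp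
  have pos: "size Y > 0" using nonempty by (simp add: nonempty_has_size)
  have "emeasure (distr (measure_pmf (pmf_of_multiset Y)) borel (\<lambda>x. x)) A =
      emeasure (measure_pmf (pmf_of_multiset Y)) A"
    using A by (simp add: emeasure_distr)
  also have "\<dots> = (\<integral>\<^sup>+x. indicator A x \<partial>measure_pmf (pmf_of_multiset Y))"
    by simp
  also have "\<dots> = (\<Sum>y\<in>set_mset Y. indicator A y * ennreal (count Y y / size Y))"
    using nonempty by (subst nn_integral_measure_pmf_finite) simp_all
  also have "\<dots> = (\<Sum>y\<in>set_mset Y. (of_nat (count Y y) * indicator A y) / of_nat (size Y))"
    using pos by (intro sum.cong refl)
      (simp add: divide_ennreal[symmetric] ennreal_of_nat_eq_real_of_nat ennreal_times_divide mult.commute)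
  also have "\<dots> = (\<Sum>y\<in>#Y. indicator A y) / of_nat (size Y)"
    by (simp only: sum_mset_count divide_ennreal_def sum_distrib_right)
  finally show "emeasure (root_measure p) A = emeasure (distr (measure_pmf (pmf_of_multiset Y)) borel (\<lambda>x. x)) A"
    using A by (simp add: emeasure_root_measure Y size)
qed simp

lemma real_distribution_root_measure: "real_distribution (root_measure p)"
  unfolding root_measure_eq_distr by (rule prob_space.real_distribution_distr[OF prob_space_measure_pmf]) simp

lemma integral_root_measure:
  fixes f :: "real \<Rightarrow> real"
  assumes [measurable]: "f \<in> borel_measurable borel"
  shows "integrable (root_measure p) f" and "(\<integral>x. f x \<partial>root_measure p) = (\<Sum>y\<in>#Y. f y) / size Y"
proof -
  show "integrable (root_measure p) f"
    unfolding root_measure_eq_distr using nonempty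
    by (simp add: integrable_distr_eq integrable_measure_pmf_finite)
  have "(\<integral>x. f x \<partial>root_measure p) = (\<integral>x. f x \<partial>measure_pmf (pmf_of_multiset Y))"
    unfolding root_measure_eq_distr by (simp add: integral_distr)
  also have "\<dots> = (\<Sum>y\<in>set_mset Y. f y * (count Y y / size Y))"
    using nonempty by (subst integral_measure_pmf_real[of "set_mset Y"]) simp_all
  finally show "(\<integral>x. f x \<partial>root_measure p) = (\<Sum>y\<in>#Y. f y) / size Y"
    by (simp add: sum_mset_count sum_divide_distrib mult.commute)
qed

lemma AE_root_measure:
  assumes [measurable]: "Measurable.pred borel P" and "\<And>y. y \<in># Y \<Longrightarrow> P y"
  shows "AE x in root_measure p. P x"
  unfolding root_measure_eq_distr using assms nonempty
  by (simp add: AE_distr_iff AE_measure_pmf_iff)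

end

text \<open>Multiplying by an independent fair sign presents the symmetrization as the image of a
  product measure, so that its integrals can be computed by Fubini.\<close>

lemma symmetrization_eq_distr:
  assumes "real_distribution M"
  shows "symmetrization M =
    distr (measure_pmf (bernoulli_pmf (1 / 2)) \<Otimes>\<^sub>M M) borel (\<lambda>(b, x). if b then x else - x)"
proof (rule measure_eqI)
  interpret real_distribution M by fact
  let ?B = "measure_pmf (bernoulli_pmf (1 / 2))"
  fix A assume "A \<in> sets (symmetrization M)"
  then have [measurable]: "A \<in> sets borel" by simp
  have "emeasure (distr (?B \<Otimes>\<^sub>M M) borel (\<lambda>(b, x). if b then x else - x)) A =
      (\<integral>\<^sup>+z. indicator A ((\<lambda>(b, x). if b then x else - x) z) \<partial>(?B \<Otimes>\<^sub>M M))"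
    by (subst nn_integral_indicator[symmetric], simp, subst nn_integral_distr) simp_all
  also have "\<dots> = (\<integral>\<^sup>+b. \<integral>\<^sup>+x. indicator A (if b then x else - x) \<partial>M \<partial>?B)"
    by (subst nn_integral_fst[symmetric]) simp_all
  also have "\<dots> = (\<integral>\<^sup>+x. indicator A x \<partial>M) * ennreal (1 / 2) + (\<integral>\<^sup>+x. indicator A (- x) \<partial>M) * ennreal (1 - 1 / 2)"
    by (subst nn_integral_bernoulli_pmf) simp_all
  also have "(\<integral>\<^sup>+x. indicator A x \<partial>M) = emeasure M A"
    by simp
  also have "(\<integral>\<^sup>+x. indicator A (- x) \<partial>M) = emeasure (distr M borel uminus) A"
    by (subst nn_integral_indicator[symmetric], simp, subst nn_integral_distr) simp_all
  also have "emeasure M A * ennreal (1 / 2) + emeasure (distr M borel uminus) A * ennreal (1 - 1 / 2) =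
      emeasure (symmetrization M) A"
  proof -
    have "ennreal (1 / 2) = inverse 2" "ennreal (1 - 1 / 2) = inverse 2"
      using inverse_ennreal[of 2] by simp_all
    then show ?thesis
      by (simp only: emeasure_symmetrization[OF events_eq_borel \<open>A \<in> sets borel\<close>] divide_ennreal_def distrib_right)
  qed
  finally show "emeasure (symmetrization M) A =
      emeasure (distr (?B \<Otimes>\<^sub>M M) borel (\<lambda>(b, x). if b then x else - x)) A" by simp
qed simp

lemma real_distribution_symmetrization:
  assumes "real_distribution M"
  shows "real_distribution (symmetrization M)"
proof -
  interpret real_distribution M by fact
  interpret pair_prob_space "measure_pmf (bernoulli_pmf (1 / 2))" M ..
  show ?thesis
    unfolding symmetrization_eq_distr[OF assms] by (intro real_distribution_distr) simp
qed

lemma integral_symmetrization: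
  fixes f :: "real \<Rightarrow> real"
  assumes "real_distribution M" and [measurable]: "f \<in> borel_measurable borel" and B: "\<And>x. \<bar>f x\<bar> \<le> B"
  shows "(\<integral>x. f x \<partial>symmetrization M) = (\<integral>x. (f x + f (- x)) / 2 \<partial>M)"
proof -
  interpret RM: real_distribution M by fact
  let ?B = "measure_pmf (bernoulli_pmf (1 / 2))"
  interpret pair_prob_space ?B M ..
  have int1: "integrable M f"
    by (rule RM.integrable_const_bound[of _ B]) (use B in simp_all)
  have int2: "integrable M (\<lambda>x. f (- x))"
    by (rule RM.integrable_const_bound[of _ B]) (use B in simp_all)
  have "(\<integral>x. f x \<partial>symmetrization M) = (\<integral>z. f ((\<lambda>(b, x). if b then x else - x) z) \<partial>(?B \<Otimes>\<^sub>M M))"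
    unfolding symmetrization_eq_distr[OF assms(1)] by (rule integral_distr) simp_all
  also have "\<dots> = (\<integral>b. \<integral>x. f (if b then x else - x) \<partial>M \<partial>?B)"
  proof -
    have "integrable (?B \<Otimes>\<^sub>M M) (\<lambda>z. f ((\<lambda>(b, x). if b then x else - x) z))"
      by (rule P.integrable_const_bound[of _ B]) (use B in simp_all)
    from integral_fst'[OF this] show ?thesis by simp
  qed
  also have "\<dots> = (\<integral>x. f x \<partial>M) * (1 / 2) + (\<integral>x. f (- x) \<partial>M) * (1 - 1 / 2)"
    by (subst integral_bernoulli_pmf) simp_all
  also have "\<dots> = (\<integral>x. (f x + f (- x)) / 2 \<partial>M)"
    using int1 int2 by (simp add: add_divide_distrib)
  finally show ?thesis .
qed

lemma real_distribution_sqrt_measure: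
  assumes "real_distribution M"
  shows "real_distribution (sqrt_measure M)"
proof -
  interpret real_distribution M by fact
  show ?thesis unfolding sqrt_measure_def by (intro real_distribution_symmetrization real_distribution_distr) simp
qed

lemma integral_sqrt_measure:
  fixes f :: "real \<Rightarrow> real"
  assumes "real_distribution M" and [measurable]: "f \<in> borel_measurable borel" and B: "\<And>x. \<bar>f x\<bar> \<le> B"
  shows "(\<integral>x. f x \<partial>sqrt_measure M) = (\<integral>x. (f (sqrt x) + f (- sqrt x)) / 2 \<partial>M)"
proof -
  interpret real_distribution M by fact
  have "real_distribution (distr M borel sqrt)" by (intro real_distribution_distr) simp
  from integral_symmetrization[OF this assms(2) B] show ?thesis
    by (simp add: sqrt_measure_def integral_distr)
qed

lemma symmetric_distribution_sqrt_measure: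
  assumes "real_distribution M"
  shows "symmetric_distribution (sqrt_measure M)"
  unfolding symmetric_distribution_def
proof (intro conjI measure_eqI real_distribution_sqrt_measure assms)
  interpret real_distribution M by fact
  interpret S: real_distribution "distr M borel sqrt" by (intro real_distribution_distr) simp
  fix A assume "A \<in> sets (distr (sqrt_measure M) borel uminus)"
  then have A[measurable]: "A \<in> sets borel" by simp
  define \<sigma> where "\<sigma> = distr M borel sqrt"
  have [simp, measurable_cong]: "sets \<sigma> = sets borel" "space \<sigma> = UNIV" by (simp_all add: \<sigma>_def)
  have [measurable]: "uminus -` B \<in> sets borel" if "B \<in> sets borel" for B :: "real set"
    using measurable_sets_borel[OF borel_measurable_uminus[OF measurable_ident] that] by simp
  have vv: "uminus -` uminus -` A = A" by auto
  have "emeasure (distr (symmetrization \<sigma>) borel uminus) A = emeasure (symmetrization \<sigma>) (uminus -` A)"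
    by (subst emeasure_distr) (simp_all)
  also have "\<dots> = (emeasure \<sigma> (uminus -` A) + emeasure \<sigma> (uminus -` uminus -` A)) / 2"
    by (subst emeasure_symmetrization) (simp_all add: emeasure_distr)
  also have "\<dots> = emeasure (symmetrization \<sigma>) A"
    by (simp add: emeasure_symmetrization emeasure_distr add.commute vv)
  finally show "emeasure (distr (sqrt_measure M) borel uminus) A = emeasure (sqrt_measure M) A"
    by (simp add: sqrt_measure_def \<sigma>_def)
qed (simp add: sqrt_measure_def)

text \<open>Test functions pull back: averaging f over \<open>sqrt x\<close> and
  \<open>- sqrt x\<close> yields a bounded function that is continuous on the whole line, because
  \<open>sqrt\<close> is continuous there.\<close>

lemma weak_conv_sqrt_measure:
  assumes "\<And>d. real_distribution (M d)" "real_distribution N" "weak_conv_m M N"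
  shows "weak_conv_m (\<lambda>d. sqrt_measure (M d)) (sqrt_measure N)"
proof (rule integral_bdd_continuous_conv_imp_weak_conv)
  fix f :: "real \<Rightarrow> real" assume cont: "\<And>x. isCont f x" and bd: "\<And>x. \<bar>f x\<bar> \<le> 1"
  have [measurable]: "f \<in> borel_measurable borel"
    by (intro borel_measurable_continuous_onI continuous_at_imp_continuous_on) (use cont in auto)
  define g where "g x = (f (sqrt x) + f (- sqrt x)) / 2" for x
  have "isCont (\<lambda>x. f (sqrt x)) x" "isCont (\<lambda>x. f (- sqrt x)) x" for x
    by (rule isCont_o2[OF _ cont], intro continuous_intros)+
  then have "isCont g x" for x
    unfolding g_def by (intro isCont_divide isCont_add continuous_const) simp_all
  moreover have "norm (g x) \<le> 1" for x
    using bd[of "sqrt x"] bd[of "- sqrt x"] by (simp add: g_def)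
  ultimately have "(\<lambda>d. \<integral>x. g x \<partial>M d) \<longlonglongrightarrow> (\<integral>x. g x \<partial>N)"
    by (intro weak_conv_imp_integral_bdd_continuous_conv[OF assms])
  moreover have "(\<integral>x. f x \<partial>sqrt_measure L) = (\<integral>x. g x \<partial>L)" if "real_distribution L" for L
    unfolding g_def by (rule integral_sqrt_measure[OF that _ bd]) simp
  ultimately show "(\<lambda>d. \<integral>x. f x \<partial>sqrt_measure (M d)) \<longlonglongrightarrow> (\<integral>x. f x \<partial>sqrt_measure N)"
    using assms(1,2) by simp
qed (intro real_distribution_sqrt_measure assms)+

section \<open>The method of moments\<close>

lemma (in real_distribution) integrable_bounded_support:
  fixes f :: "real \<Rightarrow> real"
  assumes [measurable]: "f \<in> borel_measurable borel" and "AE x in M. \<bar>f x\<bar> \<le> B"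
  shows "integrable M f"
  by (rule integrable_const_bound[of _ B]) (use assms in simp_all)

text \<open>The Taylor polynomial of the characteristic function at order 2 K has an error of at
  most 2 |t|^(2 K) / (2 K)! times the absolute moment of that order. Bounded support of N makes this
  small for N; for the laws \<open>M d\<close> it is then eventually small because that single
  moment converges. Thus their supports may grow with d.\<close>

lemma char_tendsto_of_moments:
  assumes M: "\<And>d. real_distribution (M d)" and N: "real_distribution N"
    and R: "R \<ge> 0" "AE x in N. \<bar>x\<bar> \<le> R"
    and int: "\<And>d k. integrable (M d) (\<lambda>x. x ^ k)"
    and conv: "\<And>k. (\<lambda>d. \<integral>x. x ^ k \<partial>M d) \<longlonglongrightarrow> (\<integral>x. x ^ k \<partial>N)"
  shows "(\<lambda>d. char (M d) t) \<longlonglongrightarrow> char N t"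
proof (rule tendstoI)
  interpret N: real_distribution N by fact
  fix \<epsilon> :: real assume \<epsilon>: "\<epsilon> > 0"
  have power_bd: "AE x in N. \<bar>x ^ k\<bar> \<le> R ^ k" for k
    using R(2) by eventually_elim (simp add: power_abs power_mono)
  have intN: "integrable N (\<lambda>x. x ^ k)" for k
    by (rule N.integrable_bounded_support[OF _ power_bd]) simp
  define a where "a k = 2 * (\<bar>t\<bar> * R) ^ k / fact k" for k
  have "(\<lambda>k. 2 * (inverse (fact k) * (\<bar>t\<bar> * R) ^ k)) \<longlonglongrightarrow> 2 * 0"
    by (intro tendsto_mult tendsto_const summable_LIMSEQ_zero summable_exp)
  moreover have "a = (\<lambda>k. 2 * (inverse (fact k) * (\<bar>t\<bar> * R) ^ k))"
    by (simp add: a_def fun_eq_iff divide_inverse mult_ac)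
  ultimately have "a \<longlonglongrightarrow> 0" by simp
  then have "\<forall>\<^sub>F k in sequentially. a k < \<epsilon> / 4"
    using \<epsilon> by (intro order_tendstoD) auto
  then obtain K where "\<And>k. k \<ge> K \<Longrightarrow> a k < \<epsilon> / 4"
    by (auto simp: eventually_sequentially)
  then have aK: "a (2 * K) < \<epsilon> / 4" by simp
  define S where "S L = (\<Sum>k\<le>2 * K. ((\<i> * t) ^ k / fact k) * complex_of_real (\<integral>x. x ^ k \<partial>L))" for L
  define E where "E L = 2 * \<bar>t\<bar> ^ (2 * K) / fact (2 * K) * (\<integral>x. \<bar>x\<bar> ^ (2 * K) \<partial>L)" for L
  \<comment> \<open>The even order turns the absolute moment in the error bound into an ordinary
    moment, whose limit is known.\<close>
  have even: "\<bar>x\<bar> ^ (2 * K) = x ^ (2 * K)" for x :: real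
    by (simp add: power_even_abs)
  have approx: "cmod (char L t - S L) \<le> E L" if "real_distribution L" "\<And>k. integrable L (\<lambda>x. x ^ k)" for L
    using real_distribution.char_approx1[OF that(1), of "2 * K" t] that(2) by (simp add: S_def E_def)
  have "(\<integral>x. x ^ (2 * K) \<partial>N) \<le> (\<integral>x. R ^ (2 * K) \<partial>N)"
    using power_bd[of "2 * K"] by (intro integral_mono_AE intN) (auto elim: eventually_mono)
  then have "(\<integral>x. x ^ (2 * K) \<partial>N) \<le> R ^ (2 * K)"
    using N.prob_space by simp
  from mult_left_mono[OF this, of "2 * \<bar>t\<bar> ^ (2 * K) / fact (2 * K)"] have "E N \<le> a (2 * K)"
    by (simp add: E_def a_def even power_mult_distrib)
  then have EN: "E N < \<epsilon> / 4" using aK by simp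
  have "(\<lambda>d. E (M d)) \<longlonglongrightarrow> E N"
    unfolding E_def even by (intro tendsto_mult tendsto_const conv)
  then have 1: "\<forall>\<^sub>F d in sequentially. E (M d) < \<epsilon> / 4"
    using EN by (rule order_tendstoD)
  have "(\<lambda>d. S (M d)) \<longlonglongrightarrow> S N"
    unfolding S_def by (intro tendsto_sum tendsto_mult tendsto_const tendsto_of_real conv)
  then have 2: "\<forall>\<^sub>F d in sequentially. dist (S (M d)) (S N) < \<epsilon> / 4"
    using \<epsilon> by (intro tendstoD) auto
  show "\<forall>\<^sub>F d in sequentially. dist (char (M d) t) (char N t) < \<epsilon>"
    using 1 2
  proof eventually_elim
    case (elim d)
    have "dist (char (M d) t) (char N t) \<le>
        dist (char (M d) t) (S (M d)) + dist (S (M d)) (S N) + dist (char N t) (S N)"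
      using dist_triangle[of "char (M d) t" "char N t" "S (M d)"]
        dist_triangle[of "S (M d)" "char N t" "S N"] dist_commute[of "S N" "char N t"] by linarith
    also have "\<dots> < \<epsilon>"
      using elim EN approx[OF M int, of d] approx[OF N intN] \<epsilon> unfolding dist_norm by linarith
    finally show ?case .
  qed
qed

lemma weak_conv_of_moments:
  assumes M: "\<And>d. real_distribution (M d)" and N: "real_distribution N"
    and R: "R \<ge> 0" "AE x in N. \<bar>x\<bar> \<le> R"
    and int: "\<And>d k. integrable (M d) (\<lambda>x. x ^ k)"
    and conv: "\<And>k. (\<lambda>d. \<integral>x. x ^ k \<partial>M d) \<longlonglongrightarrow> (\<integral>x. x ^ k \<partial>N)"
  shows "weak_conv_m M N"
  using char_tendsto_of_moments[OF assms] M N by (intro levy_continuity) auto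

text \<open>Equality is the special case of \<open>char_tendsto_of_moments\<close> in which the
  sequence is constantly M.\<close>

lemma real_distribution_eqI_moments:
  assumes "real_distribution M" "real_distribution N"
    and R: "R \<ge> 0" "AE x in M. \<bar>x\<bar> \<le> R" "AE x in N. \<bar>x\<bar> \<le> R"
    and eq: "\<And>k. (\<integral>x. x ^ k \<partial>M) = (\<integral>x. x ^ k \<partial>N)"
  shows "M = N"
proof (rule Levy_uniqueness[OF assms(1,2)])
  interpret M: real_distribution M by fact
  have "AE x in M. \<bar>x ^ k\<bar> \<le> R ^ k" for k
    using R(2) by eventually_elim (simp add: power_abs power_mono)
  then have int: "integrable M (\<lambda>x. x ^ k)" for k
    by (intro M.integrable_bounded_support) simp_all
  have "(\<lambda>d::nat. char M t) \<longlonglongrightarrow> char N t" for t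
    using int by (intro char_tendsto_of_moments[OF assms(1,2) R(1,3)]) (simp_all add: eq)
  then show "char M = char N"
    by (intro ext LIMSEQ_unique[OF tendsto_const])
qed

text \<open>Bounded continuous functions that vanish on [0, C] but nowhere on one side of it have
  integral 0 along the sequence, hence in the limit. For the moments, x^k is replaced by its version
  clipped to [0, C], which is a legitimate test function and almost surely the same.\<close>

lemma weak_conv_bounded_support:
  assumes M: "\<And>d. real_distribution (M d)" and N: "real_distribution N"
    and supp: "\<And>d. AE x in M d. 0 \<le> x \<and> x \<le> C" and "C \<ge> 0" and conv: "weak_conv_m M N"
  shows "AE x in N. 0 \<le> x \<and> x \<le> C"
    and "(\<lambda>d. \<integral>x. x ^ k \<partial>M d) \<longlonglongrightarrow> (\<integral>x. x ^ k \<partial>N)"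
proof -
  interpret N: real_distribution N by fact
  interpret M: real_distribution "M d" for d by fact
  have *: "AE x in N. f x = 0"
    if f: "\<And>x. isCont f x" "\<And>x. 0 \<le> f x \<and> f x \<le> 1" and "\<And>x. 0 \<le> x \<Longrightarrow> x \<le> C \<Longrightarrow> f x = 0" for f :: "real \<Rightarrow> real"
  proof -
    have [measurable]: "f \<in> borel_measurable borel"
      by (intro borel_measurable_continuous_onI continuous_at_imp_continuous_on) (use f in auto)
    have "(\<lambda>d. \<integral>x. f x \<partial>M d) \<longlonglongrightarrow> (\<integral>x. f x \<partial>N)"
      by (rule weak_conv_imp_integral_bdd_continuous_conv[OF M N conv f(1), of 1]) (use f(2) in simp)
    moreover have "(\<integral>x. f x \<partial>M d) = 0" for d
    proof -
      have "AE x in M d. f x = 0" using supp[of d] by eventually_elim (use that(3) in auto)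
      then show ?thesis by (rule integral_eq_zero_AE)
    qed
    ultimately have "(\<integral>x. f x \<partial>N) = 0" by (simp add: LIMSEQ_const_iff)
    moreover have "integrable N f"
      by (rule N.integrable_const_bound[of _ 1]) (use f(2) in simp_all)
    ultimately show ?thesis
      using f(2) by (subst (asm) integral_nonneg_eq_0_iff_AE) auto
  qed
  have "AE x in N. min 1 (max 0 (x - C)) = 0"
    by (rule *) (auto intro!: continuous_intros)
  moreover have "AE x in N. min 1 (max 0 (- x)) = 0"
    by (rule *) (auto intro!: continuous_intros)
  ultimately show supp': "AE x in N. 0 \<le> x \<and> x \<le> C"
    by eventually_elim (auto simp: min_def max_def split: if_splits)
  define g where "g x = (max 0 (min C x)) ^ k" for x
  have "isCont g x" for x
    unfolding g_def by (intro continuous_intros)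
  moreover have "norm (g x) \<le> C ^ k" for x
    using \<open>C \<ge> 0\<close> by (auto simp: g_def intro!: power_mono)
  ultimately have "(\<lambda>d. \<integral>x. g x \<partial>M d) \<longlonglongrightarrow> (\<integral>x. g x \<partial>N)"
    by (rule weak_conv_imp_integral_bdd_continuous_conv[OF M N conv])
  moreover have "(\<integral>x. g x \<partial>L) = (\<integral>x. x ^ k \<partial>L)"
    if "real_distribution L" "AE x in L. 0 \<le> x \<and> x \<le> C" for L
  proof (rule integral_cong_AE)
    interpret L: real_distribution L by fact
    show "g \<in> borel_measurable L" "(\<lambda>x. x ^ k) \<in> borel_measurable L"
      by (simp_all add: g_def[abs_def])
    show "AE x in L. g x = x ^ k"
      using that(2) by eventually_elim (simp add: g_def)
  qed
  ultimately show "(\<lambda>d. \<integral>x. x ^ k \<partial>M d) \<longlonglongrightarrow> (\<integral>x. x ^ k \<partial>N)"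
    using M N supp supp' by simp
qed

text \<open>The limit law is not given in advance. Tightness produces it along a subsequence; its
  moments must be the numbers \<open>m k\<close>, and then the method of moments applies to the
  whole sequence.\<close>

lemma tendsto_moments_imp_weak_conv:
  assumes M: "\<And>d. real_distribution (M d)"
    and supp: "\<And>d. AE x in M d. 0 \<le> x \<and> x \<le> C" and "C \<ge> 0"
    and conv: "\<And>k. (\<lambda>d. \<integral>x. x ^ k \<partial>M d) \<longlonglongrightarrow> m k"
  obtains N where "real_distribution N" "weak_conv_m M N" "AE x in N. 0 \<le> x \<and> x \<le> C"
    "\<And>k. (\<integral>x. x ^ k \<partial>N) = m k"
proof -
  interpret M: real_distribution "M d" for d by fact
  \<comment> \<open>Tightness is formulated with intervals open on the left, so the left end has to
    lie strictly below 0.\<close>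
  have "measure (M d) {- 1<..C} = 1" for d
    using supp[of d] by (subst M.prob_eq_1) (auto elim: eventually_mono)
  then have "tight M"
    unfolding tight_def
  proof (intro conjI allI impI M)
    fix \<epsilon> :: real assume "\<epsilon> > 0"
    then have "- 1 < C \<and> (\<forall>d. measure (M d) {- 1<..C} > 1 - \<epsilon>)"
      using \<open>C \<ge> 0\<close> \<open>\<And>d. measure (M d) {- 1<..C} = 1\<close> by simp
    then show "\<exists>a b. a < b \<and> (\<forall>d. measure (M d) {a<..b} > 1 - \<epsilon>)" by blast
  qed
  from tight_imp_convergent_subsubsequence[OF this, of id] obtain r N where
    r: "strict_mono (r :: nat \<Rightarrow> nat)" and N: "real_distribution N" and wc: "weak_conv_m (M \<circ> r) N"
    by (auto simp: strict_mono_id)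
  have Mr: "real_distribution ((M \<circ> r) d)" "AE x in (M \<circ> r) d. 0 \<le> x \<and> x \<le> C" for d
    using M[of "r d"] supp[of "r d"] by (simp_all only: comp_def)
  note suppN = weak_conv_bounded_support(1)[OF Mr(1) N Mr(2) \<open>C \<ge> 0\<close> wc]
    and lim = weak_conv_bounded_support(2)[OF Mr(1) N Mr(2) \<open>C \<ge> 0\<close> wc]
  have m: "(\<integral>x. x ^ k \<partial>N) = m k" for k
  proof (rule LIMSEQ_unique[OF lim])
    show "(\<lambda>d. \<integral>x. x ^ k \<partial>(M \<circ> r) d) \<longlonglongrightarrow> m k"
      using LIMSEQ_subseq_LIMSEQ[OF conv[of k] r] by (simp only: comp_def)
  qed
  have "AE x in M d. \<bar>x ^ k\<bar> \<le> C ^ k" for d k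
    using supp by eventually_elim (simp add: power_abs power_mono)
  then have int: "integrable (M d) (\<lambda>x. x ^ k)" for d k
    by (intro M.integrable_bounded_support) simp_all
  have "weak_conv_m M N"
  proof (rule weak_conv_of_moments[OF M N \<open>C \<ge> 0\<close> _ int])
    show "AE x in N. \<bar>x\<bar> \<le> C" using suppN by eventually_elim simp
    show "(\<lambda>d. \<integral>x. x ^ k \<partial>M d) \<longlonglongrightarrow> (\<integral>x. x ^ k \<partial>N)" for k
      unfolding m by (rule conv)
  qed
  from that[OF N this suppN m] show ?thesis .
qed

section \<open>The Marchenko--Pastur distribution\<close>

context
  fixes c :: real
  assumes c: "c \<ge> 1"
begin

definition mp_quad :: "real \<Rightarrow> real" where
  "mp_quad x = 4 * c - (x - 1 - c)\<^sup>2"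

abbreviation "mp_left \<equiv> (1 - sqrt c)\<^sup>2"
abbreviation "mp_right \<equiv> (1 + sqrt c)\<^sup>2"

lemma mp_quad_factor: "mp_quad x = (x - mp_left) * (mp_right - x)"
proof -
  have "4 * (s * s) - (x - 1 - s * s)\<^sup>2 = (x - (1 - s)\<^sup>2) * ((1 + s)\<^sup>2 - x)" for s :: real
    by (simp add: power2_eq_square algebra_simps)
  from this[of "sqrt c"] show ?thesis using c by (simp add: mp_quad_def)
qed

lemma mp_quad_expand: "mp_quad x = - x\<^sup>2 + 2 * (1 + c) * x - (1 - c)\<^sup>2"
  by (simp add: mp_quad_def power2_eq_square algebra_simps)

lemma mp_left_less_right: "mp_left < mp_right"
  using c by (simp add: power2_eq_square algebra_simps)

lemma mp_quad_pos: "mp_left < x \<Longrightarrow> x < mp_right \<Longrightarrow> mp_quad x > 0"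
  by (simp add: mp_quad_factor)

lemma mp_quad_nonneg: "mp_left \<le> x \<Longrightarrow> x \<le> mp_right \<Longrightarrow> mp_quad x \<ge> 0"
  by (simp add: mp_quad_factor)

lemma has_real_derivative_mp_quad [derivative_intros]:
  "(mp_quad has_real_derivative (2 * (1 + c) - 2 * x)) (at x)"
  unfolding mp_quad_def[abs_def] by (auto intro!: derivative_eq_intros)

text \<open>The weight omits the factor 1 / x, so index k corresponds to the moment of order k + 1
  of the distribution. In this form the integrand stays continuous even for c = 1, when the support
  reaches 0.\<close>

definition mp_moment :: "nat \<Rightarrow> real" where
  "mp_moment k = integral {mp_left..mp_right} (\<lambda>x. x ^ k * sqrt (mp_quad x))"

lemma continuous_mp_quad: "continuous_on S mp_quad"
  unfolding mp_quad_def[abs_def] by (intro continuous_intros)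

lemma mp_moment_has_integral:
  "((\<lambda>x. x ^ k * sqrt (mp_quad x)) has_integral mp_moment k) {mp_left..mp_right}"
  unfolding mp_moment_def
  by (intro integrable_integral integrable_continuous_real continuous_intros continuous_mp_quad)

text \<open>The integral of the derivative of \<open>x\<^sup>k A\<^bsup>3/2\<^esup>\<close> vanishes, where \<open>A\<close> is \<^term>\<open>mp_quad\<close>.\<close>

lemma mp_moment_rec:
  "(real k + 3) * mp_moment (Suc k) = (2 * real k + 3) * (1 + c) * mp_moment k - real k * (1 - c)\<^sup>2 * mp_moment (k - 1)"
proof -
  define f where "f x = x ^ k * (mp_quad x * sqrt (mp_quad x))" for x
  define f' where "f' x = - (real k + 3) * (x ^ Suc k * sqrt (mp_quad x)) +
    (2 * real k + 3) * (1 + c) * (x ^ k * sqrt (mp_quad x)) -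
    real k * (1 - c)\<^sup>2 * (x ^ (k - 1) * sqrt (mp_quad x))" for x
  have "(f has_real_derivative f' x) (at x)" if x: "x \<in> {mp_left<..<mp_right}" for x
  proof -
    define s where "s = sqrt (mp_quad x)"
    have pos: "mp_quad x > 0" using x mp_quad_pos by simp
    then have s: "s > 0" "s * s = mp_quad x" by (simp_all add: s_def)
    have "(f has_real_derivative (real k * x ^ (k - 1) * (mp_quad x * s) +
      ((2 * (1 + c) - 2 * x) * s + (2 * (1 + c) - 2 * x) * (inverse s * mp_quad x) / 2) * x ^ k)) (at x)"
      unfolding f_def[abs_def] s_def using pos by (auto intro!: derivative_eq_intros)
    moreover have inv: "inverse s * mp_quad x = s"
      using s by (simp flip: s(2))
    have f'_eq: "f' x = - (real k + 3) * (x ^ Suc k * s) + (2 * real k + 3) * (1 + c) * (x ^ k * s) -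
        real k * (1 - c)\<^sup>2 * (x ^ (k - 1) * s)"
      by (simp add: f'_def s_def)
    moreover have "real k * x ^ (k - 1) * (mp_quad x * s) + ((2 * (1 + c) - 2 * x) * s + (2 * (1 + c) - 2 * x) * s / 2) * x ^ k = f' x"
    \<comment> \<open>The exponent k - 1 is truncated at k = 0, where its factor
      \<open>real k\<close> vanishes.\<close>
    proof (cases k)
      case 0
      then show ?thesis by (simp add: f'_eq field_simps)
    next
      case (Suc i)
      then show ?thesis
        unfolding f'_eq mp_quad_expand by (simp add: power2_eq_square field_simps)
    qed
    ultimately show ?thesis unfolding inv by (simp only:)
  qed
  moreover have "continuous_on {mp_left..mp_right} f"
    unfolding f_def by (intro continuous_intros continuous_mp_quad)
  ultimately have "(f' has_integral (f mp_right - f mp_left)) {mp_left..mp_right}"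
    using mp_left_less_right
    by (intro fundamental_theorem_of_calculus_interior)
       (auto simp: has_real_derivative_iff_has_vector_derivative)
  moreover have "f mp_right - f mp_left = 0"
    by (simp add: f_def mp_quad_factor)
  moreover have "(f' has_integral (- (real k + 3) * mp_moment (Suc k) +
      (2 * real k + 3) * (1 + c) * mp_moment k - real k * (1 - c)\<^sup>2 * mp_moment (k - 1))) {mp_left..mp_right}"
    unfolding f'_def[abs_def]
    by (intro has_integral_add has_integral_diff has_integral_mult_right mp_moment_has_integral)
  ultimately have "- (real k + 3) * mp_moment (Suc k) +
      (2 * real k + 3) * (1 + c) * mp_moment k - real k * (1 - c)\<^sup>2 * mp_moment (k - 1) = 0"
    using has_integral_unique by metis
  then show ?thesis by (simp add: algebra_simps)
qed

text \<open>The argument is the affine map from the support onto [-1, 1], which makes this an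
  antiderivative of 1 / sqrt A with A the polynomial \<open>mp_quad\<close>.\<close>

definition mp_arcsin1 :: "real \<Rightarrow> real" where
  "mp_arcsin1 x = arcsin ((x - 1 - c) / (2 * sqrt c))"

lemma mp_arcsin1_bounds:
  assumes "mp_left \<le> x" "x \<le> mp_right"
  shows "(x - 1 - c) / (2 * sqrt c) \<in> {-1..1}"
proof -
  have "sqrt c * sqrt c = c" "sqrt c > 0" using c by auto
  then show ?thesis
    using assms by (auto simp: field_simps power2_eq_square)
qed

lemma mp_arcsin1_ends: "mp_arcsin1 mp_left = - (pi / 2)" "mp_arcsin1 mp_right = pi / 2"
proof -
  have s: "sqrt c * sqrt c = c" "sqrt c > 0" using c by auto
  have "(mp_left - 1 - c) / (2 * sqrt c) = -1" "(mp_right - 1 - c) / (2 * sqrt c) = 1"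
    using s by (simp_all add: field_simps power2_eq_square)
  then show "mp_arcsin1 mp_left = - (pi / 2)" "mp_arcsin1 mp_right = pi / 2"
    unfolding mp_arcsin1_def by (simp_all only: arcsin_minus_1 arcsin_1)
qed

lemma mp_arcsin1_deriv:
  assumes "mp_left < x" "x < mp_right"
  shows "(mp_arcsin1 has_real_derivative 1 / sqrt (mp_quad x)) (at x)"
proof -
  have s: "sqrt c * sqrt c = c" "sqrt c > 0" using c by auto
  define u where "u = (x - 1 - c) / (2 * sqrt c)"
  have u: "1 - u\<^sup>2 = mp_quad x / (2 * sqrt c)\<^sup>2"
    using s by (simp add: u_def mp_quad_def field_simps power2_eq_square)
  then have "1 - u\<^sup>2 > 0" using mp_quad_pos[OF assms] s by simp
  then have "-1 < u" "u < 1" by (simp_all add: abs_square_less_1 abs_less_iff)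
  moreover have "((\<lambda>x. (x - 1 - c) / (2 * sqrt c)) has_real_derivative 1 / (2 * sqrt c)) (at x)"
    by (rule DERIV_cdivide) (auto intro!: derivative_eq_intros)
  ultimately have "(mp_arcsin1 has_real_derivative inverse (sqrt (1 - u\<^sup>2)) * (1 / (2 * sqrt c))) (at x)"
    unfolding mp_arcsin1_def[abs_def] u_def by (intro DERIV_chain2[OF DERIV_arcsin])
  also have "inverse (sqrt (1 - u\<^sup>2)) * (1 / (2 * sqrt c)) = 1 / sqrt (mp_quad x)"
    using s mp_quad_pos[OF assms] by (simp add: u real_sqrt_divide real_sqrt_mult field_simps)
  finally show ?thesis .
qed

lemma mp_arcsin1_continuous: "continuous_on {mp_left..mp_right} mp_arcsin1"
  unfolding mp_arcsin1_def[abs_def]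
  using mp_arcsin1_bounds c by (intro continuous_intros) (auto simp: Ball_def)

text \<open>The graph of sqrt A is a half circle of radius 2 sqrt c, whose area is 2 pi c; F is the
  usual antiderivative for it.\<close>

lemma mp_moment_0: "mp_moment 0 = 2 * pi * c"
proof -
  define F where "F x = (x - 1 - c) / 2 * sqrt (mp_quad x) + 2 * c * mp_arcsin1 x" for x
  have "(F has_real_derivative x ^ 0 * sqrt (mp_quad x)) (at x)" if x: "x \<in> {mp_left<..<mp_right}" for x
  proof -
    define s where "s = sqrt (mp_quad x)"
    have pos: "mp_quad x > 0" using x mp_quad_pos by simp
    then have s: "s > 0" "s * s = mp_quad x" by (simp_all add: s_def)
    have "(mp_arcsin1 has_real_derivative 1 / s) (at x)"
      using mp_arcsin1_deriv x by (simp add: s_def)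
    then have "(F has_real_derivative (1 / 2 * s + (2 * (1 + c) - 2 * x) * (inverse s / 2) * ((x - 1 - c) / 2) + 2 * c * (1 / s))) (at x)"
      unfolding F_def[abs_def] s_def using pos by (auto intro!: derivative_eq_intros)
    also have "1 / 2 * s + (2 * (1 + c) - 2 * x) * (inverse s / 2) * ((x - 1 - c) / 2) + 2 * c * (1 / s)
        = (s * s + mp_quad x) / (2 * s)"
      using s(1) by (simp add: mp_quad_def field_simps power2_eq_square)
    also have "\<dots> = x ^ 0 * s" using s(1) by (simp flip: s(2))
    finally show ?thesis by (simp add: s_def)
  qed
  moreover have "continuous_on {mp_left..mp_right} F"
    unfolding F_def[abs_def] by (intro continuous_intros continuous_mp_quad mp_arcsin1_continuous) auto
  ultimately have "((\<lambda>x. x ^ 0 * sqrt (mp_quad x)) has_integral (F mp_right - F mp_left)) {mp_left..mp_right}"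
    using mp_left_less_right
    by (intro fundamental_theorem_of_calculus_interior)
       (auto simp: has_real_derivative_iff_has_vector_derivative)
  moreover have "F mp_right - F mp_left = 2 * pi * c"
    by (simp add: F_def mp_quad_factor mp_arcsin1_ends)
  ultimately show ?thesis
    using mp_moment_has_integral[of 0] has_integral_unique by metis
qed

text \<open>\<open>\<surd>A / x\<close> has the antiderivative \<open>\<surd>A + (1 + c) mp_arcsin1 - mp_arcsin2\<close>; the last term is
  \<open>0\<close> for \<open>c = 1\<close>, where its argument is undefined at the left end point.\<close>

definition mp_arcsin2 :: "real \<Rightarrow> real" where
  "mp_arcsin2 x = (c - 1) * arcsin (((1 + c) * x - (c - 1)\<^sup>2) / (2 * sqrt c * x))"

lemma mp_arcsin2_trivial: "c = 1 \<Longrightarrow> mp_arcsin2 = (\<lambda>_. 0)"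
  unfolding mp_arcsin2_def[abs_def] by simp

lemma mp_left_nonneg: "mp_left \<ge> 0"
  by simp

lemma mp_left_pos: "c \<noteq> 1 \<Longrightarrow> mp_left > 0"
  by simp

lemma mp_interval_nonneg: "mp_left \<le> x \<Longrightarrow> 0 \<le> x"
  by (rule order_trans[OF mp_left_nonneg])

lemma mp_interval_pos: "c \<noteq> 1 \<Longrightarrow> mp_left \<le> x \<Longrightarrow> 0 < x"
  by (rule less_le_trans[OF mp_left_pos])

text \<open>The argument v is affine in 1 / x, the natural variable for integrating 1 / (x sqrt A).
  For c \<noteq> 1 it maps the ends of the support to -1 and 1, so 1 - v^2 has the same zeros as
  A.\<close>

lemma mp_arcsin2_argument:
  assumes "x > 0"
  defines "v \<equiv> ((1 + c) * x - (c - 1)\<^sup>2) / (2 * sqrt c * x)"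
  shows "1 - v\<^sup>2 = (c - 1)\<^sup>2 * mp_quad x / (2 * sqrt c * x)\<^sup>2"
proof -
  define D where "D = 2 * sqrt c * x"
  have D: "D \<noteq> 0" "D\<^sup>2 = 4 * c * x\<^sup>2" using c assms(1) by (simp_all add: D_def power_mult_distrib)
  have "1 - (N / D)\<^sup>2 = (D\<^sup>2 - N\<^sup>2) / D\<^sup>2" for N
    using D(1) by (simp add: power_divide diff_divide_distrib)
  then have "1 - v\<^sup>2 = (D\<^sup>2 - ((1 + c) * x - (c - 1)\<^sup>2)\<^sup>2) / D\<^sup>2"
    by (simp only: v_def D_def[symmetric])
  also have "D\<^sup>2 - ((1 + c) * x - (c - 1)\<^sup>2)\<^sup>2 = (c - 1)\<^sup>2 * mp_quad x"
    unfolding D(2) mp_quad_def by (simp add: power2_eq_square algebra_simps)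
  finally show ?thesis by (simp add: D_def)
qed

lemma mp_arcsin2_deriv:
  assumes "mp_left < x" "x < mp_right"
  shows "(mp_arcsin2 has_real_derivative (c - 1)\<^sup>2 / (x * sqrt (mp_quad x))) (at x)"
proof (cases "c = 1")
  case True
  then show ?thesis unfolding mp_arcsin2_trivial[OF True] by simp
next
  case False
  have x: "x > 0" using assms mp_left_nonneg by linarith
  have c1: "c > 1" using c False by simp
  define D where "D = 2 * sqrt c * x"
  define v where "v = ((1 + c) * x - (c - 1)\<^sup>2) / D"
  have D: "D > 0" using c x by (simp add: D_def)
  have v: "1 - v\<^sup>2 = (c - 1)\<^sup>2 * mp_quad x / D\<^sup>2"
    using mp_arcsin2_argument[OF x] by (simp add: v_def D_def)
  moreover have "(c - 1)\<^sup>2 * mp_quad x / D\<^sup>2 > 0"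
    using mp_quad_pos[OF assms] D c1 by simp
  ultimately have "1 - v\<^sup>2 > 0" by simp
  then have "-1 < v" "v < 1" by (simp_all add: abs_square_less_1 abs_less_iff)
  have "((\<lambda>x. ((1 + c) * x - (c - 1)\<^sup>2) / (2 * sqrt c * x)) has_real_derivative
      ((1 + c) * D - ((1 + c) * x - (c - 1)\<^sup>2) * (2 * sqrt c)) / (D * D)) (at x)"
    unfolding D_def using x c by (auto intro!: derivative_eq_intros)
  also have "((1 + c) * D - ((1 + c) * x - (c - 1)\<^sup>2) * (2 * sqrt c)) / (D * D) = (c - 1)\<^sup>2 / (x * D)"
  proof -
    have "(1 + c) * D - ((1 + c) * x - (c - 1)\<^sup>2) * (2 * sqrt c) = (c - 1)\<^sup>2 * (2 * sqrt c)"
      by (simp add: D_def algebra_simps)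
    then show ?thesis using D x by (simp add: D_def field_simps)
  qed
  finally have "((\<lambda>x. arcsin (((1 + c) * x - (c - 1)\<^sup>2) / (2 * sqrt c * x))) has_real_derivative
      inverse (sqrt (1 - v\<^sup>2)) * ((c - 1)\<^sup>2 / (x * D))) (at x)"
    using \<open>-1 < v\<close> \<open>v < 1\<close> unfolding v_def D_def by (intro DERIV_chain2[OF DERIV_arcsin])
  then have "(mp_arcsin2 has_real_derivative (c - 1) * (inverse (sqrt (1 - v\<^sup>2)) * ((c - 1)\<^sup>2 / (x * D)))) (at x)"
    unfolding mp_arcsin2_def[abs_def] by (rule DERIV_cmult)
  also have "sqrt (1 - v\<^sup>2) = (c - 1) * sqrt (mp_quad x) / D"
    unfolding v using D c1 by (simp add: real_sqrt_divide real_sqrt_mult)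
  also have "(c - 1) * (inverse ((c - 1) * sqrt (mp_quad x) / D) * ((c - 1)\<^sup>2 / (x * D))) = (c - 1)\<^sup>2 / (x * sqrt (mp_quad x))"
  proof -
    have "e * (inverse (e * S / D) * (e\<^sup>2 / (x * D))) = e\<^sup>2 / (x * S)" if "e \<noteq> 0" "S \<noteq> 0" for e S :: real
      using that D x by (simp add: field_simps power2_eq_square)
    then show ?thesis using c1 mp_quad_pos[OF assms] by simp
  qed
  finally show ?thesis .
qed

lemma mp_arcsin2_continuous: "continuous_on {mp_left..mp_right} mp_arcsin2"
proof (cases "c = 1")
  case True
  then show ?thesis unfolding mp_arcsin2_trivial[OF True] by simp
next
  case False
  have x: "x > 0" if "x \<in> {mp_left..mp_right}" for x
    using that mp_interval_pos[OF False] by (simp only: atLeastAtMost_iff)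
  have bd: "-1 \<le> ((1 + c) * x - (c - 1)\<^sup>2) / (2 * sqrt c * x) \<and> ((1 + c) * x - (c - 1)\<^sup>2) / (2 * sqrt c * x) \<le> 1"
    if "x \<in> {mp_left..mp_right}" for x
  proof -
    have "1 - (((1 + c) * x - (c - 1)\<^sup>2) / (2 * sqrt c * x))\<^sup>2 \<ge> 0"
      unfolding mp_arcsin2_argument[OF x[OF that]] using that mp_quad_nonneg by simp
    then have "\<bar>((1 + c) * x - (c - 1)\<^sup>2) / (2 * sqrt c * x)\<bar> \<le> 1"
      by (simp add: abs_square_le_1)
    then show ?thesis unfolding abs_le_iff by linarith
  qed
  show ?thesis
    unfolding mp_arcsin2_def[abs_def]
    by (intro continuous_on_mult continuous_on_const continuous_on_arcsin continuous_on_divide continuous_on_diff continuous_on_id ballI bd)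
       (use x c in force)+
qed

lemma mp_arcsin2_ends: "mp_arcsin2 mp_left = - (c - 1) * (pi / 2)" "mp_arcsin2 mp_right = (c - 1) * (pi / 2)"
proof -
  have *: "mp_arcsin2 mp_left = - (c - 1) * (pi / 2) \<and> mp_arcsin2 mp_right = (c - 1) * (pi / 2)"
  proof (cases "c = 1")
    case True
    then show ?thesis unfolding mp_arcsin2_trivial[OF True] by simp
  next
    case False
    define s where "s = sqrt c"
    have s: "c = s * s" "s > 1" using c False by (auto simp: s_def)
    have nz: "s \<noteq> 0" "1 - s \<noteq> 0" "1 + s \<noteq> 0" using s(2) by auto
    have "((1 + c) * mp_left - (c - 1)\<^sup>2) / (2 * sqrt c * mp_left) = -1"
    proof -
      have "(1 + c) * mp_left - (c - 1)\<^sup>2 = - (2 * s * (1 - s)\<^sup>2)"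
        unfolding s_def[symmetric] by (simp add: s(1) power2_eq_square algebra_simps)
      then show ?thesis using nz by (simp flip: s_def)
    qed
    moreover have "((1 + c) * mp_right - (c - 1)\<^sup>2) / (2 * sqrt c * mp_right) = 1"
    proof -
      have "(1 + c) * mp_right - (c - 1)\<^sup>2 = 2 * s * (1 + s)\<^sup>2"
        unfolding s_def[symmetric] by (simp add: s(1) power2_eq_square algebra_simps)
      then show ?thesis using nz by (simp flip: s_def)
    qed
    ultimately show ?thesis
      unfolding mp_arcsin2_def by (simp only: arcsin_minus_1 arcsin_1 mult_minus_left mult_minus_right simp_thms)
  qed
  show "mp_arcsin2 mp_left = - (c - 1) * (pi / 2)" "mp_arcsin2 mp_right = (c - 1) * (pi / 2)"
    using * by blast+
qed

lemma mp_mass_has_integral: "((\<lambda>x. sqrt (mp_quad x) / x) has_integral 2 * pi) {mp_left..mp_right}"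
proof -
  define F where "F x = sqrt (mp_quad x) + (1 + c) * mp_arcsin1 x - mp_arcsin2 x" for x
  have "(F has_real_derivative sqrt (mp_quad x) / x) (at x)" if x: "x \<in> {mp_left<..<mp_right}" for x
  proof -
    define s where "s = sqrt (mp_quad x)"
    have pos: "mp_quad x > 0" using x mp_quad_pos by simp
    then have s: "s > 0" "s * s = mp_quad x" by (simp_all add: s_def)
    have x0: "x > 0" using le_less_trans[OF mp_left_nonneg] x by (simp only: greaterThanLessThan_iff)
    have "(mp_arcsin1 has_real_derivative 1 / s) (at x)" "(mp_arcsin2 has_real_derivative (c - 1)\<^sup>2 / (x * s)) (at x)"
      using mp_arcsin1_deriv mp_arcsin2_deriv x by (simp_all add: s_def)
    then have "(F has_real_derivative ((2 * (1 + c) - 2 * x) * (inverse s / 2) + (1 + c) * (1 / s) - (c - 1)\<^sup>2 / (x * s))) (at x)"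
      unfolding F_def[abs_def] s_def using pos by (auto intro!: derivative_eq_intros)
    also have "(2 * (1 + c) - 2 * x) * (inverse s / 2) + (1 + c) * (1 / s) - (c - 1)\<^sup>2 / (x * s) = mp_quad x / (x * s)"
      using s(1) x0 by (simp add: mp_quad_def field_simps power2_eq_square)
    also have "\<dots> = s / x" using s(1) x0 by (simp flip: s(2))
    finally show ?thesis by (simp add: s_def)
  qed
  moreover have "continuous_on {mp_left..mp_right} F"
    unfolding F_def[abs_def]
    by (intro continuous_intros continuous_mp_quad mp_arcsin1_continuous mp_arcsin2_continuous)
  ultimately have "((\<lambda>x. sqrt (mp_quad x) / x) has_integral (F mp_right - F mp_left)) {mp_left..mp_right}"
    using mp_left_less_right
    by (intro fundamental_theorem_of_calculus_interior)
       (auto simp: has_real_derivative_iff_has_vector_derivative)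
  \<comment> \<open>The square root vanishes at both ends. The two arcsines contribute (1 + c) pi
    and (c - 1) pi, whose difference does not depend on c.\<close>
  moreover have "F mp_right - F mp_left = 2 * pi"
    by (simp add: F_def mp_quad_factor mp_arcsin1_ends mp_arcsin2_ends field_simps)
  ultimately show ?thesis by simp
qed

definition mp_density :: "real \<Rightarrow> real" where
  "mp_density x = sqrt (mp_quad x) / (2 * pi * x) * indicator {mp_left..mp_right} x"

lemma marchenko_pastur_eq: "marchenko_pastur c = density lborel mp_density"
  by (simp add: marchenko_pastur_def mp_density_def mp_quad_def)

lemma mp_density_nonneg: "mp_density x \<ge> 0"
  by (auto simp: mp_density_def indicator_def intro!: divide_nonneg_nonneg mult_nonneg_nonneg mp_quad_nonneg simp: mp_interval_nonneg)

lemma borel_measurable_mp_density [measurable]: "mp_density \<in> borel_measurable borel"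
proof -
  have [measurable]: "mp_quad \<in> borel_measurable borel"
    using continuous_mp_quad by (rule borel_measurable_continuous_onI)
  show ?thesis unfolding mp_density_def[abs_def] by measurable
qed

lemma sets_marchenko_pastur [simp, measurable_cong]: "sets (marchenko_pastur c) = sets borel"
  by (simp add: marchenko_pastur_eq)

lemma space_marchenko_pastur [simp]: "space (marchenko_pastur c) = UNIV"
  by (simp add: marchenko_pastur_eq)

lemma real_distribution_marchenko_pastur: "real_distribution (marchenko_pastur c)"
proof -
  have "((\<lambda>x. 1 / (2 * pi) * (sqrt (mp_quad x) / x)) has_integral 1 / (2 * pi) * (2 * pi)) {mp_left..mp_right}"
    by (intro has_integral_mult_right mp_mass_has_integral)
  then have I: "((\<lambda>x. sqrt (mp_quad x) / (2 * pi * x)) has_integral 1) {mp_left..mp_right}"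
    by simp
  have "(\<integral>\<^sup>+x. ennreal (mp_density x) \<partial>lborel) =
      (\<integral>\<^sup>+x. ennreal (sqrt (mp_quad x) / (2 * pi * x)) * indicator {mp_left..mp_right} x \<partial>lborel)"
    by (intro nn_integral_cong) (simp add: mp_density_def indicator_def)
  also have "\<dots> = ennreal 1"
    by (intro nn_integral_has_integral_lebesgue'[OF _ I])
       (auto intro!: divide_nonneg_nonneg mult_nonneg_nonneg mp_quad_nonneg simp: mp_interval_nonneg)
  finally have "prob_space (marchenko_pastur c)"
    by (intro prob_spaceI) (simp add: marchenko_pastur_eq emeasure_density)
  then show ?thesis
    by (simp add: real_distribution_def real_distribution_axioms_def)
qed

lemma AE_marchenko_pastur: "AE x in marchenko_pastur c. 0 \<le> x \<and> x \<le> mp_right"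
proof -
  have "AE x in lborel. 0 < ennreal (mp_density x) \<longrightarrow> 0 \<le> x \<and> x \<le> mp_right"
    by (intro AE_I2) (auto simp: mp_density_def indicator_def intro: mp_interval_nonneg split: if_splits)
  then show ?thesis
    unfolding marchenko_pastur_eq by (subst AE_density) simp_all
qed

lemma integral_marchenko_pastur:
  "(\<integral>x. x ^ Suc k \<partial>marchenko_pastur c) = mp_moment k / (2 * pi)"
proof -
  have I: "((\<lambda>x. 1 / (2 * pi) * (x ^ k * sqrt (mp_quad x))) has_integral 1 / (2 * pi) * mp_moment k) {mp_left..mp_right}"
    by (intro has_integral_mult_right mp_moment_has_integral)
  have "(\<integral>x. x ^ Suc k \<partial>marchenko_pastur c) = (\<integral>x. mp_density x * x ^ Suc k \<partial>lborel)"
    unfolding marchenko_pastur_eq by (subst integral_density) (simp_all add: mp_density_nonneg)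
  also have "\<dots> = enn2real (\<integral>\<^sup>+x. ennreal (mp_density x * x ^ Suc k) \<partial>lborel)"
  proof (rule integral_eq_nn_integral)
    have "mp_density x * x ^ Suc k \<ge> 0" for x
    proof (cases "x \<in> {mp_left..mp_right}")
      case True
      then show ?thesis
        by (intro mult_nonneg_nonneg mp_density_nonneg zero_le_power mp_interval_nonneg) simp
    qed (simp add: mp_density_def)
    then show "AE x in lborel. 0 \<le> mp_density x * x ^ Suc k" by (intro AE_I2)
  qed simp
  also have "(\<integral>\<^sup>+x. ennreal (mp_density x * x ^ Suc k) \<partial>lborel) =
      (\<integral>\<^sup>+x. ennreal (1 / (2 * pi) * (x ^ k * sqrt (mp_quad x))) * indicator {mp_left..mp_right} x \<partial>lborel)"
  proof (rule nn_integral_cong_AE)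
    \<comment> \<open>The factor x cancels the 1 / x of the density only away from 0, and 0 belongs
      to the support when c = 1.\<close>
    have "AE x in lborel. x \<noteq> (0::real)" by (rule AE_lborel_singleton)
    then show "AE x in lborel. ennreal (mp_density x * x ^ Suc k) =
        ennreal (1 / (2 * pi) * (x ^ k * sqrt (mp_quad x))) * indicator {mp_left..mp_right} x"
      by eventually_elim (simp add: mp_density_def indicator_def field_simps)
  qed
  also have "\<dots> = ennreal (1 / (2 * pi) * mp_moment k)"
    by (intro nn_integral_has_integral_lebesgue'[OF _ I])
       (auto intro!: mult_nonneg_nonneg divide_nonneg_nonneg mp_quad_nonneg simp: mp_interval_nonneg)
  also have "mp_moment k \<ge> 0"
    by (intro has_integral_nonneg[OF mp_moment_has_integral])
       (auto intro!: mult_nonneg_nonneg mp_quad_nonneg simp: mp_interval_nonneg)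
  then have "enn2real (ennreal (1 / (2 * pi) * mp_moment k)) = mp_moment k / (2 * pi)"
    by simp
  finally show ?thesis .
qed

lemma marchenko_pastur_moment_1: "(\<integral>x. x \<partial>marchenko_pastur c) = c"
  using integral_marchenko_pastur[of 0] by (simp add: mp_moment_0)

lemma marchenko_pastur_moment_rec:
  assumes "k \<ge> 1"
  shows "(real k + 2) * (\<integral>x. x ^ Suc k \<partial>marchenko_pastur c) =
    (2 * real k + 1) * (1 + c) * (\<integral>x. x ^ k \<partial>marchenko_pastur c) -
    (real k - 1) * (1 - c)\<^sup>2 * (\<integral>x. x ^ (k - 1) \<partial>marchenko_pastur c)"
proof -
  obtain i where k: "k = Suc i" using assms by (cases k) auto
  have rec: "(real k + 2) * mp_moment k = (2 * real k + 1) * (1 + c) * mp_moment i - (real k - 1) * (1 - c)\<^sup>2 * mp_moment (i - 1)"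
    using mp_moment_rec[of i] by (simp add: k algebra_simps)
  \<comment> \<open>For k = 1 the moment of order 0 on the left is not given by an
    \<open>mp_moment\<close>, but then both sides have the factor 0.\<close>
  have last: "(real k - 1) * (\<integral>x. x ^ (k - 1) \<partial>marchenko_pastur c) = (real k - 1) * (mp_moment (i - 1) / (2 * pi))"
  proof (cases i)
    case (Suc i')
    then show ?thesis using integral_marchenko_pastur[of i'] by (simp add: k)
  qed (simp add: k)
  have "(real k + 2) * (mp_moment k / (2 * pi)) = (2 * real k + 1) * (1 + c) * (mp_moment i / (2 * pi)) -
      (1 - c)\<^sup>2 * ((real k - 1) * (mp_moment (i - 1) / (2 * pi)))"
    using arg_cong[OF rec, of "\<lambda>x. x / (2 * pi)"] by (simp add: diff_divide_distrib mult_ac)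
  moreover have "(\<integral>x. x ^ k \<partial>marchenko_pastur c) = mp_moment i / (2 * pi)"
    unfolding k by (rule integral_marchenko_pastur)
  moreover have "(real k - 1) * (1 - c)\<^sup>2 * (\<integral>x. x ^ (k - 1) \<partial>marchenko_pastur c) =
      (1 - c)\<^sup>2 * ((real k - 1) * (\<integral>x. x ^ (k - 1) \<partial>marchenko_pastur c))"
    by simp
  ultimately show ?thesis
    by (simp only: integral_marchenko_pastur last)
qed

end

section \<open>The rectangular R-transform on the negative axis\<close>

text \<open>This is 1 plus \<open>rect_M\<close> at - w. For w \<ge> 0 the integrand lies in (0, 1],
  so no moments of the measure are involved.\<close>

definition stieltjes :: "real measure \<Rightarrow> real \<Rightarrow> real" where
  "stieltjes \<nu> w = (\<integral>t. 1 / (1 + t\<^sup>2 * w) \<partial>\<nu>)"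

lemma one_plus_square_pos: "w \<ge> 0 \<Longrightarrow> 1 + t\<^sup>2 * w > (0::real)"
  by (intro add_pos_nonneg) auto

context real_distribution
begin

lemma integrable_stieltjes: "w \<ge> 0 \<Longrightarrow> integrable M (\<lambda>t. 1 / (1 + t\<^sup>2 * w))"
  by (rule integrable_const_bound[of _ 1]) (use one_plus_square_pos in \<open>auto simp: divide_le_eq abs_of_pos\<close>)

lemma rect_M_eq_stieltjes:
  assumes "w \<ge> 0"
  shows "rect_M M (- w) = stieltjes M w - 1"
proof -
  have "- w * t\<^sup>2 / (1 - t\<^sup>2 * (- w)) = 1 / (1 + t\<^sup>2 * w) - 1" for t :: real
    using one_plus_square_pos[OF assms, of t] by (simp add: field_simps)
  then have "rect_M M (- w) = (\<integral>t. 1 / (1 + t\<^sup>2 * w) - 1 \<partial>M)"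
    unfolding rect_M_def by (simp only:)
  also have "\<dots> = (\<integral>t. 1 / (1 + t\<^sup>2 * w) \<partial>M) - (\<integral>t. 1 \<partial>M)"
    by (rule Bochner_Integration.integral_diff) (use integrable_stieltjes[OF assms] in simp_all)
  finally show ?thesis
    using prob_space by (simp add: stieltjes_def)
qed

lemma stieltjes_pos:
  assumes "w \<ge> 0"
  shows "stieltjes M w > 0"
proof -
  have "stieltjes M w \<ge> 0"
    unfolding stieltjes_def using one_plus_square_pos[OF assms] by (intro integral_nonneg_AE) (simp add: less_imp_le)
  moreover have "stieltjes M w \<noteq> 0"
  proof
    assume "stieltjes M w = 0"
    then have "AE t in M. 1 / (1 + t\<^sup>2 * w) = 0"
      unfolding stieltjes_def using one_plus_square_pos[OF assms]
      by (subst (asm) integral_nonneg_eq_0_iff_AE[OF integrable_stieltjes[OF assms]]) (auto simp: less_imp_le)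
    then have "AE t in M. False"
      by eventually_elim (use one_plus_square_pos[OF assms] in \<open>metis divide_eq_0_iff less_irrefl zero_neq_one\<close>)
    then show False by simp
  qed
  ultimately show ?thesis by simp
qed

lemma rect_M_gt:
  assumes "z \<le> 0"
  shows "rect_M M z > -1"
  using rect_M_eq_stieltjes[of "- z"] stieltjes_pos[of "- z"] assms by simp

lemma continuous_stieltjes: "continuous_on {0..} (stieltjes M)"
  unfolding continuous_on_sequentially comp_def
proof (intro allI ballI impI, elim conjE)
  fix a :: real and x assume x: "\<forall>n. x n \<in> {0..}" "x \<longlonglongrightarrow> a" and "a \<in> {0..}"
  then have a: "a \<ge> 0" by simp
  show "(\<lambda>n. stieltjes M (x n)) \<longlonglongrightarrow> stieltjes M a"
    unfolding stieltjes_def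
  proof (rule integral_dominated_convergence[where w = "\<lambda>_. 1"])
    show "AE t in M. (\<lambda>n. 1 / (1 + t\<^sup>2 * x n)) \<longlonglongrightarrow> 1 / (1 + t\<^sup>2 * a)"
    proof (intro AE_I2)
      fix t :: real
      have "1 + t\<^sup>2 * a \<noteq> 0" using one_plus_square_pos[OF a, of t] by simp
      then show "(\<lambda>n. 1 / (1 + t\<^sup>2 * x n)) \<longlonglongrightarrow> 1 / (1 + t\<^sup>2 * a)"
        by (intro tendsto_intros x(2))
    qed
    show "AE t in M. norm (1 / (1 + t\<^sup>2 * x n)) \<le> 1" for n
      using one_plus_square_pos[of "x n"] x(1) by (intro AE_I2) (simp add: divide_le_eq abs_of_pos)
  qed simp_all
qed

lemma continuous_rect_M: "continuous_on {..0} (rect_M M)"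
proof -
  have "continuous_on {..0} (\<lambda>z. stieltjes M (- z) - 1)"
    by (intro continuous_intros continuous_on_compose2[OF continuous_stieltjes]) auto
  then show ?thesis
    by (rule continuous_on_eq) (use rect_M_eq_stieltjes in \<open>metis atMost_iff minus_minus neg_0_le_iff_le\<close>)
qed

lemma continuous_rect_H: "continuous_on {..0} (rect_H r M)"
  unfolding rect_H_def[abs_def] by (intro continuous_intros continuous_rect_M)

lemma rect_H_0: "rect_H r M 0 = 0"
  by (simp add: rect_H_def)

lemma rect_factor_pos:
  assumes "0 < r" "r \<le> 1" "z \<le> 0"
  shows "(r * rect_M M z + 1) * (rect_M M z + 1) > 0"
proof -
  have M: "rect_M M z > -1" using rect_M_gt assms by simp
  then have "r * rect_M M z > r * (-1)" using assms by (intro mult_strict_left_mono) auto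
  then show ?thesis using M assms by (intro mult_pos_pos) auto
qed

lemma rect_H_neg: "0 < r \<Longrightarrow> r \<le> 1 \<Longrightarrow> z < 0 \<Longrightarrow> rect_H r M z < 0"
  using rect_factor_pos[of r z] by (simp add: rect_H_def mult.assoc mult_neg_pos)

lemma filterlim_rect_H:
  assumes "0 < r" "r \<le> 1"
  shows "filterlim (rect_H r M) (at_left 0) (at_left 0)"
proof -
  have "(rect_H r M \<longlongrightarrow> rect_H r M 0) (at 0 within {..0})"
    using continuous_rect_H by (simp add: continuous_on_def)
  then have "(rect_H r M \<longlongrightarrow> 0) (at_left 0)"
    unfolding rect_H_0 by (rule tendsto_mono[rotated]) (simp add: at_le lessThan_subset_iff subset_iff)
  moreover have "\<forall>\<^sub>F z in at_left 0. rect_H r M z \<in> {..<0} \<and> rect_H r M z \<noteq> 0"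
    unfolding eventually_at_filter
    by (intro always_eventually allI impI) (use rect_H_neg[OF assms] in force)
  ultimately show ?thesis
    unfolding filterlim_at by blast
qed

text \<open>By the intermediate value theorem, \<^term>\<open>rect_H r M\<close> maps left neighbourhoods of 0 onto left
  neighbourhoods of 0.\<close>

lemma eventually_rect_H_imp_eventually:
  assumes "0 < r" "r \<le> 1" and "\<forall>\<^sub>F w in at_left 0. P (rect_H r M w)"
  shows "\<forall>\<^sub>F z in at_left 0. P z"
proof -
  have "\<exists>b<0. \<forall>w>b. w < 0 \<longrightarrow> P (rect_H r M w)"
    using assms(3) eventually_at_left[of "-1::real" 0] by simp
  then obtain b where b: "b < 0" "\<And>w. b < w \<Longrightarrow> w < 0 \<Longrightarrow> P (rect_H r M w)"
    by blast
  define c where "c = b / 2"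
  have c: "b < c" "c < 0" using b by (auto simp: c_def)
  have "P z" if z: "rect_H r M c < z" "z < 0" for z
  proof -
    have "continuous_on {c..0} (rect_H r M)"
      by (rule continuous_on_subset[OF continuous_rect_H]) auto
    then obtain w where w: "c \<le> w" "w \<le> 0" "rect_H r M w = z"
      using IVT'[of "rect_H r M" c z 0] z c by (auto simp: rect_H_0)
    then have "w \<noteq> 0" using z by (auto simp: rect_H_0)
    then show ?thesis using b(2)[of w] w c by auto
  qed
  then show ?thesis
    using rect_H_neg[OF assms(1,2) c(2)] by (subst eventually_at_left[of "rect_H r M c"]) auto
qed

text \<open>The level 9 / 10 serves the next lemma, where an integrand that is at least 1 / 4 on
  [-T, T] and at least -1 elsewhere must have positive mean; for this the level has to exceed 4 /
  5.\<close>

lemma bounded_part: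
  obtains T where "T > 0" "measure M {-T..T} > 9 / 10"
proof -
  have "(\<lambda>n. measure M {- real n..real n}) \<longlonglongrightarrow> measure M (\<Union>n. {- real n..real n})"
    by (intro finite_Lim_measure_incseq) (auto simp: incseq_def)
  also have "x \<in> (\<Union>n. {- real n..real n})" for x :: real
  proof -
    obtain n where "real n \<ge> \<bar>x\<bar>" using real_arch_simple by blast
    then have "x \<in> {- real n..real n}" by auto
    then show ?thesis by blast
  qed
  then have "(\<Union>n. {- real n..real n}) = space M" by auto
  finally have "(\<lambda>n. measure M {- real n..real n}) \<longlonglongrightarrow> 1" by (simp only: prob_space)
  then have "\<forall>\<^sub>F n in sequentially. measure M {- real n..real n} > 9 / 10"
    by (rule order_tendstoD) simp
  then obtain n where "measure M {- real n..real n} > 9 / 10"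
    by (meson eventually_happens' sequentially_bot)
  moreover have "measure M {- real n..real n} \<le> measure M {- (real n + 1)..real n + 1}"
    by (intro finite_measure_mono) auto
  ultimately show ?thesis by (intro that[of "real n + 1"]) auto
qed

text \<open>Near \<open>0\<close> the function \<open>u G(u\<^sup>2)\<close> is strictly increasing. As \<open>- H(-u\<^sup>2)\<close> is the combination
  \<open>(1 - r) u (u G(u\<^sup>2)) + r (u G(u\<^sup>2))\<^sup>2\<close>, it is injective without any moment assumption.\<close>

lemma stieltjes_sqrt_strict_mono:
  obtains \<delta> where "\<delta> > 0"
    "\<And>u v. 0 < u \<Longrightarrow> u < v \<Longrightarrow> v < \<delta> \<Longrightarrow> u * stieltjes M (u\<^sup>2) < v * stieltjes M (v\<^sup>2)"
proof -
  obtain T where T: "T > 0" "measure M {-T..T} > 9 / 10" by (rule bounded_part)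
  show ?thesis
  proof (rule that)
    show "1 / (2 * T) > 0" using T by simp
    fix u v :: real assume u: "0 < u" "u < v" "v < 1 / (2 * T)"
    \<comment> \<open>This is the difference quotient of u / (1 + t^2 u^2) between u and v, so the
      claim amounts to its mean being positive.\<close>
    define \<phi> where "\<phi> t = (1 - t\<^sup>2 * (u * v)) / ((1 + t\<^sup>2 * u\<^sup>2) * (1 + t\<^sup>2 * v\<^sup>2))" for t
    have p: "1 + t\<^sup>2 * u\<^sup>2 > 0" "1 + t\<^sup>2 * v\<^sup>2 > 0" for t
      using one_plus_square_pos by auto
    have diff: "v * (1 / (1 + t\<^sup>2 * v\<^sup>2)) - u * (1 / (1 + t\<^sup>2 * u\<^sup>2)) = (v - u) * \<phi> t" for t
      using p[of t] unfolding \<phi>_def by (simp add: divide_simps) (simp add: algebra_simps power2_eq_square)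
    have int: "integrable M (\<lambda>t. 1 / (1 + t\<^sup>2 * u\<^sup>2))" "integrable M (\<lambda>t. 1 / (1 + t\<^sup>2 * v\<^sup>2))"
      by (simp_all add: integrable_stieltjes)
    have "v * stieltjes M (v\<^sup>2) - u * stieltjes M (u\<^sup>2) = (\<integral>t. v * (1 / (1 + t\<^sup>2 * v\<^sup>2)) - u * (1 / (1 + t\<^sup>2 * u\<^sup>2)) \<partial>M)"
      unfolding stieltjes_def
      by (simp only: Bochner_Integration.integral_diff[OF integrable_mult_right[OF int(2)] integrable_mult_right[OF int(1)]]
          integral_mult_right_zero)
    also have "\<dots> = (v - u) * (\<integral>t. \<phi> t \<partial>M)"
      unfolding diff by simp
    finally have eq: "v * stieltjes M (v\<^sup>2) - u * stieltjes M (u\<^sup>2) = (v - u) * (\<integral>t. \<phi> t \<partial>M)" .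
    have int_diff: "integrable M (\<lambda>t. (v - u) * \<phi> t)"
      unfolding diff[symmetric] using int by (intro Bochner_Integration.integrable_diff integrable_mult_right)
    then have int_\<phi>: "integrable M \<phi>" using u by simp
    have lower1: "\<phi> t \<ge> -1" for t
    proof -
      have "1 + t\<^sup>2 * v\<^sup>2 \<le> (1 + t\<^sup>2 * u\<^sup>2) * (1 + t\<^sup>2 * v\<^sup>2)"
        using p[of t] mult_right_mono[of 1 "1 + t\<^sup>2 * u\<^sup>2" "1 + t\<^sup>2 * v\<^sup>2"] by simp
      moreover have "t\<^sup>2 * (u * v) \<le> t\<^sup>2 * v\<^sup>2"
        using u by (intro mult_left_mono) (auto simp: power2_eq_square)
      moreover have "- P \<le> 1 - a" if "1 + b \<le> P" "a \<le> b" for P a b :: real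
        using that by linarith
      ultimately have "- ((1 + t\<^sup>2 * u\<^sup>2) * (1 + t\<^sup>2 * v\<^sup>2)) \<le> 1 - t\<^sup>2 * (u * v)" by blast
      then show ?thesis using p[of t] by (simp add: \<phi>_def le_divide_eq)
    qed
    \<comment> \<open>On [-T, T] the bound v < 1 / (2 T) gives t^2 v^2 \<le> 1 / 4. Hence the
      numerator is at least 3 / 4 and the denominator at most 25 / 16.\<close>
    have lower2: "\<phi> t \<ge> 1 / 4" if "t \<in> {-T..T}" for t
    proof -
      have "\<bar>t\<bar> \<le> T" using that by auto
      have "\<bar>t\<bar> * v \<le> T * v" using \<open>\<bar>t\<bar> \<le> T\<close> u by (intro mult_right_mono) auto
      also have "\<dots> \<le> 1 / 2" using u T by (simp add: field_simps)
      finally have tv: "\<bar>t\<bar> * v \<le> 1 / 2" .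
      have "t\<^sup>2 * v\<^sup>2 = (\<bar>t\<bar> * v)\<^sup>2" by (simp add: power_mult_distrib)
      also have "\<dots> \<le> (1 / 2)\<^sup>2" using tv u by (intro power_mono) auto
      finally have v4: "t\<^sup>2 * v\<^sup>2 \<le> 1 / 4" by (simp add: power2_eq_square)
      have uv: "t\<^sup>2 * (u * v) \<le> t\<^sup>2 * v\<^sup>2" "t\<^sup>2 * u\<^sup>2 \<le> t\<^sup>2 * v\<^sup>2"
        using u by (auto intro!: mult_left_mono simp: power2_eq_square mult_mono)
      have "(1 + t\<^sup>2 * u\<^sup>2) * (1 + t\<^sup>2 * v\<^sup>2) \<le> (5 / 4) * (5 / 4)"
        using v4 uv p[of t] by (intro mult_mono) auto
      then have "1 / 4 * ((1 + t\<^sup>2 * u\<^sup>2) * (1 + t\<^sup>2 * v\<^sup>2)) \<le> 1 - t\<^sup>2 * (u * v)"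
      proof -
        have "1 / 4 * P \<le> 1 - a" if "P \<le> (5 / 4) * (5 / 4)" "a \<le> b" "b \<le> 1 / 4" for P a b :: real
          using that by linarith
        then show ?thesis using v4 uv(1) \<open>_ \<le> (5 / 4) * (5 / 4)\<close> by blast
      qed
      then show ?thesis using p[of t] by (simp add: \<phi>_def le_divide_eq)
    qed
    have int_ind: "integrable M (\<lambda>t. indicator {-T..T} t :: real)"
      by (rule integrable_const_bound[of _ 1]) (auto split: split_indicator)
    \<comment> \<open>The function 5 / 4 times the indicator, minus 1, takes the values 1 / 4 and
      -1, so it combines both lower bounds.\<close>
    have "(\<integral>t. \<phi> t \<partial>M) \<ge> (\<integral>t. (5 / 4) * indicator {-T..T} t - 1 \<partial>M)"
      using int_ind lower1 lower2
      by (intro integral_mono int_\<phi> Bochner_Integration.integrable_diff integrable_mult_right) (auto simp: indicator_def)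
    also have "(\<integral>t. (5 / 4) * indicator {-T..T} t - 1 \<partial>M) = (5 / 4) * measure M {-T..T} - 1"
      using int_ind prob_space by (subst Bochner_Integration.integral_diff) simp_all
    finally have "(\<integral>t. \<phi> t \<partial>M) > 0" using T(2) by linarith
    then show "u * stieltjes M (u\<^sup>2) < v * stieltjes M (v\<^sup>2)"
      using eq u mult_pos_pos[of "v - u" "\<integral>t. \<phi> t \<partial>M"] by linarith
  qed
qed

lemma rect_H_inj:
  assumes "0 < r" "r \<le> 1"
  shows "\<exists>\<beta>>0. inj_on (rect_H r M) {-\<beta><..<0}"
proof -
  obtain \<delta> where \<delta>: "\<delta> > 0"
    "\<And>u v. 0 < u \<Longrightarrow> u < v \<Longrightarrow> v < \<delta> \<Longrightarrow> u * stieltjes M (u\<^sup>2) < v * stieltjes M (v\<^sup>2)"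
    using stieltjes_sqrt_strict_mono by blast
  define S where "S u = u * stieltjes M (u\<^sup>2)" for u
  have H: "rect_H r M (- (u\<^sup>2)) = - ((1 - r) * (u * S u) + r * (S u)\<^sup>2)" for u
    by (simp add: rect_H_def rect_M_eq_stieltjes S_def power2_eq_square algebra_simps)
  have mono: "rect_H r M (- (v\<^sup>2)) < rect_H r M (- (u\<^sup>2))" if uv: "0 < u" "u < v" "v < \<delta>" for u v
  proof -
    have S: "0 < S u" "S u < S v" using uv \<delta>(2) stieltjes_pos[of "u\<^sup>2"] by (auto simp: S_def)
    then have "(1 - r) * (u * S u) \<le> (1 - r) * (v * S v)"
      using uv assms by (intro mult_left_mono mult_mono) auto
    moreover have "r * (S u)\<^sup>2 < r * (S v)\<^sup>2"
      using S assms by (intro mult_strict_left_mono power_strict_mono) auto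
    ultimately show ?thesis unfolding H by linarith
  qed
  have "inj_on (rect_H r M) {- (\<delta>\<^sup>2)<..<0}"
  proof (rule linorder_inj_onI)
    fix a b :: real assume ab: "a < b" "a \<in> {- (\<delta>\<^sup>2)<..<0}" "b \<in> {- (\<delta>\<^sup>2)<..<0}"
    have "sqrt (- a) < sqrt (\<delta>\<^sup>2)" using ab(2) by (intro real_sqrt_less_mono) auto
    then have "sqrt (- a) < \<delta>" using \<delta>(1) by simp
    then have "rect_H r M (- ((sqrt (- a))\<^sup>2)) < rect_H r M (- ((sqrt (- b))\<^sup>2))"
      using ab by (intro mono) auto
    then show "rect_H r M a \<noteq> rect_H r M b" using ab by simp
  qed auto
  then show ?thesis using \<delta>(1) by (intro exI[of _ "\<delta>\<^sup>2"]) auto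
qed

text \<open>At (r m + 1) (m + 1) - 1 the radicand of \<open>rect_U\<close> is the square of 2 r m +
  r + 1. Since m > -1 and r \<le> 1, this number is nonnegative, so the square root selects the
  branch that returns m.\<close>

lemma rect_R_rect_H:
  assumes "0 < r" "r \<le> 1"
  shows "\<forall>\<^sub>F w in at_left 0. rect_R r M (rect_H r M w) = rect_M M w"
proof -
  define \<beta> where "\<beta> = (SOME \<beta>. \<beta> > 0 \<and> inj_on (rect_H r M) {-\<beta><..<0})"
  have \<beta>: "\<beta> > 0" "inj_on (rect_H r M) {-\<beta><..<0}"
    using someI_ex[OF rect_H_inj[OF assms]] unfolding \<beta>_def by auto
  have "rect_R r M (rect_H r M w) = rect_M M w" if w: "-\<beta> < w" "w < 0" for w
  proof -
    define m where "m = rect_M M w"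
    have m: "m > -1" using rect_M_gt w by (simp add: m_def)
    have "rect_R r M (rect_H r M w) = rect_U r (rect_H r M w / w - 1)"
      unfolding rect_R_def Let_def \<beta>_def[symmetric] using inv_into_f_f[OF \<beta>(2)] w by simp
    also have "rect_H r M w / w = (r * m + 1) * (m + 1)"
      using w by (simp add: rect_H_def m_def)
    also have "rect_U r ((r * m + 1) * (m + 1) - 1) = (- r - 1 + sqrt ((2 * r * m + r + 1)\<^sup>2)) / (2 * r)"
      unfolding rect_U_def by (simp add: power2_eq_square algebra_simps)
    also have "2 * r * m + r + 1 \<ge> 0"
    proof -
      have "2 * r * m \<ge> 2 * r * (-1)" using m assms by (intro mult_left_mono) auto
      then show ?thesis using assms by linarith
    qed
    then have "sqrt ((2 * r * m + r + 1)\<^sup>2) = 2 * r * m + r + 1" by simp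
    finally show ?thesis using assms by (simp add: m_def)
  qed
  then show ?thesis
    using \<beta>(1) by (subst eventually_at_left[of "-\<beta>"]) (auto intro!: exI[of _ "-\<beta>"])
qed

end

section \<open>The transform determines the measure\<close>

text \<open>The integrand is a geometric series in h / (s + t^2), dominated by powers of |h| / s
  uniformly in t. It can therefore be integrated term by term for an arbitrary distribution.\<close>

lemma (in real_distribution) resolvent_power_series:
  assumes "s > 0" "\<bar>h\<bar> < s"
  shows "(\<lambda>k. (\<integral>t. (1 / (s + t\<^sup>2)) ^ Suc k \<partial>M) * (- h) ^ k) sums (\<integral>t. 1 / (s + h + t\<^sup>2) \<partial>M)"
proof -
  define f :: "nat \<Rightarrow> real \<Rightarrow> real" where "f k t = (1 / (s + t\<^sup>2)) ^ Suc k * (- h) ^ k" for k t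
  have y: "0 < s + t\<^sup>2" "0 < 1 / (s + t\<^sup>2)" "1 / (s + t\<^sup>2) \<le> 1 / s" for t :: real
  proof -
    show "0 < s + t\<^sup>2" using assms(1) by (intro add_pos_nonneg) auto
    then show "0 < 1 / (s + t\<^sup>2)" by simp
    show "1 / (s + t\<^sup>2) \<le> 1 / s" using assms(1) by (intro divide_left_mono) (auto intro!: mult_pos_pos add_pos_nonneg)
  qed
  have le: "norm (f k t) \<le> 1 / s * (\<bar>h\<bar> / s) ^ k" for k t
  proof -
    have "norm (f k t) = 1 / (s + t\<^sup>2) * (\<bar>h\<bar> * (1 / (s + t\<^sup>2))) ^ k"
      using y(1)[of t] by (simp add: f_def abs_mult power_abs power_mult_distrib power_divide abs_of_pos)
    also have "\<dots> \<le> 1 / s * (\<bar>h\<bar> * (1 / s)) ^ k"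
      using y[of t] assms(1) by (intro mult_mono power_mono mult_nonneg_nonneg zero_le_power) (auto intro: less_imp_le)
    finally show ?thesis by simp
  qed
  have summable_geo: "summable (\<lambda>k. 1 / s * (\<bar>h\<bar> / s) ^ k)"
    using assms by (intro summable_mult summable_geometric) simp
  have meas: "f k \<in> borel_measurable M" for k
    unfolding f_def[abs_def] by simp
  have int: "integrable M (f k)" for k
    by (rule integrable_const_bound[of _ "1 / s * (\<bar>h\<bar> / s) ^ k"]) (use le meas in auto)
  have summable: "summable (\<lambda>k. norm (f k t))" for t
    using le by (intro summable_comparison_test'[OF summable_geo, of 0]) simp
  have "(\<integral>t. norm (f k t) \<partial>M) \<le> 1 / s * (\<bar>h\<bar> / s) ^ k" for k
    using integral_mono[OF integrable_norm[OF int[of k]], of "\<lambda>_. 1 / s * (\<bar>h\<bar> / s) ^ k"] le prob_space by simp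
  then have summable_int: "summable (\<lambda>k. \<integral>t. norm (f k t) \<partial>M)"
    by (intro summable_comparison_test'[OF summable_geo, of 0]) (simp add: integral_nonneg_AE)
  have "(\<lambda>k. \<integral>t. f k t \<partial>M) sums (\<integral>t. (\<Sum>k. f k t) \<partial>M)"
    by (intro sums_integral int summable_int AE_I2 summable)
  moreover have "(\<Sum>k. f k t) = 1 / (s + h + t\<^sup>2)" for t
  proof -
    define y where "y = 1 / (s + t\<^sup>2)"
    have "\<bar>h\<bar> * y \<le> \<bar>h\<bar> * (1 / s)"
      using y(3)[of t] by (intro mult_left_mono) (auto simp: y_def)
    also have "\<dots> < 1" using assms by simp
    finally have "norm (- h * y) < 1" using y(2)[of t] by (simp add: y_def abs_mult)
    then have "(\<lambda>k. y * (- h * y) ^ k) sums (y * (1 / (1 - (- h * y))))"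
      by (intro sums_mult geometric_sums)
    moreover have "f k t = y * (- h * y) ^ k" for k
      by (simp only: f_def y_def[symmetric] power_mult_distrib power_Suc mult_ac)
    moreover have "y * (1 / (1 - (- h * y))) = 1 / (s + h + t\<^sup>2)"
    proof -
      have "s + h > 0" using assms by linarith
      then have "s + h + t\<^sup>2 > 0" by (rule add_pos_nonneg) simp
      then show ?thesis using y(1)[of t] by (simp add: y_def field_simps)
    qed
    ultimately show ?thesis by (simp add: sums_iff)
  qed
  moreover have "(\<integral>t. f k t \<partial>M) = (\<integral>t. (1 / (s + t\<^sup>2)) ^ Suc k \<partial>M) * (- h) ^ k" for k
    unfolding f_def by (rule integral_mult_left_zero)
  ultimately show ?thesis
    by (simp only:)
qed

text \<open>The Taylor coefficients of the resolvent at a far point \<open>s\<close> are the moments of the bounded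
  variable \<open>1 / (s + t\<^sup>2)\<close>, which determine its law.\<close>

lemma stieltjes_eq_imp_distr_square_eq:
  assumes "real_distribution \<nu>1" "real_distribution \<nu>2" and "\<delta> > 0"
    and eq: "\<And>w. 0 < w \<Longrightarrow> w < \<delta> \<Longrightarrow> stieltjes \<nu>1 w = stieltjes \<nu>2 w"
  shows "distr \<nu>1 borel (\<lambda>t. t\<^sup>2) = distr \<nu>2 borel (\<lambda>t. t\<^sup>2)"
proof -
  interpret N1: real_distribution \<nu>1 by fact
  interpret N2: real_distribution \<nu>2 by fact
  \<comment> \<open>With x = 1 / w the known range w < \<delta> becomes x > 1 / \<delta>. The added
    1 leaves room for an expansion around s with radius up to 1.\<close>
  define s where "s = 1 / \<delta> + 1"
  have s: "s > 0" using \<open>\<delta> > 0\<close> by (simp add: s_def add_pos_pos)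
  have ypos: "0 < s + t\<^sup>2" for t :: real using s by (intro add_pos_nonneg) auto
  have R: "(\<integral>t. 1 / (x + t\<^sup>2) \<partial>\<nu>1) = (\<integral>t. 1 / (x + t\<^sup>2) \<partial>\<nu>2)" if x: "x > 1 / \<delta>" for x
  proof -
    have x0: "x > 0" using less_trans[OF _ x] \<open>\<delta> > 0\<close> by simp
    have "1 / x < \<delta>" using x x0 \<open>\<delta> > 0\<close> by (simp add: field_simps)
    then have "stieltjes \<nu>1 (1 / x) = stieltjes \<nu>2 (1 / x)" using eq x0 by simp
    moreover have "stieltjes \<nu> (1 / x) = x * (\<integral>t. 1 / (x + t\<^sup>2) \<partial>\<nu>)" for \<nu>
    proof -
      have "1 / (1 + t\<^sup>2 * (1 / x)) = x * (1 / (x + t\<^sup>2))" for t :: real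
        using x0 by (simp add: field_simps)
      then show ?thesis unfolding stieltjes_def by (simp only: integral_mult_right_zero)
    qed
    ultimately show ?thesis using x0 by simp
  qed
  define D where "D k = (\<integral>t. (1 / (s + t\<^sup>2)) ^ Suc k \<partial>\<nu>1) - (\<integral>t. (1 / (s + t\<^sup>2)) ^ Suc k \<partial>\<nu>2)" for k
  define r where "r = min 1 s"
  have r: "r > 0" "r \<le> 1" "r \<le> s" using s by (auto simp: r_def)
  have sums0: "(\<lambda>k. D k * (x - 0) ^ k) sums 0" if "norm (x - 0) < r" for x
  proof -
    have "\<bar>- x\<bar> < s" "s + (- x) > 1 / \<delta>" using that r by (auto simp: s_def)
    from sums_diff[OF N1.resolvent_power_series[OF s this(1)] N2.resolvent_power_series[OF s this(1)]] R[OF this(2)]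
    show ?thesis by (simp add: D_def left_diff_distrib)
  qed
  have D0: "D k = 0" for k
  proof (rule ccontr)
    assume nz: "D k \<noteq> 0"
    \<comment> \<open>The principle of isolated zeros in \<open>powser_0_nonzero\<close> is stated
      for a nonzero coefficient of positive index; index 0 is read off at the centre.\<close>
    have "D 0 = 0" using sums_unique2[OF sums0[of 0]] r powser_sums_zero[of D] by simp
    then have "k > 0" using nz by (cases k) auto
    obtain e where "e > 0" "\<And>z. z \<in> cball 0 e - {0} \<Longrightarrow> (\<lambda>_::real. 0 :: real) z \<noteq> 0"
      using powser_0_nonzero[where f = "\<lambda>_. 0", OF r(1) sums0 refl nz \<open>k > 0\<close>] by blast
    from this(2)[of e] this(1) show False by simp
  qed
  define y where "y t = 1 / (s + t\<^sup>2)" for t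
  have [measurable]: "y \<in> borel_measurable borel" unfolding y_def[abs_def] by measurable
  have "\<bar>y t\<bar> \<le> 1 / s" for t
    using ypos[of t] s unfolding y_def by (simp add: abs_of_pos divide_left_mono)
  then have AEy: "AE x in distr \<nu> borel y. \<bar>x\<bar> \<le> 1 / s" if "real_distribution \<nu>" for \<nu>
    using real_distribution.events_eq_borel[OF that] by (subst AE_distr_iff) (auto cong: measurable_cong_sets)
  have mom: "(\<integral>x. x ^ k \<partial>distr \<nu>1 borel y) = (\<integral>x. x ^ k \<partial>distr \<nu>2 borel y)" for k
  proof (cases k)
    case 0
    then show ?thesis using N1.prob_space N2.prob_space by (simp add: measure_distr)
  next
    case (Suc i)
    then show ?thesis using D0[of i] by (simp add: D_def integral_distr y_def)
  qed
  have "distr \<nu>1 borel y = distr \<nu>2 borel y"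
    by (rule real_distribution_eqI_moments[OF _ _ _ AEy[OF assms(1)] AEy[OF assms(2)] mom]) (use s in simp_all)
  then have "distr (distr \<nu>1 borel y) borel (\<lambda>x. 1 / x - s) = distr (distr \<nu>2 borel y) borel (\<lambda>x. 1 / x - s)"
    by simp
  moreover have "(\<lambda>x. 1 / x - s) \<circ> y = (\<lambda>t. t\<^sup>2)"
    by (simp add: y_def fun_eq_iff)
  ultimately show ?thesis
    by (simp add: distr_distr)
qed

text \<open>By symmetry, twice the characteristic function is the mean of 2 cos (u t), which is even
  in t and hence a function of t^2.\<close>

lemma symmetric_distribution_eqI:
  assumes "symmetric_distribution \<nu>1" "symmetric_distribution \<nu>2"
    and eq: "distr \<nu>1 borel (\<lambda>t. t\<^sup>2) = distr \<nu>2 borel (\<lambda>t. t\<^sup>2)"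
  shows "\<nu>1 = \<nu>2"
proof (rule Levy_uniqueness)
  show "real_distribution \<nu>1" "real_distribution \<nu>2" using assms by (auto simp: symmetric_distribution_def)
  have "2 * char \<nu> u = (\<integral>x. iexp (u * sqrt x) + iexp (- (u * sqrt x)) \<partial>distr \<nu> borel (\<lambda>t. t\<^sup>2))"
    if \<nu>: "symmetric_distribution \<nu>" for \<nu> u
  proof -
    interpret real_distribution \<nu> using \<nu> by (simp add: symmetric_distribution_def)
    have int: "integrable \<nu> (\<lambda>t. iexp (v * t))" for v
      by (rule integrable_const_bound[of _ 1]) auto
    have "char \<nu> u = char (distr \<nu> borel uminus) u"
      using \<nu> by (simp add: symmetric_distribution_def)
    also have "\<dots> = (\<integral>t. iexp (- (u * t)) \<partial>\<nu>)"
      unfolding char_def by (subst integral_distr) simp_all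
    finally have "2 * char \<nu> u = (\<integral>t. iexp (u * t) \<partial>\<nu>) + (\<integral>t. iexp (- (u * t)) \<partial>\<nu>)"
      by (simp add: char_def)
    also have "\<dots> = (\<integral>t. iexp (u * t) + iexp (- (u * t)) \<partial>\<nu>)"
      using int[of u] int[of "- u"] by simp
    also have "\<dots> = (\<integral>t. iexp (u * sqrt (t\<^sup>2)) + iexp (- (u * sqrt (t\<^sup>2))) \<partial>\<nu>)"
      by (intro Bochner_Integration.integral_cong) (auto simp: abs_if)
    also have "\<dots> = (\<integral>x. iexp (u * sqrt x) + iexp (- (u * sqrt x)) \<partial>distr \<nu> borel (\<lambda>t. t\<^sup>2))"
      by (subst integral_distr) simp_all
    finally show ?thesis .
  qed
  then have "2 * char \<nu>1 u = 2 * char \<nu>2 u" for u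
    using assms(1,2) eq by simp
  then show "char \<nu>1 = char \<nu>2" by (simp add: fun_eq_iff)
qed

text \<open>Write M1, H1, M2, H2 for \<open>rect_M\<close> and \<open>rect_H\<close> of the two
  measures. For small w < 0 the intermediate value theorem gives w' with H2(w') = H1(w), and equal
  transforms give M2(w') = M1(w). Dividing both values of H by the common positive factor (r M + 1)
  (M + 1) yields w' = w, so M1 and M2 agree near 0.\<close>

lemma rect_R_unique:
  assumes "symmetric_distribution \<nu>1" "symmetric_distribution \<nu>2" and r: "0 < r" "r \<le> 1"
    and eq: "\<forall>\<^sub>F z in at_left 0. rect_R r \<nu>1 z = rect_R r \<nu>2 z"
  shows "\<nu>1 = \<nu>2"
proof -
  interpret N1: real_distribution \<nu>1 using assms by (simp add: symmetric_distribution_def)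
  interpret N2: real_distribution \<nu>2 using assms by (simp add: symmetric_distribution_def)
  have "\<forall>\<^sub>F z in at_left 0. \<exists>w<0. rect_H r \<nu>2 w = z \<and> rect_R r \<nu>2 z = rect_M \<nu>2 w"
  proof (rule N2.eventually_rect_H_imp_eventually[OF r])
    have "\<forall>\<^sub>F w in at_left (0::real). w < 0" by (simp add: eventually_at_filter)
    with N2.rect_R_rect_H[OF r]
    show "\<forall>\<^sub>F w in at_left 0. \<exists>w'<0. rect_H r \<nu>2 w' = rect_H r \<nu>2 w \<and> rect_R r \<nu>2 (rect_H r \<nu>2 w) = rect_M \<nu>2 w'"
      by eventually_elim blast
  qed
  then have "\<forall>\<^sub>F w in at_left 0. \<exists>w'<0. rect_H r \<nu>2 w' = rect_H r \<nu>1 w \<and> rect_R r \<nu>2 (rect_H r \<nu>1 w) = rect_M \<nu>2 w'"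
    by (rule eventually_compose_filterlim[OF _ N1.filterlim_rect_H[OF r]])
  moreover have "\<forall>\<^sub>F w in at_left 0. rect_R r \<nu>1 (rect_H r \<nu>1 w) = rect_R r \<nu>2 (rect_H r \<nu>1 w)"
    by (rule eventually_compose_filterlim[OF eq N1.filterlim_rect_H[OF r]])
  moreover have "\<forall>\<^sub>F w in at_left (0::real). w < 0" by (simp add: eventually_at_filter)
  ultimately have "\<forall>\<^sub>F w in at_left 0. rect_M \<nu>1 w = rect_M \<nu>2 w"
    using N1.rect_R_rect_H[OF r]
  proof eventually_elim
    case (elim w)
    then obtain w' where w': "w' < 0" "rect_H r \<nu>2 w' = rect_H r \<nu>1 w" "rect_M \<nu>2 w' = rect_M \<nu>1 w"
      by auto
    have "(r * rect_M \<nu>1 w + 1) * (rect_M \<nu>1 w + 1) > 0"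
      using N1.rect_factor_pos[OF r, of w] elim by simp
    then have "r * rect_M \<nu>1 w + 1 \<noteq> 0" "rect_M \<nu>1 w + 1 \<noteq> 0" by auto
    then have "w' = w" using w'(2) unfolding rect_H_def w'(3) by simp
    then show ?case using w' by simp
  qed
  then obtain b where b: "b < 0" "\<And>w. b < w \<Longrightarrow> w < 0 \<Longrightarrow> rect_M \<nu>1 w = rect_M \<nu>2 w"
    using eventually_at_left[of "-1::real" 0] by auto
  have "stieltjes \<nu>1 w = stieltjes \<nu>2 w" if "0 < w" "w < - b" for w
    using b(2)[of "- w"] that N1.rect_M_eq_stieltjes[of w] N2.rect_M_eq_stieltjes[of w] by simp
  then have "distr \<nu>1 borel (\<lambda>t. t\<^sup>2) = distr \<nu>2 borel (\<lambda>t. t\<^sup>2)"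
    using b(1) by (intro stieltjes_eq_imp_distr_square_eq[of _ _ "- b"] N1.real_distribution_axioms N2.real_distribution_axioms) auto
  then show ?thesis
    by (rule symmetric_distribution_eqI[OF assms(1,2)])
qed

section \<open>Analytic extension of the rectangular R-transform\<close>

definition complex_fps :: "real fps \<Rightarrow> complex fps" where
  "complex_fps F = Abs_fps (\<lambda>k. of_real (F $ k))"

lemma complex_fps_nth [simp]: "complex_fps F $ k = of_real (F $ k)"
  by (simp add: complex_fps_def)

lemma complex_fps_add: "complex_fps (F + G) = complex_fps F + complex_fps G"
  by (simp add: fps_eq_iff)

lemma complex_fps_mult: "complex_fps (F * G) = complex_fps F * complex_fps G"
  by (simp add: fps_eq_iff fps_mult_nth)

lemma complex_fps_1: "complex_fps 1 = 1"
  by (simp add: fps_eq_iff)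

lemma complex_fps_X: "complex_fps fps_X = fps_X"
  by (simp add: fps_eq_iff)

lemma complex_fps_const: "complex_fps (fps_const c) = fps_const (of_real c)"
  by (simp add: fps_eq_iff)

lemma complex_fps_power: "complex_fps (F ^ n) = complex_fps F ^ n"
  by (induction n) (simp_all add: complex_fps_1 complex_fps_mult)

lemma complex_fps_compose: "complex_fps (fps_compose F G) = fps_compose (complex_fps F) (complex_fps G)"
  by (simp add: fps_eq_iff fps_compose_nth flip: complex_fps_power)

text \<open>The series of \<^const>\<open>rect_M\<close> and \<^const>\<open>rect_H\<close>, not for \<open>M\<close> but for \<^term>\<open>sqrt_measure M\<close>.\<close>

definition moment_series :: "real measure \<Rightarrow> real fps" where
  "moment_series M = Abs_fps (\<lambda>k. if k = 0 then 0 else (\<integral>x. x ^ k \<partial>M))"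

definition H_series :: "real \<Rightarrow> real fps \<Rightarrow> real fps" where
  "H_series r m = fps_X * (1 + fps_const r * m) * (1 + m)"

lemma H_series_nth_0 [simp]: "H_series r m $ 0 = 0"
  by (simp add: H_series_def)

lemma H_series_nth_1: "m $ 0 = 0 \<Longrightarrow> H_series r m $ 1 = 1"
  by (simp add: H_series_def mult.assoc)

lemma moment_series_0 [simp]: "moment_series M $ 0 = 0"
  by (simp add: moment_series_def)

locale bounded_nonneg_distribution = real_distribution M for M +
  fixes C :: real
  assumes C: "C > 0" and support: "AE x in M. 0 \<le> x \<and> x \<le> C"
begin

lemma integrable_power: "integrable M (\<lambda>x. x ^ k)"
proof (rule integrable_bounded_support)
  show "AE x in M. \<bar>x ^ k\<bar> \<le> C ^ k"
    using support by eventually_elim (simp add: power_abs power_mono)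
qed simp

lemma moment_bounds: "0 \<le> (\<integral>x. x ^ k \<partial>M)" "(\<integral>x. x ^ k \<partial>M) \<le> C ^ k"
proof -
  show "0 \<le> (\<integral>x. x ^ k \<partial>M)"
    by (rule integral_nonneg_AE) (use support in eventually_elim, simp)
  have "(\<integral>x. x ^ k \<partial>M) \<le> (\<integral>x. C ^ k \<partial>M)"
    by (rule integral_mono_AE[OF integrable_power]) (simp, use support in eventually_elim, simp add: power_mono)
  then show "(\<integral>x. x ^ k \<partial>M) \<le> C ^ k" using prob_space by simp
qed

lemma rect_M_sqrt_measure:
  assumes "z \<le> 0"
  shows "rect_M (sqrt_measure M) z = (\<integral>x. z * x / (1 - x * z) \<partial>M)"
proof -
  define f where "f t = z * t\<^sup>2 / (1 - t\<^sup>2 * z)" for t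
  have [measurable]: "f \<in> borel_measurable borel" unfolding f_def[abs_def] by simp
  have f_bound: "\<bar>f t\<bar> \<le> 1" for t
  proof -
    have "z * t\<^sup>2 \<le> 0" using assms by (intro mult_nonpos_nonneg) auto
    then have "\<bar>z * t\<^sup>2\<bar> = - (t\<^sup>2 * z)" and neg: "t\<^sup>2 * z \<le> 0" by (simp_all add: mult.commute)
    moreover have "\<bar>1 - t\<^sup>2 * z\<bar> = 1 + - (t\<^sup>2 * z)" using neg by simp
    moreover have "a / (1 + a) \<le> 1" if "a \<ge> 0" for a :: real
      using that by (simp add: divide_le_eq)
    from this[of "- (t\<^sup>2 * z)"] have "- (t\<^sup>2 * z) / (1 + - (t\<^sup>2 * z)) \<le> 1"
      using neg by simp
    ultimately show ?thesis by (simp only: f_def abs_divide)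
  qed
  have "rect_M (sqrt_measure M) z = (\<integral>t. f t \<partial>sqrt_measure M)"
    by (simp add: rect_M_def f_def)
  also have "\<dots> = (\<integral>x. (f (sqrt x) + f (- sqrt x)) / 2 \<partial>M)"
    by (rule integral_sqrt_measure[OF real_distribution_axioms _ f_bound]) simp
  also have "\<dots> = (\<integral>x. z * x / (1 - x * z) \<partial>M)"
  proof (rule integral_cong_AE)
    have even: "f (- t) = f t" for t by (simp add: f_def)
    have avg: "(f t + f (- t)) / 2 = f t" for t by (simp add: even)
    show "AE x in M. (f (sqrt x) + f (- sqrt x)) / 2 = z * x / (1 - x * z)"
      unfolding avg using support by eventually_elim (simp add: f_def)
  qed simp_all
  finally show ?thesis .
qed

lemma rect_M_power_series:
  assumes "z \<le> 0" "C * \<bar>z\<bar> < 1"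
  shows "(\<lambda>k. moment_series M $ k * z ^ k) sums rect_M (sqrt_measure M) z"
proof -
  define f where "f k x = (if k = 0 then 0 else x ^ k * z ^ k)" for k :: nat and x
  have le: "AE x in M. norm (f k x) \<le> (C * \<bar>z\<bar>) ^ k" for k
    using support
    by eventually_elim (auto simp: f_def abs_mult power_abs power_mult_distrib intro!: mult_right_mono power_mono)
  have summable_geo: "summable (\<lambda>k. (C * \<bar>z\<bar>) ^ k)"
    using assms C by (intro summable_geometric) (simp add: abs_mult)
  have [measurable]: "f k \<in> borel_measurable borel" for k
    unfolding f_def[abs_def] by simp
  have int: "integrable M (f k)" for k
    by (rule integrable_const_bound[OF le[of k]]) simp
  have summable: "AE x in M. summable (\<lambda>k. norm (f k x))"
  proof -
    have "AE x in M. \<forall>k. norm (f k x) \<le> (C * \<bar>z\<bar>) ^ k" unfolding AE_all_countable using le by blast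
    then show ?thesis
      by eventually_elim (intro summable_comparison_test'[OF summable_geo, of 0], simp)
  qed
  have "(\<integral>x. norm (f k x) \<partial>M) \<le> (C * \<bar>z\<bar>) ^ k" for k
    using integral_mono_AE[OF integrable_norm[OF int[of k]] _ le[of k]] prob_space by simp
  then have summable_int: "summable (\<lambda>k. \<integral>x. norm (f k x) \<partial>M)"
    by (intro summable_comparison_test'[OF summable_geo, of 0]) (simp add: integral_nonneg_AE)
  have "(\<lambda>k. \<integral>x. f k x \<partial>M) sums (\<integral>x. (\<Sum>k. f k x) \<partial>M)"
    by (intro sums_integral int summable_int summable)
  moreover have "(\<integral>x. f k x \<partial>M) = moment_series M $ k * z ^ k" for k
    by (simp add: f_def moment_series_def)
  moreover have "(\<integral>x. (\<Sum>k. f k x) \<partial>M) = rect_M (sqrt_measure M) z"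
    unfolding rect_M_sqrt_measure[OF assms(1)]
  proof (rule integral_cong_AE)
    show "AE x in M. (\<Sum>k. f k x) = z * x / (1 - x * z)"
      using support
    proof eventually_elim
      case (elim x)
      have "\<bar>x * z\<bar> \<le> C * \<bar>z\<bar>" using elim by (auto simp: abs_mult intro!: mult_right_mono)
      then have n: "norm (x * z) < 1" using assms by simp
      then have ne: "1 - x * z \<noteq> 0" by auto
      have "(\<lambda>k. (x * z) ^ k) sums (1 / (1 - x * z))" using n by (rule geometric_sums)
      then have "(\<lambda>k. (x * z) ^ Suc k) sums (1 / (1 - x * z) - 1)"
        by (subst sums_Suc_iff) simp
      then have "(\<lambda>k. f (Suc k) x) sums (1 / (1 - x * z) - 1)"
        by (simp add: f_def power_mult_distrib mult_ac)
      then have "f (0 :: nat) x = 0 \<Longrightarrow> (\<lambda>k. f k x) sums (1 / (1 - x * z) - 1)"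
        by (subst (asm) sums_Suc_iff) simp
      then have "(\<Sum>k. f k x) = 1 / (1 - x * z) - 1" by (simp add: f_def sums_iff)
      also have "\<dots> = z * x / (1 - x * z)" using ne by (simp add: field_simps)
      finally show ?case .
    qed
  qed simp_all
  ultimately show ?thesis by simp
qed

lemma moment_series_conv_radius: "fps_conv_radius (complex_fps (moment_series M)) > 0"
proof -
  have "summable (\<lambda>k. complex_fps (moment_series M) $ k * of_real (1 / (2 * C)) ^ k)"
  proof (rule summable_comparison_test'[of "\<lambda>k. (1 / 2) ^ k" 0])
    fix k :: nat
    have "norm (of_real (1 / (2 * C)) :: complex) = 1 / (2 * C)"
      unfolding norm_of_real using C by simp
    moreover have "norm (complex_fps (moment_series M) $ k) \<le> C ^ k"
      using moment_bounds[of k] C by (simp add: moment_series_def)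
    ultimately have "norm (complex_fps (moment_series M) $ k * of_real (1 / (2 * C)) ^ k) \<le> C ^ k * (1 / (2 * C)) ^ k"
      unfolding norm_mult norm_power using C by (intro mult_mono) auto
    also have "\<dots> = (1 / 2) ^ k" using C by (simp flip: power_mult_distrib)
    finally show "norm (complex_fps (moment_series M) $ k * of_real (1 / (2 * C)) ^ k) \<le> (1 / 2) ^ k" .
  qed (simp add: summable_geometric)
  then have "conv_radius (\<lambda>k. complex_fps (moment_series M) $ k) \<ge> ereal (norm (of_real (1 / (2 * C)) :: complex))"
    by (rule conv_radius_geI)
  then have "fps_conv_radius (complex_fps (moment_series M)) \<ge> ereal (norm (of_real (1 / (2 * C)) :: complex))"
    by (simp only: fps_conv_radius_def)
  moreover have "ereal (norm (of_real (1 / (2 * C)) :: complex)) > 0" using C by (simp add: zero_ereal_def)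
  ultimately show ?thesis by order
qed

definition M_fun :: "complex \<Rightarrow> complex" where
  "M_fun = eval_fps (complex_fps (moment_series M))"

definition H_fun :: "real \<Rightarrow> complex \<Rightarrow> complex" where
  "H_fun r z = z * (1 + of_real r * M_fun z) * (1 + M_fun z)"

lemma M_fun_expansion: "M_fun has_fps_expansion complex_fps (moment_series M)"
  unfolding M_fun_def by (rule eval_fps_has_fps_expansion[OF moment_series_conv_radius])

lemma M_fun_0: "M_fun 0 = 0"
  by (simp add: M_fun_def eval_fps_at_0)

lemma H_fun_expansion: "H_fun r has_fps_expansion complex_fps (H_series r (moment_series M))"
  unfolding H_fun_def[abs_def] H_series_def complex_fps_mult complex_fps_add complex_fps_1 complex_fps_X complex_fps_const
  by (intro fps_expansion_intros M_fun_expansion)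

lemma H_fun_0: "H_fun r 0 = 0"
  by (simp add: H_fun_def)

lemma eventually_M_fun: "\<forall>\<^sub>F w in at_left 0. M_fun (of_real w) = of_real (rect_M (sqrt_measure M) w)"
proof -
  have "M_fun (of_real w) = of_real (rect_M (sqrt_measure M) w)" if w: "- (1 / (2 * C)) < w" "w < 0" for w
  proof -
    have "C * \<bar>w\<bar> < 1" using w C by (simp add: field_simps)
    then have "(\<lambda>k. moment_series M $ k * w ^ k) sums rect_M (sqrt_measure M) w"
      using w by (intro rect_M_power_series) auto
    then have "(\<lambda>k. complex_of_real (moment_series M $ k * w ^ k)) sums of_real (rect_M (sqrt_measure M) w)"
      by (rule sums_of_real)
    then show ?thesis by (simp add: M_fun_def eval_fps_def sums_iff)
  qed
  then show ?thesis
    using C by (subst eventually_at_left[of "- (1 / (2 * C))"]) (auto intro!: exI[of _ "- (1 / (2 * C))"])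
qed

lemma eventually_H_fun: "\<forall>\<^sub>F w in at_left 0. H_fun r (of_real w) = of_real (rect_H r (sqrt_measure M) w)"
  using eventually_M_fun
  by eventually_elim (simp add: H_fun_def rect_H_def algebra_simps)

text \<open>\<open>K\<close> is \<open>M o H\<^sup>-\<^sup>1\<close>; as \<open>U\<close> inverts \<open>M \<mapsto> (r M + 1) (M + 1) - 1 = H / z - 1\<close>, this is the
  rectangular R-transform.\<close>

lemma ex_analytic_compositional_quotient:
  obtains K where "K analytic_on {0}" "K 0 = 0"
    "\<forall>\<^sub>F w in nhds 0. K (H_fun r w) = M_fun w"
    "\<And>F. F $ 0 = 0 \<Longrightarrow> fps_compose F (complex_fps (H_series r (moment_series M))) = complex_fps (moment_series M)
       \<Longrightarrow> K has_fps_expansion F"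
proof -
  let ?Hs = "complex_fps (H_series r (moment_series M))"
  let ?Ms = "complex_fps (moment_series M)"
  obtain S where S: "open S" "0 \<in> S" "H_fun r holomorphic_on S"
    using has_fps_expansion_imp_holomorphic[OF H_fun_expansion] by metis
  obtain S' where S': "open S'" "0 \<in> S'" "M_fun holomorphic_on S'"
    using has_fps_expansion_imp_holomorphic[OF M_fun_expansion] by metis
  have H1: "?Hs $ 1 = 1" by (simp add: H_series_nth_1[unfolded One_nat_def])
  have "deriv (H_fun r) 0 = 1"
    using fps_nth_fps_expansion[OF H_fun_expansion, of r 1] H1 by simp
  then obtain \<rho> where \<rho>: "\<rho> > 0" "ball 0 \<rho> \<subseteq> S" "open (H_fun r ` ball 0 \<rho>)" "inj_on (H_fun r) (ball 0 \<rho>)"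
    using has_complex_derivative_locally_invertible[OF S(3,2,1)] by (metis zero_neq_one)
  obtain g where g: "g holomorphic_on (H_fun r ` ball 0 \<rho>)" "\<And>z. z \<in> ball 0 \<rho> \<Longrightarrow> g (H_fun r z) = z"
    using holomorphic_has_inverse[OF holomorphic_on_subset[OF S(3) \<rho>(2)] open_ball \<rho>(4)] by metis
  have zero: "0 \<in> H_fun r ` ball 0 \<rho>" using \<rho>(1) H_fun_0 by (intro image_eqI[of _ _ 0]) auto
  have g0: "g 0 = 0" using g(2)[of 0] \<rho>(1) by (simp add: H_fun_0)
  define K where "K = M_fun \<circ> g"
  have "g analytic_on {0}" using g(1) \<rho>(3) zero analytic_at by blast
  moreover have "M_fun analytic_on {g 0}" using S' g0 analytic_at by metis
  ultimately have K_an: "K analytic_on {0}"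
    unfolding K_def by (intro analytic_on_compose) auto
  have K_eq: "\<forall>\<^sub>F w in nhds 0. K (H_fun r w) = M_fun w"
    unfolding eventually_nhds using \<rho>(1) g(2) by (intro exI[of _ "ball 0 \<rho>"]) (auto simp: K_def)
  \<comment> \<open>The expansion of K and the given F both become the moment series when composed
    with H. As H has linear coefficient 1 it is invertible under composition, so they
    coincide.\<close>
  have K_exp: "K has_fps_expansion F"
    if F: "F $ 0 = 0" "fps_compose F ?Hs = ?Ms" for F
  proof -
    define F' where "F' = fps_expansion K 0"
    have KF': "K has_fps_expansion F'"
      unfolding F'_def using K_an by (rule analytic_at_imp_has_fps_expansion_0)
    have "(K \<circ> H_fun r) has_fps_expansion fps_compose F' ?Hs"
      by (rule has_fps_expansion_compose[OF KF' H_fun_expansion]) simp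
    then have "M_fun has_fps_expansion fps_compose F' ?Hs"
      using K_eq unfolding has_fps_expansion_def comp_def by (auto elim: eventually_elim2)
    then have "fps_compose F' ?Hs = ?Ms"
      using M_fun_expansion by (intro fps_ext) (metis fps_nth_fps_expansion)
    then have "fps_compose F' ?Hs = fps_compose F ?Hs" using F by simp
    then have "fps_compose (fps_compose F' ?Hs) (fps_inv ?Hs) = fps_compose (fps_compose F ?Hs) (fps_inv ?Hs)"
      by simp
    moreover have "fps_compose (fps_compose G ?Hs) (fps_inv ?Hs) = G" for G
    proof -
      have "fps_compose (fps_compose G ?Hs) (fps_inv ?Hs) = fps_compose G (fps_compose ?Hs (fps_inv ?Hs))"
        by (rule fps_compose_assoc[symmetric]) (simp_all add: fps_inv_def)
      also have "fps_compose ?Hs (fps_inv ?Hs) = fps_X"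
        using H1 by (intro fps_inv_right) simp_all
      finally show ?thesis by simp
    qed
    ultimately have "F' = F" by simp
    with KF' show ?thesis by simp
  qed
  show ?thesis
    by (rule that[OF K_an _ K_eq K_exp]) (simp add: K_def g0 M_fun_0)
qed

end

context bounded_nonneg_distribution
begin

lemma real_distribution_sqrt: "real_distribution (sqrt_measure M)"
  by (rule real_distribution_sqrt_measure[OF real_distribution_axioms])

text \<open>The identity K(H(w)) = M(w) determines K only at values of H;
  \<open>eventually_rect_H_imp_eventually\<close> turns this into a statement about all small z < 0.
  The second conclusion is the link from formal limits of cumulants to the analytic
  transform.\<close>

lemma ex_is_rect_R:
  assumes r: "0 < r" "r \<le> 1"
  obtains K where "is_rect_R r (sqrt_measure M) K"
    "\<And>F. F $ 0 = 0 \<Longrightarrow> fps_compose F (H_series r (moment_series M)) = moment_series M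
       \<Longrightarrow> K has_fps_expansion complex_fps F"
proof -
  interpret S: real_distribution "sqrt_measure M" by (rule real_distribution_sqrt)
  obtain K where K: "K analytic_on {0}" "K 0 = 0"
    "\<forall>\<^sub>F w in nhds 0. K (H_fun r w) = M_fun w"
    "\<And>F. F $ 0 = 0 \<Longrightarrow> fps_compose F (complex_fps (H_series r (moment_series M))) = complex_fps (moment_series M)
       \<Longrightarrow> K has_fps_expansion F"
    using ex_analytic_compositional_quotient[of r] by blast
  have "\<forall>\<^sub>F z in at_left 0. K (of_real z) = of_real (rect_R r (sqrt_measure M) z)"
  proof (rule S.eventually_rect_H_imp_eventually[OF r])
    have "filterlim complex_of_real (nhds (of_real 0)) (at_left 0)"
      by (intro tendsto_intros)
    then have "\<forall>\<^sub>F w in at_left 0. K (H_fun r (complex_of_real w)) = M_fun (of_real w)"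
      using K(3) by (intro eventually_compose_filterlim[OF K(3)]) simp
    then show "\<forall>\<^sub>F w in at_left 0. K (of_real (rect_H r (sqrt_measure M) w)) =
        of_real (rect_R r (sqrt_measure M) (rect_H r (sqrt_measure M) w))"
      using eventually_H_fun[of r] eventually_M_fun S.rect_R_rect_H[OF r]
      by eventually_elim simp
  qed
  then have "is_rect_R r (sqrt_measure M) K"
    using K(1,2) by (simp add: is_rect_R_def)
  moreover have "K has_fps_expansion complex_fps F"
    if "F $ 0 = 0" "fps_compose F (H_series r (moment_series M)) = moment_series M" for F
    using that by (intro K(4)) (simp_all flip: complex_fps_compose)
  ultimately show ?thesis using that by blast
qed

end

text \<open>Both transforms are analytic by \<open>ex_is_rect_R\<close>, so the relation between
  their Taylor coefficients already is a relation between germs; the convergence of F comes from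
  there as well.\<close>

lemma rect_R_rescaled:
  assumes M: "bounded_nonneg_distribution M C" and N: "bounded_nonneg_distribution N C'"
    and r: "0 < r" "r \<le> 1" "0 < r'" "r' \<le> 1" and "t > 0"
    and F: "F $ 0 = 0" "fps_compose F (H_series r (moment_series M)) = moment_series M"
    and F': "fps_compose (Abs_fps (\<lambda>k. F $ k * s ^ k / t)) (H_series r' (moment_series N)) = moment_series N"
  obtains K K' where "is_rect_R r (sqrt_measure M) K" "is_rect_R r' (sqrt_measure N) K'"
    "\<forall>\<^sub>F z in nhds 0. K' z = 1 / of_real t * K (of_real s * z)"
proof -
  interpret M: bounded_nonneg_distribution M C by fact
  interpret N: bounded_nonneg_distribution N C' by fact
  obtain K where K: "is_rect_R r (sqrt_measure M) K" "K has_fps_expansion complex_fps F"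
    using M.ex_is_rect_R[OF r(1,2)] F by metis
  obtain K' where K': "is_rect_R r' (sqrt_measure N) K'"
    "K' has_fps_expansion complex_fps (Abs_fps (\<lambda>k. F $ k * s ^ k / t))"
    using N.ex_is_rect_R[OF r(3,4)] F F' by (metis div_0 fps_nth_Abs_fps mult_zero_left)
  have "(\<lambda>z. complex_of_real s * z) has_fps_expansion (fps_const (of_real s) * fps_X)"
    by (rule has_fps_expansion_cmult_left[OF has_fps_expansion_fps_X])
  from has_fps_expansion_compose[OF K(2) this]
  have "(K \<circ> (\<lambda>z. of_real s * z)) has_fps_expansion fps_compose (complex_fps F) (fps_const (of_real s) * fps_X)"
    by simp
  from has_fps_expansion_cmult_left[OF this, of "1 / of_real t"]
  have "(\<lambda>z. 1 / of_real t * K (of_real s * z)) has_fps_expansion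
      fps_const (1 / of_real t) * fps_compose (complex_fps F) (fps_const (of_real s) * fps_X)"
    by (simp add: comp_def)
  also have "fps_const (1 / of_real t) * fps_compose (complex_fps F) (fps_const (of_real s) * fps_X) =
      complex_fps (Abs_fps (\<lambda>k. F $ k * s ^ k / t))"
    by (simp add: fps_eq_iff fps_compose_linear)
  finally have "\<forall>\<^sub>F z in nhds 0. eval_fps (complex_fps (Abs_fps (\<lambda>k. F $ k * s ^ k / t))) z =
      1 / of_real t * K (of_real s * z)"
    by (simp add: has_fps_expansion_def)
  moreover have "\<forall>\<^sub>F z in nhds 0. eval_fps (complex_fps (Abs_fps (\<lambda>k. F $ k * s ^ k / t))) z = K' z"
    using K'(2) by (simp add: has_fps_expansion_def)
  ultimately have "\<forall>\<^sub>F z in nhds 0. K' z = 1 / of_real t * K (of_real s * z)"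
    by eventually_elim simp
  with K(1) K'(1) show ?thesis by (rule that)
qed

section \<open>Dilations and convolution powers\<close>

lemma filterlim_mult_at_left_0:
  assumes "c > (0::real)"
  shows "filterlim (\<lambda>z. c * z) (at_left 0) (at_left 0)"
proof -
  have "((\<lambda>z. c * z) \<longlongrightarrow> c * 0) (at_left 0)" by (intro tendsto_intros)
  moreover have "\<forall>\<^sub>F z in at_left 0. c * z \<in> {..<0} \<and> c * z \<noteq> 0"
    using assms by (simp add: eventually_at_filter mult_pos_neg)
  ultimately show ?thesis by (simp add: filterlim_at)
qed

text \<open>Dilation by a replaces w by a^2 w in M, while the leading factor of H stays w. Thus a^2
  H for the dilated measure is H of the original one at a^2 w, and M after the inverse of H is
  evaluated at a^2 z.\<close>

lemma rect_R_dilate: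
  assumes "real_distribution \<nu>" "a > 0" and r: "0 < r" "r \<le> 1"
  shows "\<forall>\<^sub>F z in at_left 0. rect_R r (dilate_measure a \<nu>) z = rect_R r \<nu> (a\<^sup>2 * z)"
proof -
  interpret N: real_distribution \<nu> by fact
  interpret D: real_distribution "dilate_measure a \<nu>"
    unfolding dilate_measure_def by (rule N.real_distribution_distr) simp
  have M: "rect_M (dilate_measure a \<nu>) w = rect_M \<nu> (a\<^sup>2 * w)" for w
  proof -
    have "rect_M (dilate_measure a \<nu>) w = (\<integral>t. w * (a * t)\<^sup>2 / (1 - (a * t)\<^sup>2 * w) \<partial>\<nu>)"
      unfolding rect_M_def dilate_measure_def by (rule integral_distr) simp_all
    then show ?thesis by (simp add: rect_M_def power_mult_distrib mult_ac)
  qed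
  have H: "a\<^sup>2 * rect_H r (dilate_measure a \<nu>) w = rect_H r \<nu> (a\<^sup>2 * w)" for w
    by (simp add: rect_H_def M)
  have "\<forall>\<^sub>F w in at_left 0. rect_R r \<nu> (rect_H r \<nu> (a\<^sup>2 * w)) = rect_M \<nu> (a\<^sup>2 * w)"
    using \<open>a > 0\<close> by (intro eventually_compose_filterlim[OF N.rect_R_rect_H[OF r] filterlim_mult_at_left_0]) simp
  with D.rect_R_rect_H[OF r]
  have "\<forall>\<^sub>F w in at_left 0. rect_R r (dilate_measure a \<nu>) (rect_H r (dilate_measure a \<nu>) w) =
      rect_R r \<nu> (a\<^sup>2 * rect_H r (dilate_measure a \<nu>) w)"
    by eventually_elim (simp add: M H)
  then show ?thesis
    by (rule D.eventually_rect_H_imp_eventually[OF r])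
qed

lemma symmetric_distribution_dilate:
  assumes "symmetric_distribution \<nu>"
  shows "symmetric_distribution (dilate_measure a \<nu>)"
proof -
  interpret N: real_distribution \<nu> using assms by (simp add: symmetric_distribution_def)
  have "distr (dilate_measure a \<nu>) borel uminus = distr (distr \<nu> borel uminus) borel (\<lambda>x. a * x)"
    unfolding dilate_measure_def by (simp add: distr_distr comp_def)
  also have "\<dots> = dilate_measure a \<nu>"
    using assms by (simp add: symmetric_distribution_def dilate_measure_def)
  finally show ?thesis
    unfolding symmetric_distribution_def dilate_measure_def using N.real_distribution_distr by simp
qed

lemma dilate_measure_dilate_measure:
  assumes "real_distribution \<nu>" "a \<noteq> 0"
  shows "dilate_measure a (dilate_measure (1 / a) \<nu>) = \<nu>"
proof -
  interpret N: real_distribution \<nu> by fact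
  have "dilate_measure a (dilate_measure (1 / a) \<nu>) = distr \<nu> borel (\<lambda>x. x)"
    unfolding dilate_measure_def using \<open>a \<noteq> 0\<close> by (simp add: distr_distr comp_def)
  also have "\<dots> = \<nu>"
    by (rule distr_id2) simp
  finally show ?thesis .
qed

lemma rect_power_eqI:
  assumes "symmetric_distribution \<nu>" "0 < r" "r \<le> 1"
    and "\<forall>\<^sub>F z in at_left 0. rect_R r \<nu> z = k * rect_R r \<mu> z"
  shows "rect_power r \<mu> k = \<nu>"
  unfolding rect_power_def
proof (rule the_equality)
  fix \<nu>' assume \<nu>': "symmetric_distribution \<nu>' \<and> (\<forall>\<^sub>F z in at_left 0. rect_R r \<nu>' z = k * rect_R r \<mu> z)"
  then have "\<forall>\<^sub>F z in at_left 0. rect_R r \<nu>' z = rect_R r \<nu> z"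
    using assms(4) by (auto elim: eventually_elim2)
  with \<nu>' show "\<nu>' = \<nu>"
    using assms(1-3) by (intro rect_R_unique[of \<nu>' \<nu> r]) auto
qed (use assms in blast)

text \<open>Differentiating the quadratic equation \<open>y = H(y)\<close> gives
  \<open>\<theta>y (1 - 2 (1 + \<rho>) w + (1 - \<rho>)\<^sup>2 w\<^sup>2) + y (1 - (1 + \<rho>) w) = 2 w\<close>.\<close>

lemma marchenko_pastur_fps_ode:
  fixes y :: "real fps"
  assumes y: "y = H_series \<rho> y"
  shows "(real k + 2) * y $ Suc k = (2 * real k + 1) * (1 + \<rho>) * y $ k - (if k = 0 then - 2 else (real k - 1) * (1 - \<rho>)\<^sup>2 * y $ (k - 1))"
proof -
  define P where "P = fps_const \<rho>"
  define E where "E = fps_theta y"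
  have theta_X: "fps_theta fps_X = (fps_X :: real fps)"
    by (simp add: fps_theta_def)
  have theta_P_0: "fps_theta P = 0"
    by (simp add: P_def fps_eq_iff)
  have theta_add: "fps_theta (F + G) = fps_theta F + fps_theta G" for F G :: "real fps"
    by (simp add: fps_eq_iff algebra_simps)
  have quad: "y = fps_X * (1 + P * y) * (1 + y)"
    using y by (simp add: H_series_def P_def)
  have "E = fps_theta (fps_X * (1 + P * y) * (1 + y))"
    unfolding E_def by (subst quad) simp
  also have "\<dots> = fps_X * (1 + P * y) * (1 + y) + fps_X * (P * E) * (1 + y) + fps_X * (1 + P * y) * E"
    by (simp add: fps_theta_mult theta_add theta_P_0 theta_X E_def) (simp add: algebra_simps)
  finally have E: "E = y + fps_X * (P * E) * (1 + y) + fps_X * (1 + P * y) * E"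
    using quad by simp
  have ode: "E * (1 - 2 * (1 + P) * fps_X + (1 - P)\<^sup>2 * fps_X\<^sup>2) + y * (1 - (1 + P) * fps_X) = 2 * fps_X"
    using quad E by algebra
  \<comment> \<open>This is the left-hand side of the differential equation multiplied out into
    terms with constants and \<open>fps_X\<close> only, so that its coefficients can be read off
    directly.\<close>
  define Z where "Z = E - fps_const 2 * (fps_X * E) - fps_const 2 * (fps_X * (P * E)) + fps_X * (fps_X * (fps_const ((1 - \<rho>)\<^sup>2) * E))
     + y - fps_X * y - fps_X * (P * y)"
  have PP: "fps_const ((1 - \<rho>)\<^sup>2) = (1 - P)\<^sup>2"
    by (simp add: P_def power2_eq_square flip: fps_const_1_eq_1)
  have two: "fps_const 2 = (2 :: real fps)"
    by (simp add: fps_numeral_fps_const)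
  have "Z = fps_const 2 * fps_X"
    unfolding Z_def PP two using ode by algebra
  then have "Z $ Suc k = (fps_const 2 * fps_X) $ Suc k" by simp
  then show ?thesis
    by (cases k) (simp_all add: Z_def E_def P_def algebra_simps)
qed

text \<open>For \<rho> = 1 / c, multiplying the coefficient of index k by c^k turns the recursion of
  \<open>marchenko_pastur_fps_ode\<close> into \<open>marchenko_pastur_moment_rec\<close>. Both
  sides start with the value 1 at k = 1.\<close>

lemma marchenko_pastur_moments_unique:
  fixes y :: "real fps"
  assumes c: "c \<ge> 1" and y: "y = H_series (1 / c) y" and "k \<ge> 1"
  shows "y $ k = (\<integral>x. x ^ k \<partial>marchenko_pastur c) / c ^ k"
  using \<open>k \<ge> 1\<close>
proof (induction k rule: less_induct)
  case (less k)
  show ?case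
  proof (cases "k = 1")
    case True
    then show ?thesis
      using marchenko_pastur_fps_ode[OF y, of 0] marchenko_pastur_moment_1[OF c] c
        arg_cong[OF y, of "\<lambda>F. F $ 0"] by simp
  next
    case False
    then obtain i where k: "k = Suc i" "i \<ge> 1" using less.prems by (cases k) auto
    define m where "m k = (\<integral>x. x ^ k \<partial>marchenko_pastur c)" for k
    have yi: "y $ i = m i / c ^ i" using less.IH[of i] k by (simp add: m_def)
    have yi': "(real i - 1) * (y $ (i - 1)) = (real i - 1) * (m (i - 1) / c ^ (i - 1))"
      using less.IH[of "i - 1"] k by (cases "i = 1") (auto simp: m_def)
    have rec: "(real i + 2) * m k = (2 * real i + 1) * (1 + c) * m i - (real i - 1) * (1 - c)\<^sup>2 * m (i - 1)"
      using marchenko_pastur_moment_rec[OF c k(2)] unfolding k(1) m_def .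
    obtain i' where i: "i = Suc i'" using k(2) by (cases i) auto
    have "(real i + 2) * y $ k = (2 * real i + 1) * (1 + 1 / c) * y $ i - (1 - 1 / c)\<^sup>2 * ((real i - 1) * y $ (i - 1))"
      using marchenko_pastur_fps_ode[OF y, of i] k by (simp add: mult_ac)
    also have "\<dots> = ((2 * real i + 1) * (1 + c) * m i - (real i - 1) * (1 - c)\<^sup>2 * m (i - 1)) / c ^ k"
      unfolding yi yi' using c by (simp add: k(1) i field_simps power2_eq_square)
    also have "\<dots> = (real i + 2) * (m k / c ^ k)"
      unfolding rec[symmetric] by simp
    finally have "(real i + 2) * y $ k = (real i + 2) * (m k / c ^ k)" .
    then have "y $ k = m k / c ^ k" by (subst (asm) mult_left_cancel) auto
    then show ?thesis by (simp add: m_def)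
  qed
qed

section \<open>Uniform convergence on compact sets from convergence of coefficients\<close>

lemma unif_compact_limitI:
  assumes deg: "\<forall>\<^sub>F d in sequentially. degree (q d) \<le> L" "degree r \<le> L"
    and coeff: "\<And>i. i \<le> L \<Longrightarrow> (\<lambda>d. coeff (q d) i) \<longlonglongrightarrow> coeff r i"
  shows "unif_compact_limit q r"
  unfolding unif_compact_limit_def
proof (intro allI impI uniform_limitI)
  fix K :: "complex set" and \<epsilon> :: real assume "compact K" "\<epsilon> > 0"
  obtain B where B: "\<And>z. z \<in> K \<Longrightarrow> norm z \<le> B"
    using compact_imp_bounded[OF \<open>compact K\<close>] by (auto simp: bounded_iff)
  have cpoly_eq: "cpoly f z = (\<Sum>i\<le>L. of_real (coeff f i) * z ^ i)" if "degree f \<le> L" for f z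
    using that unfolding poly_altdef
    by (intro sum.mono_neutral_cong_left) (auto simp: degree_map_poly coeff_map_poly coeff_eq_0)
  have "(\<lambda>d. \<Sum>i\<le>L. \<bar>coeff (q d) i - coeff r i\<bar> * \<bar>B\<bar> ^ i) \<longlonglongrightarrow> (\<Sum>i\<le>L. \<bar>coeff r i - coeff r i\<bar> * \<bar>B\<bar> ^ i)"
    by (intro tendsto_sum tendsto_mult tendsto_rabs tendsto_diff tendsto_const coeff) auto
  then have "(\<lambda>d. \<Sum>i\<le>L. \<bar>coeff (q d) i - coeff r i\<bar> * \<bar>B\<bar> ^ i) \<longlonglongrightarrow> 0" by simp
  then have "\<forall>\<^sub>F d in sequentially. (\<Sum>i\<le>L. \<bar>coeff (q d) i - coeff r i\<bar> * \<bar>B\<bar> ^ i) < \<epsilon>"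
    using \<open>\<epsilon> > 0\<close> by (rule order_tendstoD)
  with deg(1) show "\<forall>\<^sub>F d in sequentially. \<forall>z\<in>K. dist (cpoly (q d) z) (cpoly r z) < \<epsilon>"
  proof eventually_elim
    case (elim d)
    show ?case
    proof
      fix z assume z: "z \<in> K"
      have "dist (cpoly (q d) z) (cpoly r z) = norm (\<Sum>i\<le>L. of_real (coeff (q d) i - coeff r i) * z ^ i)"
        using elim deg by (simp add: cpoly_eq dist_norm algebra_simps flip: sum_subtractf)
      also have "\<dots> \<le> (\<Sum>i\<le>L. \<bar>coeff (q d) i - coeff r i\<bar> * \<bar>B\<bar> ^ i)"
      proof (rule sum_norm_le)
        fix i assume "i \<in> {..L}"
        have "norm z \<le> \<bar>B\<bar>" using B[OF z] by simp
        then show "norm (of_real (coeff (q d) i - coeff r i) * z ^ i) \<le> \<bar>coeff (q d) i - coeff r i\<bar> * \<bar>B\<bar> ^ i"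
          unfolding norm_mult norm_of_real norm_power by (intro mult_left_mono power_mono) auto
      qed
      finally show "dist (cpoly (q d) z) (cpoly r z) < \<epsilon>" using elim by simp
    qed
  qed
qed

section \<open>Limits of the derivatives\<close>

lemma coeff_dilate_poly:
  "coeff (dilate_poly a q) i = a ^ degree q * ((1 / a) ^ i * coeff q i)"
proof -
  have "coeff (pcompose q [:0, c:]) i = c ^ i * coeff q i" for c
  proof (induction q arbitrary: i)
    case (pCons b q)
    then show ?case by (cases i) (simp_all add: pcompose_pCons coeff_pCons)
  qed simp
  then show ?thesis by (simp add: dilate_poly_def)
qed

lemma degree_dilate_poly: "a \<noteq> 0 \<Longrightarrow> degree (dilate_poly a q) = degree q"
  by (simp add: dilate_poly_def degree_pcompose)

lemma rev_fps_dilate_poly: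
  assumes "a \<noteq> 0"
  shows "rev_fps (dilate_poly a q) $ k = a ^ k * rev_fps q $ k"
proof (cases "k \<le> degree q")
  case True
  then have "a ^ degree q = a ^ k * a ^ (degree q - k)" by (simp flip: power_add)
  then show ?thesis
    using True assms by (simp add: rev_fps_nth degree_dilate_poly coeff_dilate_poly power_divide)
qed (use assms in \<open>simp add: rev_fps_nth degree_dilate_poly\<close>)

lemma dilate_poly_1: "dilate_poly 1 q = q"
  by (simp add: poly_eq_iff coeff_dilate_poly)

lemma cpoly_dilate_poly:
  assumes "a \<noteq> 0"
  shows "cpoly (dilate_poly a q) z = of_real a ^ degree q * cpoly q (z / of_real a)"
  unfolding poly_altdef sum_distrib_left
  using assms by (intro sum.cong) (auto simp: degree_map_poly degree_dilate_poly coeff_map_poly coeff_dilate_poly power_divide)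

locale nonneg_rooted =
  fixes Q :: "real poly" and C :: real
  assumes monic: "lead_coeff Q = 1" and deg: "degree Q \<ge> 1"
    and roots: "\<And>z. cpoly Q z = 0 \<Longrightarrow> z \<in> of_real ` {0..C}"
begin

lemma nonneg_rooted_factorization:
  "Q = (\<Prod>y\<in>#proots Q. [:-y, 1:])" "size (proots Q) = degree Q" "proots Q \<noteq> {#}"
  "set_mset (proots Q) \<subseteq> {0..C}"
proof -
  have "Q \<noteq> 0" using monic by auto
  from real_rooted_factorization[OF this roots]
  show *: "Q = (\<Prod>y\<in>#proots Q. [:-y, 1:])" "set_mset (proots Q) \<subseteq> {0..C}"
    unfolding monic by simp_all
  show size: "size (proots Q) = degree Q"
    using degree_prod_mset_linear[of "proots Q"] *(1) by simp
  show "proots Q \<noteq> {#}" using size deg by auto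
qed

lemma real_distribution_roots: "real_distribution (root_measure Q)"
  by (rule real_distribution_root_measure[OF refl nonneg_rooted_factorization(2,3)])

lemma root_measure_support: "AE x in root_measure Q. 0 \<le> x \<and> x \<le> C"
  by (rule AE_root_measure[OF refl nonneg_rooted_factorization(2,3)])
     (use nonneg_rooted_factorization(4) in auto)

lemma integrable_root_measure_power: "integrable (root_measure Q) (\<lambda>x. x ^ k)"
  by (rule integral_root_measure(1)[OF refl nonneg_rooted_factorization(2,3)]) simp

lemma moment_series_root_measure: "moment_series (root_measure Q) = moment_fps (proots Q)"
  unfolding moment_series_def moment_fps_def fps_eq_iff
  by (simp add: integral_root_measure(2)[OF refl nonneg_rooted_factorization(2,3)])

lemma fps_theta_rev_fps_root_measure:
  "fps_theta (rev_fps Q) = - (fps_const (real (degree Q)) * (moment_series (root_measure Q) * rev_fps Q))"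
  using fps_theta_rev_fps[OF nonneg_rooted_factorization(1,3)]
  by (simp add: moment_series_root_measure nonneg_rooted_factorization(2))

lemma moment_series_exact:
  assumes "n > -1" "k \<le> degree Q"
  defines "d \<equiv> real (degree Q)"
  shows "moment_series (root_measure Q) $ k = (\<Sum>r\<le>k. cumulant d n (rev_fps Q) r *
      (M_step (d / (n + d)) (1 / d) (1 / (n + d)) (moment_series (root_measure Q)) ^^ r) 1 $ k)"
  unfolding d_def
  by (rule moment_cumulant_exact[OF deg assms(1) _ fps_theta_rev_fps_root_measure assms(2)])
     (simp add: rev_fps_0 monic)

lemma nonneg_rooted_dilate:
  assumes "a > 0"
  shows "nonneg_rooted (dilate_poly a Q) (a * C)"
proof
  show "lead_coeff (dilate_poly a Q) = 1"
    using assms monic by (simp add: degree_dilate_poly coeff_dilate_poly power_divide)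
  show "degree (dilate_poly a Q) \<ge> 1" using assms deg by (simp add: degree_dilate_poly)
  fix z assume "cpoly (dilate_poly a Q) z = 0"
  then have "cpoly Q (z / of_real a) = 0" using assms by (simp add: cpoly_dilate_poly)
  then obtain y where y: "y \<in> {0..C}" "z / of_real a = of_real y" using roots by blast
  then have "z = of_real (a * y)" using assms by (simp add: field_simps)
  moreover have "a * y \<in> {0..a * C}" using y assms by auto
  ultimately show "z \<in> of_real ` {0..a * C}" by blast
qed

end

text \<open>For small d a polynomial may be constant or unconstrained, and its root measure need not
  be a probability measure, whereas the convergence criteria ask for one at every index. Shifting
  the sequence bridges this.\<close>

lemma weak_conv_m_offset: "weak_conv_m (\<lambda>d. M (d + D)) N \<longleftrightarrow> weak_conv_m M N"
proof -
  have "(\<lambda>d. f (d + D)) \<longlonglongrightarrow> c \<longleftrightarrow> f \<longlonglongrightarrow> c" for f :: "nat \<Rightarrow> real" and c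
    using LIMSEQ_offset[of f D c] LIMSEQ_ignore_initial_segment[of f c D] by iprover
  from this[of "\<lambda>d. cdf (M d) _" _] show ?thesis
    unfolding weak_conv_m_def weak_conv_def by (simp only:)
qed

lemma tendsto_ratios:
  fixes x :: "nat \<Rightarrow> nat" and n :: "nat \<Rightarrow> real"
  assumes x: "filterlim x at_top sequentially" and lim: "(\<lambda>d. n d / real (x d)) \<longlonglongrightarrow> \<alpha>" and "\<alpha> \<ge> 0"
  shows "(\<lambda>d. real (x d) / (n d + real (x d))) \<longlonglongrightarrow> 1 / (1 + \<alpha>)"
    and "(\<lambda>d. 1 / real (x d)) \<longlonglongrightarrow> 0"
    and "(\<lambda>d. 1 / (n d + real (x d))) \<longlonglongrightarrow> 0"
proof -
  have pos: "\<forall>\<^sub>F d in sequentially. x d \<ge> 1"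
    using x by (simp add: filterlim_at_top)
  have "(\<lambda>d. 1 / (n d / real (x d) + 1)) \<longlonglongrightarrow> 1 / (\<alpha> + 1)"
    using \<open>\<alpha> \<ge> 0\<close> by (intro tendsto_intros lim) auto
  then show 1: "(\<lambda>d. real (x d) / (n d + real (x d))) \<longlonglongrightarrow> 1 / (1 + \<alpha>)"
    unfolding add.commute[of 1 \<alpha>]
  proof (rule Lim_transform_eventually)
    show "\<forall>\<^sub>F d in sequentially. 1 / (n d / real (x d) + 1) = real (x d) / (n d + real (x d))"
      using pos
    proof eventually_elim
      case (elim d)
      then have "n d / real (x d) + 1 = (n d + real (x d)) / real (x d)" by (simp add: add_divide_distrib)
      then show ?case by simp
    qed
  qed
  have "filterlim (\<lambda>d. real (x d)) at_top sequentially"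
    by (rule filterlim_compose[OF filterlim_real_sequentially x])
  then show 2: "(\<lambda>d. 1 / real (x d)) \<longlonglongrightarrow> 0"
    by (intro tendsto_divide_0[OF tendsto_const] filterlim_at_top_imp_at_infinity)
  have "(\<lambda>d. 1 / real (x d) * (real (x d) / (n d + real (x d)))) \<longlonglongrightarrow> 0 * (1 / (1 + \<alpha>))"
    by (intro tendsto_mult 1 2)
  then have "(\<lambda>d. 1 / real (x d) * (real (x d) / (n d + real (x d)))) \<longlonglongrightarrow> 0" by simp
  then show "(\<lambda>d. 1 / (n d + real (x d))) \<longlonglongrightarrow> 0"
    by (rule Lim_transform_eventually) (use pos in eventually_elim, simp)
qed

lemma falling_ratio_tendsto: "((\<lambda>x. falling x k / x ^ k) \<longlongrightarrow> 1) at_top"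
proof (induction k)
  case 0
  then show ?case by (simp add: falling_def)
next
  case (Suc k)
  have "((\<lambda>x::real. (x - real k) / x) \<longlongrightarrow> 1) at_top" by real_asymp
  from tendsto_mult[OF Suc this] show ?case
    by (simp add: falling_def mult_ac)
qed

locale derivative_flow =
  fixes p :: "nat \<Rightarrow> real poly" and \<mu> :: "real measure" and C :: real
    and n :: "nat \<Rightarrow> real" and j :: "nat \<Rightarrow> nat"
  assumes monic: "\<And>d. d \<ge> 1 \<Longrightarrow> degree (p d) = d \<and> lead_coeff (p d) = 1"
    and roots: "\<And>d z. d \<ge> 1 \<Longrightarrow> cpoly (p d) z = 0 \<Longrightarrow> z \<in> of_real ` {0..C}"
    and C: "C > 0"
    and \<mu>: "real_distribution \<mu>"
    and conv: "weak_conv_m (\<lambda>d. root_measure (p d)) \<mu>"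
    and n: "\<And>d. d \<ge> 1 \<Longrightarrow> n d > -1"
    and j: "\<And>d. d \<ge> 1 \<Longrightarrow> j d \<in> {1..d}"
begin

definition q where "q d = p_jd (n d) (j d) d (p d)"
definition l where "l d = d - j d"

abbreviation cum where "cum d k \<equiv> cumulant (real d) (n d) (rev_fps (p d)) k"

text \<open>Passing from d to l leaves the symbol unchanged up to index l, so a cumulant changes
  only through its normalisation (d (n + d))^k / d. This is the quotient of the two
  normalisations.\<close>

abbreviation cum_factor where
  "cum_factor d k \<equiv> ((real (l d) / real d) * ((n d + real (l d)) / (n d + real d))) ^ k * (real d / real (l d))"

lemma nonneg_rooted_p: "d \<ge> 1 \<Longrightarrow> nonneg_rooted (p d) C"
  using monic[of d] roots[of d] by (intro nonneg_rooted.intro) (blast, linarith, blast)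

lemma
  assumes "d \<ge> 1"
  shows degree_q: "degree (q d) = l d" and lead_coeff_q: "lead_coeff (q d) = 1"
    and symbol_q: "\<And>k. k \<le> l d \<Longrightarrow> symbol (real (l d)) (n d) (rev_fps (q d)) $ k = symbol (real d) (n d) (rev_fps (p d)) $ k"
    and roots_q: "\<And>z. cpoly (q d) z = 0 \<Longrightarrow> z \<in> of_real ` {0..C}"
proof -
  have pd: "degree (p d) = d" "lead_coeff (p d) = 1" using monic[OF assms] by blast+
  have jd: "j d \<le> d" and nd: "n d > -1" using j[OF assms] n[OF assms] by auto
  show deg: "degree (q d) = l d"
    unfolding q_def l_def by (rule degree_p_jd[OF nd pd jd])
  show "lead_coeff (q d) = 1"
    using lead_coeff_p_jd[OF nd pd jd] unfolding deg by (simp add: q_def l_def)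
  show "symbol (real (l d)) (n d) (rev_fps (q d)) $ k = symbol (real d) (n d) (rev_fps (p d)) $ k" if "k \<le> l d" for k
    using symbol_p_jd[OF nd pd jd] that by (simp add: q_def l_def)
  show "z \<in> of_real ` {0..C}" if "cpoly (q d) z = 0" for z
    using p_jd_roots_interval[OF nd _ roots[OF assms] pd jd] C that by (simp add: q_def)
qed

lemma nonneg_rooted_q: "d \<ge> 1 \<Longrightarrow> l d \<ge> 1 \<Longrightarrow> nonneg_rooted (q d) C"
  using degree_q[of d] lead_coeff_q[of d] roots_q[of d] by (intro nonneg_rooted.intro) (blast, linarith, blast)

lemma mu_support: "AE x in \<mu>. 0 \<le> x \<and> x \<le> C"
  and moments_p: "(\<lambda>d. \<integral>x. x ^ k \<partial>root_measure (p d)) \<longlonglongrightarrow> (\<integral>x. x ^ k \<partial>\<mu>)"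
proof -
  have conv': "weak_conv_m (\<lambda>d. root_measure (p (d + 1))) \<mu>"
    using conv weak_conv_m_offset[of "\<lambda>d. root_measure (p d)" 1] by simp
  have *: "real_distribution (root_measure (p (d + 1)))" "AE x in root_measure (p (d + 1)). 0 \<le> x \<and> x \<le> C" for d
    using nonneg_rooted.real_distribution_roots[OF nonneg_rooted_p[of "d + 1"]]
      nonneg_rooted.root_measure_support[OF nonneg_rooted_p[of "d + 1"]] by simp_all
  note ** = weak_conv_bounded_support[OF *(1) \<mu> *(2) less_imp_le[OF C] conv']
  show "AE x in \<mu>. 0 \<le> x \<and> x \<le> C"
    by (rule **(1))
  have "(\<lambda>d. \<integral>x. x ^ k \<partial>root_measure (p (d + 1))) \<longlonglongrightarrow> (\<integral>x. x ^ k \<partial>\<mu>)"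
    by (rule **(2))
  then show "(\<lambda>d. \<integral>x. x ^ k \<partial>root_measure (p d)) \<longlonglongrightarrow> (\<integral>x. x ^ k \<partial>\<mu>)"
    by (rule LIMSEQ_offset)
qed

lemma bounded_mu: "bounded_nonneg_distribution \<mu> C"
  unfolding bounded_nonneg_distribution_def bounded_nonneg_distribution_axioms_def
  using \<mu> C mu_support by blast

lemma moment_series_p: "(\<lambda>d. moment_series (root_measure (p d)) $ k) \<longlonglongrightarrow> moment_series \<mu> $ k"
  using moments_p[of k] by (simp add: moment_series_def)

lemma cumulants_p_tendsto:
  assumes "(\<lambda>d. n d / real d) \<longlonglongrightarrow> \<alpha>" "\<alpha> \<ge> 0"
  obtains F where "F $ 0 = 0" "\<And>k. (\<lambda>d. cum d k) \<longlonglongrightarrow> F $ k"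
    "moment_series \<mu> = fps_compose F (H_series (1 / (1 + \<alpha>)) (moment_series \<mu>))"
proof -
  define c where "c d k = cum d k" for d k
  note ratios = tendsto_ratios[OF filterlim_ident assms]
  interpret moment_cumulant_limit "\<lambda>d. moment_series (root_measure (p d))" c
    "\<lambda>d. real d / (n d + real d)" "\<lambda>d. 1 / real d" "\<lambda>d. 1 / (n d + real d)" "1 / (1 + \<alpha>)"
  proof
    fix k
    show "\<forall>\<^sub>F d in sequentially. moment_series (root_measure (p d)) $ k = (\<Sum>r\<le>k. c d r *
        (M_step (real d / (n d + real d)) (1 / real d) (1 / (n d + real d)) (moment_series (root_measure (p d))) ^^ r) 1 $ k)"
      using eventually_ge_at_top[of "max 1 k"]
    proof eventually_elim
      case (elim d)
      then have d: "d \<ge> 1" by simp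
      then have deg: "degree (p d) = d" using monic by blast
      show ?case
        using nonneg_rooted.moment_series_exact[OF nonneg_rooted_p[OF d] n[OF d], of k] elim
        unfolding deg c_def by linarith
    qed
  qed (rule ratios)+
  define F where "F = Abs_fps (\<lambda>k. lim (\<lambda>d. c d k))"
  have c0: "c d 0 = 0" for d by (simp add: c_def cumulant_def log_symbol_0)
  have F: "(\<lambda>d. c d k) \<longlonglongrightarrow> F $ k" for k
    using cumulants_convergent[OF c0 moment_series_p] by (simp add: F_def convergent_LIMSEQ_iff)
  have "F $ 0 = 0" using F[of 0] by (simp add: c0 LIMSEQ_const_iff)
  moreover have "moment_series \<mu> = fps_compose F (H_series (1 / (1 + \<alpha>)) (moment_series \<mu>))"
    using limit_identity[OF F moment_series_p] by (simp add: H_series_def)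
  ultimately show ?thesis using that F unfolding c_def by blast
qed

lemma cumulant_dilate_q:
  assumes "d \<ge> 1" "k \<le> l d" "a > 0"
  shows "cumulant (real (l d)) (n d) (rev_fps (dilate_poly a (q d))) k =
    a ^ k * cum d k * cum_factor d k"
proof -
  have "rev_fps (p d) $ 0 = 1" using monic[OF assms(1)] unfolding rev_fps_0 by blast
  moreover have "rev_fps (dilate_poly a (q d)) $ 0 = 1"
    using assms by (simp add: rev_fps_dilate_poly rev_fps_0[of "q d"] lead_coeff_q)
  ultimately have "log_symbol (real (l d)) (n d) (rev_fps (dilate_poly a (q d))) $ k = a ^ k * log_symbol (real d) (n d) (rev_fps (p d)) $ k"
  proof (rule log_symbol_scale_upto[OF _ _ _ \<open>k \<le> l d\<close>])
    fix i assume "i \<le> l d"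
    have "symbol (real (l d)) (n d) (rev_fps (dilate_poly a (q d))) $ i = a ^ i * symbol (real (l d)) (n d) (rev_fps (q d)) $ i"
      using assms(3) by (simp add: symbol_def rev_fps_dilate_poly)
    then show "symbol (real (l d)) (n d) (rev_fps (dilate_poly a (q d))) $ i = a ^ i * symbol (real d) (n d) (rev_fps (p d)) $ i"
      unfolding symbol_q[OF assms(1) \<open>i \<le> l d\<close>] .
  qed
  moreover have "n d + real d \<noteq> 0" using n[OF assms(1)] assms(1) by auto
  ultimately show ?thesis
    using assms(1) by (simp add: cumulant_def power_mult_distrib power_divide)
qed

text \<open>The hypothesis involves only cumulants of the original polynomials. The dilation is kept
  free because it has to grow when l = o(d) and is 1 when l is proportional to d.\<close>

lemma moments_dilate_q_tendsto:
  assumes l: "filterlim l at_top sequentially" and nl: "(\<lambda>d. n d / real (l d)) \<longlonglongrightarrow> \<beta>" "\<beta> \<ge> 0"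
    and a_pos: "\<forall>\<^sub>F d in sequentially. a d > 0"
    and G: "\<And>k. (\<lambda>d. a d ^ k * cum d k * cum_factor d k) \<longlonglongrightarrow> G $ k"
  obtains m where "\<And>k. (\<lambda>d. moment_series (root_measure (dilate_poly (a d) (q d))) $ k) \<longlonglongrightarrow> m $ k"
    "m = fps_compose G (H_series (1 / (1 + \<beta>)) m)"
proof -
  define c where "c d k = cumulant (real (l d)) (n d) (rev_fps (dilate_poly (a d) (q d))) k" for d k
  define M where "M d = moment_series (root_measure (dilate_poly (a d) (q d)))" for d
  note ratios = tendsto_ratios[OF l nl]
  have l_ge: "\<forall>\<^sub>F d in sequentially. l d \<ge> i" for i
    using l by (simp add: filterlim_at_top)
  interpret moment_cumulant_limit M c
    "\<lambda>d. real (l d) / (n d + real (l d))" "\<lambda>d. 1 / real (l d)" "\<lambda>d. 1 / (n d + real (l d))" "1 / (1 + \<beta>)"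
  proof
    fix k
    show "\<forall>\<^sub>F d in sequentially. M d $ k = (\<Sum>r\<le>k. c d r *
        (M_step (real (l d) / (n d + real (l d))) (1 / real (l d)) (1 / (n d + real (l d))) (M d) ^^ r) 1 $ k)"
      \<comment> \<open>The exact relation reaches only up to the degree l, so l must have passed k,
        and it must be positive.\<close>
      using l_ge[of "max 1 k"] eventually_ge_at_top[of 1] a_pos
    proof eventually_elim
      case (elim d)
      then have rooted: "nonneg_rooted (dilate_poly (a d) (q d)) (a d * C)"
        by (intro nonneg_rooted.nonneg_rooted_dilate nonneg_rooted_q) auto
      have deg: "degree (dilate_poly (a d) (q d)) = l d"
        using elim degree_q by (simp add: degree_dilate_poly)
      show ?case
        using nonneg_rooted.moment_series_exact[OF rooted n[OF elim(2)], of k] elim(1)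
        unfolding deg c_def M_def by linarith
    qed
  qed (rule ratios)+
  have c: "(\<lambda>d. c d k) \<longlonglongrightarrow> G $ k" for k
  proof (rule Lim_transform_eventually[OF G])
    show "\<forall>\<^sub>F d in sequentially. a d ^ k * cum d k * cum_factor d k = c d k"
      using l_ge[of k] eventually_ge_at_top[of 1] a_pos
    proof eventually_elim
      case (elim d)
      show ?case unfolding c_def by (rule cumulant_dilate_q[symmetric]) (use elim in auto)
    qed
  qed
  define m where "m = Abs_fps (\<lambda>k. lim (\<lambda>d. M d $ k))"
  have m: "(\<lambda>d. M d $ k) \<longlonglongrightarrow> m $ k" for k
    using moments_convergent[OF c] by (simp add: m_def convergent_LIMSEQ_iff)
  have "m = fps_compose G (H_series (1 / (1 + \<beta>)) m)"
    using limit_identity[OF c m] by (simp add: H_series_def)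
  then show ?thesis using that m unfolding M_def by blast
qed

end

section \<open>Limits for fixed l\<close>

context derivative_flow
begin

text \<open>In Newton's identities divided by d^k the moment of order i carries the weight d^(1 -
  i), so only the mean survives. With mean 1 the limits are the coefficients of exp (- w).\<close>

lemma rev_fps_p_tendsto:
  assumes mean: "(\<integral>x. x \<partial>\<mu>) = 1"
  shows "(\<lambda>d. rev_fps (p d) $ k / real d ^ k) \<longlonglongrightarrow> (- 1) ^ k / fact k"
proof (induction k rule: less_induct)
  case (less k)
  show ?case
  proof (cases k)
    case 0
    have "\<forall>\<^sub>F d in sequentially. rev_fps (p d) $ 0 / real d ^ 0 = 1"
      using eventually_ge_at_top[of 1]
    proof eventually_elim
      case (elim d)
      then have "lead_coeff (p d) = 1" using monic by blast
      then show ?case unfolding rev_fps_0 by (simp only: power_0 div_by_1)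
    qed
    then show ?thesis unfolding 0 by (simp add: tendsto_eventually)
  next
    case (Suc k')
    define m where "m d i = moment_series (root_measure (p d)) $ i * (real d / real d ^ i)" for d i
    have inverse_d: "(\<lambda>d. 1 / real d) \<longlonglongrightarrow> 0" by (rule lim_1_over_n)
    have m: "(\<lambda>d. m d i) \<longlonglongrightarrow> (if i = 1 then 1 else 0)" if "i \<ge> 1" for i
    proof -
      obtain i' where i: "i = Suc i'" using \<open>i \<ge> 1\<close> by (cases i) auto
      have "(\<lambda>d. moment_series (root_measure (p d)) $ i * (1 / real d) ^ i') \<longlonglongrightarrow> moment_series \<mu> $ i * 0 ^ i'"
        by (intro tendsto_intros moment_series_p inverse_d)
      then have "(\<lambda>d. m d i) \<longlonglongrightarrow> moment_series \<mu> $ i * 0 ^ i'"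
      proof (rule Lim_transform_eventually)
        show "\<forall>\<^sub>F d in sequentially. moment_series (root_measure (p d)) $ i * (1 / real d) ^ i' = m d i"
          using eventually_ge_at_top[of 1] by eventually_elim (simp add: m_def i power_divide)
      qed
      moreover have "moment_series \<mu> $ i * 0 ^ i' = (if i = 1 then 1 else 0)"
        using mean by (cases i') (auto simp: i moment_series_def)
      ultimately show ?thesis by simp
    qed
    have "(\<lambda>d. - (\<Sum>i=1..k. m d i * (rev_fps (p d) $ (k - i) / real d ^ (k - i))) / real k)
        \<longlonglongrightarrow> - (\<Sum>i=1..k. (if i = 1 then 1 else 0) * ((- 1) ^ (k - i) / fact (k - i))) / real k"
      using Suc by (intro tendsto_intros m less.IH) auto
    also have "- (\<Sum>i=1..k. (if i = 1 then 1 else 0) * ((- 1) ^ (k - i) / fact (k - i))) / real k = (- 1) ^ k / fact k"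
    proof -
      have "(\<Sum>i=1..k. (if i = 1 then 1 else 0) * ((- 1 :: real) ^ (k - i) / fact (k - i))) = (- 1) ^ k' / fact k'"
        by (subst sum.remove[of _ 1]) (auto simp: Suc)
      then show ?thesis by (simp add: Suc)
    qed
    finally show ?thesis
    proof (rule Lim_transform_eventually)
      show "\<forall>\<^sub>F d in sequentially. - (\<Sum>i=1..k. m d i * (rev_fps (p d) $ (k - i) / real d ^ (k - i))) / real k =
          rev_fps (p d) $ k / real d ^ k"
        using eventually_ge_at_top[of 1]
      proof eventually_elim
        case (elim d)
        define ms where "ms = moment_series (root_measure (p d))"
        have deg: "degree (p d) = d" using monic[OF elim] by blast
        have "fps_theta (rev_fps (p d)) $ k = (- (fps_const (real d) * (ms * rev_fps (p d)))) $ k"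
          using nonneg_rooted.fps_theta_rev_fps_root_measure[OF nonneg_rooted_p[OF elim]]
          unfolding deg ms_def by simp
        then have "real k * rev_fps (p d) $ k = - (real d * (ms * rev_fps (p d)) $ k)" by simp
        also have "(ms * rev_fps (p d)) $ k = (\<Sum>i=1..k. ms $ i * rev_fps (p d) $ (k - i))"
          unfolding fps_mult_nth by (subst sum.atLeast_Suc_atMost) (simp_all add: ms_def)
        finally have "rev_fps (p d) $ k = - (\<Sum>i=1..k. real d * (ms $ i * rev_fps (p d) $ (k - i))) / real k"
          using Suc by (simp add: sum_distrib_left field_simps)
        then have "rev_fps (p d) $ k / real d ^ k = - (\<Sum>i=1..k. real d * (ms $ i * rev_fps (p d) $ (k - i)) / real d ^ k) / real k"
          by (simp add: sum_divide_distrib mult.commute)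
        also have "(\<Sum>i=1..k. real d * (ms $ i * rev_fps (p d) $ (k - i)) / real d ^ k) =
            (\<Sum>i=1..k. m d i * (rev_fps (p d) $ (k - i) / real d ^ (k - i)))"
        proof (intro sum.cong refl)
          fix i assume "i \<in> {1..k}"
          then have "real d ^ k = real d ^ i * real d ^ (k - i)" by (simp flip: power_add)
          then show "real d * (ms $ i * rev_fps (p d) $ (k - i)) / real d ^ k =
              m d i * (rev_fps (p d) $ (k - i) / real d ^ (k - i))"
            by (simp add: m_def ms_def)
        qed
        finally show ?case by simp
      qed
    qed
  qed
qed

lemma rev_fps_q:
  assumes "d \<ge> 1" "k \<le> l d"
  shows "rev_fps (q d) $ k = falling (real (l d)) k * falling (n d + real (l d)) k *
    (rev_fps (p d) $ k / (falling (real d) k * falling (n d + real d) k))"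
proof -
  have "falling (real (l d)) k > 0" "falling (n d + real (l d)) k > 0"
    using n[OF assms(1)] assms(2) by (auto intro!: falling_pos)
  then show ?thesis
    using symbol_q[OF assms] by (simp add: symbol_def divide_eq_eq mult_ac)
qed

lemma n_plus_d_at_top: "filterlim (\<lambda>d. n d + real d) at_top sequentially"
proof (rule filterlim_at_top_mono)
  show "filterlim (\<lambda>d. real d - 1) at_top sequentially" by real_asymp
  show "\<forall>\<^sub>F d in sequentially. real d - 1 \<le> n d + real d"
    using eventually_ge_at_top[of 1]
  proof eventually_elim
    case (elim d)
    then show ?case using n[OF elim] by simp
  qed
qed

text \<open>By \<open>rev_fps_q\<close> the coefficient of index k carries the factor (n + d)^(- k)
  asymptotically, which the dilation by d + n removes. The remaining factor b normalises
  \<open>falling (n + L) k\<close>: it is 1 when n is fixed and 1 / n when n tends to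
  infinity.\<close>

lemma dilate_q_limit:
  assumes mean: "(\<integral>x. x \<partial>\<mu>) = 1" and L: "\<forall>\<^sub>F d in sequentially. l d = L"
    and a: "\<forall>\<^sub>F d in sequentially. a d = (real d + n d) * b d \<and> a d \<noteq> 0"
    and b: "\<And>k. k \<le> L \<Longrightarrow> (\<lambda>d. b d ^ k * falling (n d + real L) k) \<longlonglongrightarrow> B k"
    and r: "degree r \<le> L" "\<And>k. k \<le> L \<Longrightarrow> coeff r (L - k) = (- 1) ^ k / fact k * falling (real L) k * B k"
  shows "unif_compact_limit (\<lambda>d. dilate_poly (a d) (q d)) r"
proof (rule unif_compact_limitI)
  show "\<forall>\<^sub>F d in sequentially. degree (dilate_poly (a d) (q d)) \<le> L"
    using L a eventually_ge_at_top[of 1]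
  proof eventually_elim
    case (elim d)
    show ?case
      unfolding degree_dilate_poly[OF conjunct2[OF elim(2)]] using degree_q elim(1,3) by simp
  qed
  show "degree r \<le> L" by fact
  fix i assume i: "i \<le> L"
  define k where "k = L - i"
  have k: "k \<le> L" "L - k = i" using i by (auto simp: k_def)
  have 1: "(\<lambda>d. falling (real d) k / real d ^ k) \<longlonglongrightarrow> 1"
    by (rule filterlim_compose[OF falling_ratio_tendsto filterlim_real_sequentially])
  have 2: "(\<lambda>d. falling (n d + real d) k / (n d + real d) ^ k) \<longlonglongrightarrow> 1"
    by (rule filterlim_compose[OF falling_ratio_tendsto n_plus_d_at_top])
  have "(\<lambda>d. (rev_fps (p d) $ k / real d ^ k) / (falling (real d) k / real d ^ k) /
      (falling (n d + real d) k / (n d + real d) ^ k) * falling (real L) k * (b d ^ k * falling (n d + real L) k))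
      \<longlonglongrightarrow> ((- 1) ^ k / fact k) / 1 / 1 * falling (real L) k * B k"
    by (intro tendsto_mult tendsto_divide rev_fps_p_tendsto[OF mean] 1 2 b k tendsto_const) auto
  then have lim: "(\<lambda>d. (rev_fps (p d) $ k / real d ^ k) / (falling (real d) k / real d ^ k) /
      (falling (n d + real d) k / (n d + real d) ^ k) * falling (real L) k * (b d ^ k * falling (n d + real L) k))
      \<longlonglongrightarrow> coeff r i"
    using r(2)[OF k(1)] k(2) by simp
  show "(\<lambda>d. coeff (dilate_poly (a d) (q d)) i) \<longlonglongrightarrow> coeff r i"
  proof (rule Lim_transform_eventually[OF lim])
    show "\<forall>\<^sub>F d in sequentially. (rev_fps (p d) $ k / real d ^ k) / (falling (real d) k / real d ^ k) /
      (falling (n d + real d) k / (n d + real d) ^ k) * falling (real L) k * (b d ^ k * falling (n d + real L) k) =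
      coeff (dilate_poly (a d) (q d)) i"
      using L a eventually_ge_at_top[of 1]
    proof eventually_elim
      case (elim d)
      have pos: "real d ^ k \<noteq> 0" "(n d + real d) ^ k \<noteq> 0" using elim n[of d] by auto
      have deg: "degree (dilate_poly (a d) (q d)) = L"
        unfolding degree_dilate_poly[OF conjunct2[OF elim(2)]] using degree_q elim(1,3) by simp
      have "coeff (dilate_poly (a d) (q d)) i = rev_fps (dilate_poly (a d) (q d)) $ k"
        using k by (simp add: rev_fps_nth deg)
      also have "\<dots> = a d ^ k * rev_fps (q d) $ k"
        by (rule rev_fps_dilate_poly[OF conjunct2[OF elim(2)]])
      also have "\<dots> = (n d + real d) ^ k * b d ^ k * (falling (real L) k * falling (n d + real L) k *
          (rev_fps (p d) $ k / (falling (real d) k * falling (n d + real d) k)))"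
        using elim k rev_fps_q[of d k] by (simp add: power_mult_distrib add.commute)
      finally show ?case using pos by simp
    qed
  qed
qed

lemma falling_of_nat: "k \<le> L \<Longrightarrow> falling (real L) k = fact L / fact (L - k)"
proof (induction k)
  case (Suc k)
  then have "L - k = Suc (L - Suc k)" by simp
  then have fact: "fact (L - k) = (real L - real k) * (fact (L - Suc k) :: real)"
    using Suc.prems by (simp add: of_nat_diff)
  have "falling (real L) (Suc k) = falling (real L) k * (real L - real k)"
    by (simp add: falling_def)
  also have "\<dots> = fact L / fact (L - Suc k)"
    using Suc fact by simp
  finally show ?case .
qed (simp add: falling_def)

lemma laguerre_limit:
  assumes mean: "(\<integral>x. x \<partial>\<mu>) = 1" and L: "\<forall>\<^sub>F d in sequentially. l d = L"
    and \<nu>: "\<And>d. d \<ge> 1 \<Longrightarrow> n d = \<nu>"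
  shows "\<exists>r. unif_compact_limit (\<lambda>d. dilate_poly (real d + n d) (q d)) r \<and> r \<approx> laguerre \<nu> L"
proof (intro exI conjI)
  \<comment> \<open>The leading coefficient of \<open>laguerre\<close> is (-1)^L / L!, while the
    dilated polynomials are monic.\<close>
  let ?r = "smult ((- 1) ^ L * fact L) (laguerre \<nu> L)"
  show "?r \<approx> laguerre \<nu> L"
    unfolding proportional_def by (intro exI[of _ "(- 1) ^ L * fact L"]) simp
  have coeff: "coeff (laguerre \<nu> L) i = (if i \<le> L then (- 1) ^ i * falling (real L + \<nu>) (L - i) / (fact i * fact (L - i)) else 0)" for i
    unfolding laguerre_def coeff_sum coeff_monom by (simp add: sum.delta)
  show "unif_compact_limit (\<lambda>d. dilate_poly (real d + n d) (q d)) ?r"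
  proof (rule dilate_q_limit[where b = "\<lambda>_. 1" and B = "\<lambda>k. falling (\<nu> + real L) k", OF mean L])
    show "\<forall>\<^sub>F d in sequentially. real d + n d = (real d + n d) * 1 \<and> real d + n d \<noteq> 0"
      using eventually_ge_at_top[of 1]
    proof eventually_elim
      case (elim d)
      then show ?case using n[of d] by auto
    qed
    show "(\<lambda>d. 1 ^ k * falling (n d + real L) k) \<longlonglongrightarrow> falling (\<nu> + real L) k" for k
      by (rule tendsto_eventually) (use eventually_ge_at_top[of 1] in eventually_elim, simp add: \<nu>)
    show "degree ?r \<le> L" by (intro degree_le) (simp add: coeff)
    fix k assume k: "k \<le> L"
    have "(- 1 :: real) ^ L = (- 1) ^ (L - k) * (- 1) ^ k" using k by (simp flip: power_add)
    moreover have "(- 1 :: real) ^ (L - k) * (- 1) ^ (L - k) = 1" by (simp flip: power_mult_distrib)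
    ultimately have "(- 1 :: real) ^ L * (- 1) ^ (L - k) = (- 1) ^ k" by (simp add: mult.commute mult.left_commute)
    then have "coeff ?r (L - k) = (- 1) ^ k * fact L * falling (real L + \<nu>) k / (fact (L - k) * fact k)"
      using k by (simp add: coeff mult.commute mult.left_commute)
    then show "coeff ?r (L - k) = (- 1) ^ k / fact k * falling (real L) k * falling (\<nu> + real L) k"
      using k by (simp add: falling_of_nat add.commute mult_ac)
  qed
qed

lemma power_limit:
  assumes mean: "(\<integral>x. x \<partial>\<mu>) = 1" and L: "\<forall>\<^sub>F d in sequentially. l d = L"
    and top: "filterlim n at_top sequentially"
  shows "unif_compact_limit (\<lambda>d. dilate_poly ((real d + n d) / n d) (q d)) ([:-1, 1:] ^ L)"
proof (rule dilate_q_limit[where b = "\<lambda>d. 1 / n d" and B = "\<lambda>_. 1", OF mean L])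
  have n_pos: "\<forall>\<^sub>F d in sequentially. n d > 0"
    using top by (simp add: filterlim_at_top_dense)
  then show "\<forall>\<^sub>F d in sequentially. (real d + n d) / n d = (real d + n d) * (1 / n d) \<and> (real d + n d) / n d \<noteq> 0"
    by eventually_elim auto
  show "(\<lambda>d. (1 / n d) ^ k * falling (n d + real L) k) \<longlonglongrightarrow> 1" for k
  proof -
    have nL: "filterlim (\<lambda>d. n d + real L) at_top sequentially"
      by (rule filterlim_at_top_mono[OF top]) simp
    have quot: "((\<lambda>x::real. (x + real L) / x) \<longlongrightarrow> 1) at_top" by real_asymp
    have "(\<lambda>d. falling (n d + real L) k / (n d + real L) ^ k * ((n d + real L) / n d) ^ k) \<longlonglongrightarrow> 1 * 1 ^ k"
      by (intro tendsto_mult tendsto_power filterlim_compose[OF falling_ratio_tendsto nL] filterlim_compose[OF quot top])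
    then have "(\<lambda>d. falling (n d + real L) k / (n d + real L) ^ k * ((n d + real L) / n d) ^ k) \<longlonglongrightarrow> 1" by simp
    then show ?thesis
    proof (rule Lim_transform_eventually)
      show "\<forall>\<^sub>F d in sequentially. falling (n d + real L) k / (n d + real L) ^ k * ((n d + real L) / n d) ^ k =
          (1 / n d) ^ k * falling (n d + real L) k"
        using n_pos by eventually_elim (simp add: power_divide)
    qed
  qed
  show "degree ([:-1, 1:] ^ L :: real poly) \<le> L" by (simp add: degree_linear_power)
  fix k assume k: "k \<le> L"
  then have "coeff ([:-1, 1:] ^ L) (L - k) = real (L choose k) * (- 1) ^ k"
    by (simp add: coeff_linear_poly_power binomial_symmetric[symmetric])
  then show "coeff ([:-1, 1:] ^ L) (L - k) = (- 1) ^ k / fact k * falling (real L) k * 1"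
    using k by (simp add: falling_of_nat binomial_fact)
qed

end

section \<open>Limits for l tending to infinity\<close>

lemma dilate_measure_1:
  fixes M :: "real measure"
  assumes "sets M = sets borel"
  shows "dilate_measure 1 M = M"
  unfolding dilate_measure_def mult_1 using distr_id2[of borel M] assms by simp

context derivative_flow
begin

lemma marchenko_pastur_limit:
  assumes mean: "(\<integral>x. x \<partial>\<mu>) = 1" and l: "filterlim l at_top sequentially"
    and ld: "(\<lambda>d. real (l d) / real d) \<longlonglongrightarrow> 0"
    and nl: "(\<lambda>d. n d / real (l d)) \<longlonglongrightarrow> \<alpha>" and "\<alpha> \<ge> 0"
  shows "weak_conv_m (\<lambda>d. root_measure (dilate_poly ((real d + n d) / (n d + real (l d))) (q d)))
    (dilate_measure (1 / (1 + \<alpha>)) (marchenko_pastur (1 + \<alpha>)))"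
proof -
  define a where "a d = (real d + n d) / (n d + real (l d))" for d
  define c where "c = 1 + \<alpha>"
  have c: "c \<ge> 1" using \<open>\<alpha> \<ge> 0\<close> by (simp add: c_def)
  have l_ge: "\<forall>\<^sub>F d in sequentially. l d \<ge> i" for i
    using l by (simp add: filterlim_at_top)
  have "(\<lambda>d. n d / real (l d) * (real (l d) / real d)) \<longlonglongrightarrow> \<alpha> * 0"
    by (intro tendsto_mult nl ld)
  then have "(\<lambda>d. n d / real (l d) * (real (l d) / real d)) \<longlonglongrightarrow> 0" by simp
  then have nd: "(\<lambda>d. n d / real d) \<longlonglongrightarrow> 0"
    by (rule Lim_transform_eventually) (use l_ge[of 1] in eventually_elim, simp)
  \<comment> \<open>Since n = o(d), the cumulants of the original polynomials belong to the ratio 1;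
    \<alpha> enters only through the ratio at degree l.\<close>
  obtain F where F: "F $ 0 = 0" "\<And>k. (\<lambda>d. cum d k) \<longlonglongrightarrow> F $ k"
    "moment_series \<mu> = fps_compose F (H_series (1 / (1 + 0)) (moment_series \<mu>))"
    using cumulants_p_tendsto[OF nd order_refl] by blast
  have "moment_series \<mu> $ 1 = fps_compose F (H_series (1 / (1 + 0)) (moment_series \<mu>)) $ 1"
    using F(3) by metis
  also have "\<dots> = F $ 1"
    by (simp add: fps_compose_nth F(1) H_series_nth_1[unfolded One_nat_def])
  finally have F1: "F $ 1 = 1" using mean by (simp add: moment_series_def)
  have a_pos: "\<forall>\<^sub>F d in sequentially. a d > 0"
    using l_ge[of 1] eventually_ge_at_top[of 1]
  proof eventually_elim
    case (elim d)
    then show ?case unfolding a_def using n[of d] by (intro divide_pos_pos) auto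
  qed
  \<comment> \<open>The dilation is the reciprocal of (n + l) / (n + d) in
    \<open>cum_factor\<close>. What remains is the cumulant times (l / d)^(k - 1), which tends to 0
    for k \<ge> 2 and to the mean for k = 1.\<close>
  have G: "(\<lambda>d. a d ^ k * cum d k * cum_factor d k) \<longlonglongrightarrow> fps_X $ k" for k
  proof (cases k)
    case 0
    then show ?thesis by (simp add: cumulant_def log_symbol_0)
  next
    case (Suc i)
    have "(\<lambda>d. cum d k * (real (l d) / real d) ^ i) \<longlonglongrightarrow> F $ k * 0 ^ i"
      by (intro tendsto_mult tendsto_power F ld)
    also have "F $ k * 0 ^ i = fps_X $ k"
      using F1 by (cases i) (simp_all add: Suc)
    finally show ?thesis
    proof (rule Lim_transform_eventually)
      show "\<forall>\<^sub>F d in sequentially. cum d k * (real (l d) / real d) ^ i =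
          a d ^ k * cum d k * cum_factor d k"
        using l_ge[of 1] eventually_ge_at_top[of 1]
      proof eventually_elim
        case (elim d)
        define w where "w = (n d + real (l d)) / (n d + real d)"
        define u where "u = real (l d) / real d"
        have nz: "n d + real (l d) \<noteq> 0" "n d + real d \<noteq> 0" using elim n[of d] by auto
        have aw: "a d * w = 1" using nz by (simp add: a_def w_def add.commute)
        have u: "u * (real d / real (l d)) = 1" using elim by (simp add: u_def)
        have split: "a d ^ k * x * ((u * w) ^ k * y) = (a d * w) ^ k * x * u ^ i * (u * y)" for x y
          unfolding Suc by (simp add: power_mult_distrib)
        have "a d ^ k * x * ((u * w) ^ k * (real d / real (l d))) = x * u ^ i" for x
          by (simp only: split aw u power_one mult_1 mult_1_right)
        then show ?case
          unfolding u_def[symmetric] w_def[symmetric] by (simp only:)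
      qed
    qed
  qed
  obtain m where m: "\<And>k. (\<lambda>d. moment_series (root_measure (dilate_poly (a d) (q d))) $ k) \<longlonglongrightarrow> m $ k"
    "m = fps_compose fps_X (H_series (1 / (1 + \<alpha>)) m)"
    using moments_dilate_q_tendsto[OF l nl \<open>\<alpha> \<ge> 0\<close> a_pos G] by blast
  have m_eq: "m = H_series (1 / c) m"
    using m(2) by (simp add: c_def fps_X_fps_compose_startby0)
  interpret MP: real_distribution "marchenko_pastur c" by (rule real_distribution_marchenko_pastur[OF c])
  define N where "N = dilate_measure (1 / c) (marchenko_pastur c)"
  have N: "real_distribution N"
    unfolding N_def dilate_measure_def by (rule MP.real_distribution_distr) simp
  then interpret N: real_distribution N .
  have N_moment: "(\<integral>x. x ^ k \<partial>N) = (\<integral>x. x ^ k \<partial>marchenko_pastur c) / c ^ k" for k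
    unfolding N_def dilate_measure_def by (subst integral_distr) (simp_all add: power_divide)
  have N_support: "AE x in N. \<bar>x\<bar> \<le> (1 + sqrt c)\<^sup>2 / c"
    unfolding N_def dilate_measure_def
  proof (subst AE_distr_iff)
    show "AE x in marchenko_pastur c. \<bar>1 / c * x\<bar> \<le> (1 + sqrt c)\<^sup>2 / c"
      using AE_marchenko_pastur[OF c] by eventually_elim (use c in \<open>simp add: divide_right_mono\<close>)
  qed simp_all
  have good: "\<forall>\<^sub>F d in sequentially. nonneg_rooted (dilate_poly (a d) (q d)) (a d * C)"
    using a_pos l_ge[of 1] eventually_ge_at_top[of 1]
    by eventually_elim (intro nonneg_rooted.nonneg_rooted_dilate nonneg_rooted_q)
  then obtain D where D: "\<And>d. d \<ge> D \<Longrightarrow> nonneg_rooted (dilate_poly (a d) (q d)) (a d * C)"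
    by (auto simp: eventually_sequentially)
  define M where "M d = root_measure (dilate_poly (a (d + D)) (q (d + D)))" for d
  have M: "real_distribution (M d)" "integrable (M d) (\<lambda>x. x ^ k)" for d k
    using nonneg_rooted.real_distribution_roots[OF D[of "d + D"]]
      nonneg_rooted.integrable_root_measure_power[OF D[of "d + D"]] by (simp_all add: M_def)
  have "weak_conv_m M N"
  proof (rule weak_conv_of_moments[OF M(1) N _ N_support M(2)])
    show "(1 + sqrt c)\<^sup>2 / c \<ge> 0" using c by simp
    fix k
    show "(\<lambda>d. \<integral>x. x ^ k \<partial>M d) \<longlonglongrightarrow> (\<integral>x. x ^ k \<partial>N)"
    proof (cases "k = 0")
      case True
      then show ?thesis
        using prob_space.prob_space[OF real_distribution.axioms(1)[OF M(1)]] N.prob_space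
          real_distribution.space_eq_univ[OF M(1)] by simp
    next
      case False
      then have "(\<lambda>d. \<integral>x. x ^ k \<partial>M d) \<longlonglongrightarrow> m $ k"
        using LIMSEQ_ignore_initial_segment[OF m(1)[of k], of D] by (simp add: M_def moment_series_def)
      moreover have "m $ k = (\<integral>x. x ^ k \<partial>N)"
        using marchenko_pastur_moments_unique[OF c m_eq, of k] False N_moment by simp
      ultimately show ?thesis by simp
    qed
  qed
  then have "weak_conv_m (\<lambda>d. root_measure (dilate_poly (a d) (q d))) N"
    using weak_conv_m_offset[of "\<lambda>d. root_measure (dilate_poly (a d) (q d))" D N] by (simp only: M_def[abs_def])
  then show ?thesis
    unfolding a_def N_def c_def .
qed

text \<open>Here \<open>cum_factor\<close> tends to s^k / t with s = t (\<alpha> + t) / (\<alpha> +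
  1), which turns the series C into C(s z) / t. The quotient n / l tends to \<alpha> / t, whence the
  new ratio t / (t + \<alpha>).\<close>

lemma sqrt_measure_limit:
  assumes t: "0 < t" "t < 1" and ld: "(\<lambda>d. real (l d) / real d) \<longlonglongrightarrow> t"
    and nd: "(\<lambda>d. n d / real d) \<longlonglongrightarrow> \<alpha>" and "\<alpha> \<ge> 0"
  obtains \<nu> K K' where "real_distribution \<nu>"
    "weak_conv_m (\<lambda>d. sqrt_measure (root_measure (q d))) (sqrt_measure \<nu>)"
    "is_rect_R (t / (t + \<alpha>)) (sqrt_measure \<nu>) K'"
    "is_rect_R (1 / (1 + \<alpha>)) (sqrt_measure \<mu>) K"
    "\<forall>\<^sub>F z in nhds 0. K' z = 1 / of_real t * K (of_real (t * (\<alpha> + t) / (\<alpha> + 1)) * z)"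
proof -
  have "filterlim (\<lambda>d. real (l d) / real d * real d) at_top sequentially"
    by (rule filterlim_tendsto_pos_mult_at_top[OF ld t(1) filterlim_real_sequentially])
  moreover have "\<forall>\<^sub>F d in sequentially. real (l d) / real d * real d = real (l d)"
    using eventually_ge_at_top[of 1] by eventually_elim simp
  ultimately have "filterlim (\<lambda>d. real (l d)) at_top sequentially"
    using filterlim_cong[OF refl refl] by fast
  then have "\<forall>\<^sub>F d in sequentially. real Z \<le> real (l d)" for Z
    unfolding filterlim_at_top by blast
  then have l: "filterlim l at_top sequentially"
    unfolding filterlim_at_top of_nat_le_iff by blast
  have l_ge: "\<forall>\<^sub>F d in sequentially. l d \<ge> i" for i
    using l by (simp add: filterlim_at_top)
  define \<beta> where "\<beta> = \<alpha> / t"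
  have \<beta>: "\<beta> \<ge> 0" using t \<open>\<alpha> \<ge> 0\<close> by (simp add: \<beta>_def)
  have "(\<lambda>d. (n d / real d) / (real (l d) / real d)) \<longlonglongrightarrow> \<alpha> / t"
    by (intro tendsto_divide nd ld) (use t in simp)
  then have nl: "(\<lambda>d. n d / real (l d)) \<longlonglongrightarrow> \<beta>"
    unfolding \<beta>_def by (rule Lim_transform_eventually) (use eventually_ge_at_top[of 1] in eventually_elim, simp)
  define s where "s = t * (\<alpha> + t) / (\<alpha> + 1)"
  obtain F where F: "F $ 0 = 0" "\<And>k. (\<lambda>d. cum d k) \<longlonglongrightarrow> F $ k"
    "moment_series \<mu> = fps_compose F (H_series (1 / (1 + \<alpha>)) (moment_series \<mu>))"
    using cumulants_p_tendsto[OF nd \<open>\<alpha> \<ge> 0\<close>] by blast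
  define F' where "F' = Abs_fps (\<lambda>k. F $ k * s ^ k / t)"
  have ratio: "(\<lambda>d. (n d + real (l d)) / (n d + real d)) \<longlonglongrightarrow> (\<alpha> + t) / (\<alpha> + 1)"
  proof (rule Lim_transform_eventually)
    show "(\<lambda>d. (n d / real d + real (l d) / real d) / (n d / real d + 1)) \<longlonglongrightarrow> (\<alpha> + t) / (\<alpha> + 1)"
      by (intro tendsto_intros nd ld) (use \<open>\<alpha> \<ge> 0\<close> in simp)
    show "\<forall>\<^sub>F d in sequentially. (n d / real d + real (l d) / real d) / (n d / real d + 1) =
        (n d + real (l d)) / (n d + real d)"
      using eventually_ge_at_top[of 1]
    proof eventually_elim
      case (elim d)
      then have "n d / real d + 1 = (n d + real d) / real d" by (simp add: add_divide_distrib)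
      then show ?case using elim by (simp flip: add_divide_distrib)
    qed
  qed
  have dl: "(\<lambda>d. real d / real (l d)) \<longlonglongrightarrow> 1 / t"
    using tendsto_divide[OF tendsto_const[of 1] ld] t by simp
  have G: "(\<lambda>d. 1 ^ k * cum d k * cum_factor d k) \<longlonglongrightarrow> F' $ k" for k
  proof -
    have "(\<lambda>d. 1 ^ k * cum d k * cum_factor d k)
      \<longlonglongrightarrow> 1 ^ k * F $ k * ((t * ((\<alpha> + t) / (\<alpha> + 1))) ^ k * (1 / t))"
      by (intro tendsto_mult tendsto_const tendsto_power F ld ratio dl)
    then show ?thesis by (simp add: F'_def s_def)
  qed
  obtain m where m: "\<And>k. (\<lambda>d. moment_series (root_measure (dilate_poly 1 (q d))) $ k) \<longlonglongrightarrow> m $ k"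
    "m = fps_compose F' (H_series (1 / (1 + \<beta>)) m)"
    using moments_dilate_q_tendsto[OF l nl \<beta> _ G] by auto
  obtain D where D: "\<And>d. d \<ge> D \<Longrightarrow> l d \<ge> 1" "D \<ge> 1"
    using l_ge[of 1] unfolding eventually_sequentially by (metis max.bounded_iff max.cobounded2)
  define M where "M d = root_measure (q (d + D))" for d
  have rooted: "nonneg_rooted (q (d + D)) C" for d
    using D(1)[of "d + D"] D(2) by (intro nonneg_rooted_q) auto
  note M = nonneg_rooted.real_distribution_roots[OF rooted, folded M_def]
    nonneg_rooted.root_measure_support[OF rooted, folded M_def]
  have lim: "(\<lambda>d. \<integral>x. x ^ k \<partial>M d) \<longlonglongrightarrow> (if k = 0 then 1 else m $ k)" for k
  proof (cases "k = 0")
    case True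
    then show ?thesis
      using prob_space.prob_space[OF real_distribution.axioms(1)[OF M(1)]]
        real_distribution.space_eq_univ[OF M(1)] by simp
  next
    case False
    then show ?thesis
      using LIMSEQ_ignore_initial_segment[OF m(1)[of k], of D] by (simp add: M_def moment_series_def dilate_poly_1)
  qed
  obtain \<nu> where \<nu>: "real_distribution \<nu>" "weak_conv_m M \<nu>" "AE x in \<nu>. 0 \<le> x \<and> x \<le> C"
    "\<And>k. (\<integral>x. x ^ k \<partial>\<nu>) = (if k = 0 then 1 else m $ k)"
    using tendsto_moments_imp_weak_conv[OF M less_imp_le[OF C] lim] by blast
  have m0: "m $ 0 = 0"
    using LIMSEQ_unique[OF m(1)[of 0], of 0] by simp
  have m_eq: "moment_series \<nu> = m"
    using m0 by (simp add: moment_series_def fps_eq_iff \<nu>(4))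
  have bounded: "bounded_nonneg_distribution \<nu> C"
    unfolding bounded_nonneg_distribution_def bounded_nonneg_distribution_axioms_def
    using \<nu> C by blast
  have r': "1 / (1 + \<beta>) = t / (t + \<alpha>)"
    using t by (simp add: \<beta>_def field_simps)
  have comp: "fps_compose (Abs_fps (\<lambda>k. F $ k * s ^ k / t)) (H_series (t / (t + \<alpha>)) (moment_series \<nu>)) = moment_series \<nu>"
    unfolding m_eq F'_def[symmetric] r'[symmetric] by (rule m(2)[symmetric])
  obtain K K' where K: "is_rect_R (1 / (1 + \<alpha>)) (sqrt_measure \<mu>) K" "is_rect_R (t / (t + \<alpha>)) (sqrt_measure \<nu>) K'"
    "\<forall>\<^sub>F z in nhds 0. K' z = 1 / of_real t * K (of_real s * z)"
    by (rule rect_R_rescaled[OF bounded_mu bounded _ _ _ _ t(1) F(1) F(3)[symmetric] comp]) (use t \<open>\<alpha> \<ge> 0\<close> in auto)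
  have "weak_conv_m (\<lambda>d. sqrt_measure (M d)) (sqrt_measure \<nu>)"
    by (rule weak_conv_sqrt_measure[OF M(1) \<nu>(1,2)])
  then have "weak_conv_m (\<lambda>d. sqrt_measure (root_measure (q d))) (sqrt_measure \<nu>)"
    unfolding M_def weak_conv_m_offset[where M = "\<lambda>d. sqrt_measure (root_measure (q d))"] .
  from that[OF \<nu>(1) this K(2,1) K(3)[unfolded s_def]] show ?thesis .
qed

lemma sqrt_measure_limit_rect_power:
  assumes t: "0 < t" "t < 1" and ld: "(\<lambda>d. real (l d) / real d) \<longlonglongrightarrow> t"
    and nd: "(\<lambda>d. n d / real d) \<longlonglongrightarrow> 0"
  shows "weak_conv_m (\<lambda>d. sqrt_measure (root_measure (q d))) (dilate_measure t (rect_power 1 (sqrt_measure \<mu>) (1 / t)))"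
proof -
  obtain \<nu> K K' where \<nu>: "real_distribution \<nu>"
    and wc: "weak_conv_m (\<lambda>d. sqrt_measure (root_measure (q d))) (sqrt_measure \<nu>)"
    and K': "is_rect_R (t / (t + 0)) (sqrt_measure \<nu>) K'"
    and K: "is_rect_R (1 / (1 + 0)) (sqrt_measure \<mu>) K"
    and eq: "\<forall>\<^sub>F z in nhds 0. K' z = 1 / of_real t * K (of_real (t * (0 + t) / (0 + 1)) * z)"
    using sqrt_measure_limit[OF t ld nd order_refl] by blast
  have rd: "real_distribution (sqrt_measure \<nu>)" by (rule real_distribution_sqrt_measure[OF \<nu>])
  \<comment> \<open>For \<alpha> = 0 the scaling factor is t^2. Dilation by 1 / t undoes it and
    leaves the transform of \<open>sqrt_measure \<mu>\<close> divided by t, which characterises the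
    convolution power.\<close>
  define \<nu>' where "\<nu>' = dilate_measure (1 / t) (sqrt_measure \<nu>)"
  have K1: "\<forall>\<^sub>F z in at_left 0. K (of_real z) = of_real (rect_R 1 (sqrt_measure \<mu>) z)"
    using K by (simp add: is_rect_R_def)
  have K'1: "\<forall>\<^sub>F z in at_left 0. K' (of_real z) = of_real (rect_R 1 (sqrt_measure \<nu>) z)"
    using K' t by (simp add: is_rect_R_def)
  have scale: "filterlim (\<lambda>z. (1 / t)\<^sup>2 * z) (at_left 0) (at_left 0)"
    using t by (intro filterlim_mult_at_left_0) simp
  have of_real_lim: "filterlim (\<lambda>z. complex_of_real ((1 / t)\<^sup>2 * z)) (nhds 0) (at_left 0)"
  proof -
    have "((\<lambda>z. complex_of_real ((1 / t)\<^sup>2 * z)) \<longlongrightarrow> of_real ((1 / t)\<^sup>2 * 0)) (at_left 0)"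
      by (intro tendsto_intros)
    then show ?thesis by simp
  qed
  have "\<forall>\<^sub>F z in at_left 0. rect_R 1 \<nu>' z = rect_R 1 (sqrt_measure \<nu>) ((1 / t)\<^sup>2 * z)"
    unfolding \<nu>'_def by (rule rect_R_dilate[OF rd]) (use t in auto)
  then have "\<forall>\<^sub>F z in at_left 0. rect_R 1 \<nu>' z = 1 / t * rect_R 1 (sqrt_measure \<mu>) z"
    using eventually_compose_filterlim[OF K'1 scale] K1
      eventually_compose_filterlim[OF eq of_real_lim]
  proof eventually_elim
    case (elim z)
    have "complex_of_real (rect_R 1 \<nu>' z) = K' (of_real ((1 / t)\<^sup>2 * z))"
      using elim by simp
    also have "\<dots> = 1 / of_real t * K (of_real (t * (0 + t) / (0 + 1)) * of_real ((1 / t)\<^sup>2 * z))"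
      using elim(4) .
    also have "complex_of_real (t * (0 + t) / (0 + 1)) * of_real ((1 / t)\<^sup>2 * z) = of_real z"
      unfolding of_real_mult[symmetric] using t by (simp add: power2_eq_square)
    finally have "complex_of_real (rect_R 1 \<nu>' z) = complex_of_real (1 / t * rect_R 1 (sqrt_measure \<mu>) z)"
      using elim(3) by simp
    then show ?case by (simp only: of_real_eq_iff)
  qed
  then have "rect_power 1 (sqrt_measure \<mu>) (1 / t) = \<nu>'"
    unfolding \<nu>'_def
    by (intro rect_power_eqI symmetric_distribution_dilate symmetric_distribution_sqrt_measure \<nu>) auto
  then have "dilate_measure t (rect_power 1 (sqrt_measure \<mu>) (1 / t)) = sqrt_measure \<nu>"
    using dilate_measure_dilate_measure[OF rd, of t] t by (simp add: \<nu>'_def)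
  then show ?thesis using wc by simp
qed

end

section \<open>Asymptotic hypotheses as limits of ratios, and assembly of the cases\<close>

lemma asymp_equiv_imp_ratio_tendsto:
  fixes f g :: "nat \<Rightarrow> real"
  assumes "f \<sim>[sequentially] (\<lambda>d. c * g d)" "c > 0" "\<forall>\<^sub>F d in sequentially. g d > 0"
  shows "(\<lambda>d. f d / g d) \<longlonglongrightarrow> c"
proof -
  have "(\<lambda>d. f d / (c * g d)) \<longlonglongrightarrow> 1"
    by (rule asymp_equivD_strong[OF assms(1)]) (use assms(3) in eventually_elim, use assms(2) in simp)
  from tendsto_mult[OF tendsto_const[of c] this] show ?thesis
    using assms(2) by simp
qed

theorem theorem2p7:
  fixes p :: "nat \<Rightarrow> real poly" and \<mu> :: "real measure" and C :: real
    and n :: "nat \<Rightarrow> real" and j :: "nat \<Rightarrow> nat"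
  defines "q \<equiv> \<lambda>d. p_jd (n d) (j d) d (p d)"
    and "l \<equiv> \<lambda>d. d - j d"
  assumes monic: "\<And>d. d \<ge> 1 \<Longrightarrow> degree (p d) = d \<and> lead_coeff (p d) = 1"
    and nonneg: "\<And>d z. d \<ge> 1 \<Longrightarrow> cpoly (p d) z = 0 \<Longrightarrow> z \<in> \<real>\<^sub>\<ge>\<^sub>0"
    and prob: "real_distribution \<mu>" "compactly_supported \<mu>"
    and conv: "weak_conv_m (\<lambda>d. root_measure (p d)) \<mu>"
    and bound: "C > 0" "\<And>d z. d \<ge> 1 \<Longrightarrow> cpoly (p d) z = 0 \<Longrightarrow> norm z \<le> C"
    and n: "\<And>d. d \<ge> 1 \<Longrightarrow> n d > -1"
    and j: "\<And>d. d \<ge> 1 \<Longrightarrow> j d \<in> {1..d}"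
  shows
    "(\<comment> \<open>(A1), (A2)\<close>
      (\<forall>L. (\<forall>\<^sub>F d in sequentially. l d = L) \<and> (\<integral>x. x \<partial>\<mu>) = 1 \<longrightarrow>
        (\<forall>\<nu>. (\<forall>d\<ge>1. n d = \<nu>) \<longrightarrow>
          (\<exists>r. unif_compact_limit (\<lambda>d. dilate_poly (real d + n d) (q d)) r \<and>
               r \<approx> laguerre \<nu> L)) \<and>
        (filterlim n at_top sequentially \<longrightarrow>
          unif_compact_limit (\<lambda>d. dilate_poly ((real d + n d) / n d) (q d)) ([:-1, 1:] ^ L)))) \<and>
     (\<comment> \<open>(B1), (B2)\<close>
      filterlim l at_top sequentially \<and> (\<lambda>d. real (l d)) \<in> o(\<lambda>d. real d) \<and>
        (\<integral>x. x \<partial>\<mu>) = 1 \<longrightarrow>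
        (n \<in> o(\<lambda>d. real (l d)) \<longrightarrow>
          weak_conv_m
            (\<lambda>d. root_measure (dilate_poly ((real d + n d) / (n d + real (l d))) (q d)))
            (marchenko_pastur 1)) \<and>
        (\<forall>\<alpha>>0. n \<sim>[sequentially] (\<lambda>d. \<alpha> * real (l d)) \<longrightarrow>
          weak_conv_m
            (\<lambda>d. root_measure (dilate_poly ((real d + n d) / (n d + real (l d))) (q d)))
            (dilate_measure (1 / (1 + \<alpha>)) (marchenko_pastur (1 + \<alpha>))))) \<and>
     (\<comment> \<open>(C1), (C2)\<close>
      \<forall>t\<in>{0<..<1}. (\<lambda>d. real (l d)) \<sim>[sequentially] (\<lambda>d. t * real d) \<longrightarrow>
        (n \<in> o(\<lambda>d. real d) \<longrightarrow>
          weak_conv_m (\<lambda>d. sqrt_measure (root_measure (q d)))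
            (dilate_measure t (rect_power 1 (sqrt_measure \<mu>) (1 / t)))) \<and>
        (\<forall>\<alpha>>0. n \<sim>[sequentially] (\<lambda>d. \<alpha> * real d) \<longrightarrow>
          (\<exists>\<mu>' C' C\<^sub>\<alpha>. symmetric_distribution \<mu>' \<and>
             weak_conv_m (\<lambda>d. sqrt_measure (root_measure (q d))) \<mu>' \<and>
             is_rect_R (t / (t + \<alpha>)) \<mu>' C' \<and>
             is_rect_R (1 / (1 + \<alpha>)) (sqrt_measure \<mu>) C\<^sub>\<alpha> \<and>
             (\<forall>\<^sub>F z in nhds 0. C' z = 1 / of_real t *
                C\<^sub>\<alpha> (of_real (t * (\<alpha> + t) / (\<alpha> + 1)) * z)))))"
proof (intro conjI allI impI ballI)
  have roots: "z \<in> of_real ` {0..C}" if "d \<ge> 1" "cpoly (p d) z = 0" for d z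
  proof -
    have z: "z \<in> \<real>\<^sub>\<ge>\<^sub>0" "norm z \<le> C" using nonneg bound(2) that by auto
    then have "z = of_real (Re z)" "Re z \<ge> 0" by (auto simp: nonneg_Reals_def complex_eq_iff)
    moreover have "Re z \<le> C" using abs_Re_le_cmod[of z] z(2) by linarith
    ultimately show ?thesis by (intro image_eqI[of _ _ "Re z"]) auto
  qed
  interpret flow: derivative_flow p \<mu> C n j
    by (rule derivative_flow.intro) (use monic roots bound(1) prob(1) conv n j in blast)+
  have q: "q = flow.q" and l: "l = flow.l"
    by (simp_all add: q_def l_def flow.q_def flow.l_def fun_eq_iff)
  have d_pos: "\<forall>\<^sub>F d in sequentially. real d > 0"
    using eventually_ge_at_top[of 1] by eventually_elim simp
  {
    fix L \<nu> assume *: "(\<forall>\<^sub>F d in sequentially. l d = L) \<and> (\<integral>x. x \<partial>\<mu>) = 1" "\<forall>d\<ge>1. n d = \<nu>"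
    show "\<exists>r. unif_compact_limit (\<lambda>d. dilate_poly (real d + n d) (q d)) r \<and> r \<approx> laguerre \<nu> L"
      unfolding q by (rule flow.laguerre_limit) (use * l in auto)
  next
    fix L assume *: "(\<forall>\<^sub>F d in sequentially. l d = L) \<and> (\<integral>x. x \<partial>\<mu>) = 1" "filterlim n at_top sequentially"
    show "unif_compact_limit (\<lambda>d. dilate_poly ((real d + n d) / n d) (q d)) ([:-1, 1:] ^ L)"
      unfolding q by (rule flow.power_limit) (use * l in auto)
  next
    assume *: "filterlim l at_top sequentially \<and> (\<lambda>d. real (l d)) \<in> o(\<lambda>d. real d) \<and> (\<integral>x. x \<partial>\<mu>) = 1"
    note ld = smalloD_tendsto[OF conjunct1[OF conjunct2[OF *]]]
    have "\<forall>\<^sub>F d in sequentially. l d \<ge> 1"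
      using * unfolding filterlim_at_top by blast
    then have l_pos: "\<forall>\<^sub>F d in sequentially. real (l d) > 0"
      by eventually_elim simp
    show "weak_conv_m (\<lambda>d. root_measure (dilate_poly ((real d + n d) / (n d + real (l d))) (q d))) (marchenko_pastur 1)"
      if "n \<in> o(\<lambda>d. real (l d))"
    proof -
      have "real_distribution (marchenko_pastur 1)" by (rule real_distribution_marchenko_pastur) simp
      then have "dilate_measure 1 (marchenko_pastur 1) = marchenko_pastur 1"
        by (intro dilate_measure_1 real_distribution.events_eq_borel)
      then show ?thesis
        using flow.marchenko_pastur_limit[of 0] * ld smalloD_tendsto[OF that] unfolding q l by simp
    qed
    show "weak_conv_m (\<lambda>d. root_measure (dilate_poly ((real d + n d) / (n d + real (l d))) (q d)))
        (dilate_measure (1 / (1 + \<alpha>)) (marchenko_pastur (1 + \<alpha>)))"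
      if "\<alpha> > 0" "n \<sim>[sequentially] (\<lambda>d. \<alpha> * real (l d))" for \<alpha>
      unfolding q l
    proof (rule flow.marchenko_pastur_limit)
      show "(\<lambda>d. n d / real (flow.l d)) \<longlonglongrightarrow> \<alpha>"
        using asymp_equiv_imp_ratio_tendsto[OF that(2,1) l_pos] unfolding l .
    qed (use * ld that in \<open>simp_all add: l\<close>)
  next
    fix t :: real assume "t \<in> {0<..<1}" and *: "(\<lambda>d. real (l d)) \<sim>[sequentially] (\<lambda>d. t * real d)"
    then have t: "0 < t" "t < 1" by auto
    have ld: "(\<lambda>d. real (flow.l d) / real d) \<longlonglongrightarrow> t"
      using asymp_equiv_imp_ratio_tendsto[OF * t(1) d_pos] unfolding l .
    show "weak_conv_m (\<lambda>d. sqrt_measure (root_measure (q d)))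
        (dilate_measure t (rect_power 1 (sqrt_measure \<mu>) (1 / t)))"
      if "n \<in> o(\<lambda>d. real d)"
      unfolding q by (rule flow.sqrt_measure_limit_rect_power[OF t ld smalloD_tendsto[OF that]])
    show "\<exists>\<mu>' C' C\<^sub>\<alpha>. symmetric_distribution \<mu>' \<and>
             weak_conv_m (\<lambda>d. sqrt_measure (root_measure (q d))) \<mu>' \<and>
             is_rect_R (t / (t + \<alpha>)) \<mu>' C' \<and>
             is_rect_R (1 / (1 + \<alpha>)) (sqrt_measure \<mu>) C\<^sub>\<alpha> \<and>
             (\<forall>\<^sub>F z in nhds 0. C' z = 1 / of_real t *
                C\<^sub>\<alpha> (of_real (t * (\<alpha> + t) / (\<alpha> + 1)) * z))"
      if \<alpha>: "\<alpha> > 0" "n \<sim>[sequentially] (\<lambda>d. \<alpha> * real d)" for \<alpha>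
    proof -
      obtain \<nu> K K' where \<nu>: "real_distribution \<nu>"
        and *: "weak_conv_m (\<lambda>d. sqrt_measure (root_measure (flow.q d))) (sqrt_measure \<nu>)"
        "is_rect_R (t / (t + \<alpha>)) (sqrt_measure \<nu>) K'" "is_rect_R (1 / (1 + \<alpha>)) (sqrt_measure \<mu>) K"
        "\<forall>\<^sub>F z in nhds 0. K' z = 1 / of_real t * K (of_real (t * (\<alpha> + t) / (\<alpha> + 1)) * z)"
        by (rule flow.sqrt_measure_limit[OF t ld asymp_equiv_imp_ratio_tendsto[OF \<alpha>(2,1) d_pos] less_imp_le[OF \<alpha>(1)]])
      show ?thesis
        unfolding q using * symmetric_distribution_sqrt_measure[OF \<nu>] by blast
    qed
  }
qed

end
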